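(* Let $\mathsf{T}$ be an analysis-suitable T-mesh for degrees $(p,q)$, with associated T-spline basis functions $\{N_A : A\in\mathsf{A}\}$ (with respect to given global open knot vectors). Then this basis is locally linearly independent: for every Bézier element of $\mathsf{T}$, with parametric domain $\hat\Omega^e$, the functions $N_A$, $A\in\mathsf{A}$, that are not identically zero on $\hat\Omega^e$ are linearly independent on $\hat\Omega^e$. That is, if $\mathsf{A}^e$ is the set of anchors $A\in\mathsf{A}$ for which $N_A$ is not identically zero on $\hat\Omega^e$, and real numbers $c_A$ ($A\in\mathsf{A}^e$) satisfy $\sum_{A\in\mathsf{A}^e}c_A N_A(s,t)=0$ for all $(s,t)\in\hat\Omega^e$, then $c_A=0$ for all $A\in\mathsf{A}^e$.
   Context: Polynomial degrees. $p,q\ge 1$ are integers, the polynomial degrees in the horizontal and vertical direction. T-mesh. A T-mesh $\mathsf{T}$ is a rectangular partition of the index domain $[1,m]\times[1,n]$ all of whose vertices $\{i,j\}$ have integer coordinates. Cells are open, rectangular and non-overlapping. An edge is a horizontal or vertical line segment between vertices that does not intersect any cell (edges are minimal: they contain no vertex in their interior). The valence of a vertex is the number of edges meeting at it; all vertices in $(1,m)\times(1,n)$ have valence three or four, and those of valence three are called T-junctions. The horizontal skeleton $h\mathsf{S}$ and vertical skeleton $v\mathsf{S}$ are the unions of all horizontal, respectively vertical, edges together with the associated vertices; $\mathsf{S}=h\mathsf{S}\cup v\mathsf{S}$. The active region is $\mathsf{AR}=[1+\lfloor (p+1)/2\rfloor,\,m-\lfloor (p+1)/2\rfloor]\times[1+\lfloor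 (q+1)/2\rfloor,\,n-\lfloor (q+1)/2\rfloor]$, and the frame region $\mathsf{FR}$ is the closure of $([1,m]\times[1,n])\setminus\mathsf{AR}$. All T-meshes are assumed admissible: $\mathsf{S}$ contains the full vertical segments $\{i\}\times[1,n]$ for $i=1,\dots,\lfloor (p+1)/2\rfloor+1$ and $i=m-\lfloor (p+1)/2\rfloor,\dots,m$, the full horizontal segments $[1,m]\times\{j\}$ for $j=1,\dots,\lfloor (q+1)/2\rfloor+1$ and $j=n-\lfloor (q+1)/2\rfloor,\dots,n$, and every vertex in $\mathsf{FR}\cap\big((1,m)\times(1,n)\big)$ has valence four. T-junction extensions and analysis-suitability. Extensions are closed line segments originating at T-junctions. For a T-junction whose missing edge is horizontal, the (horizontal) face extension is traced from the T-junction along a horizontal line in the direction of the missing edge until $\lfloor (p+1)/2\rfloor$ vertical edges or vertices are intersected (not counting the T-junction itself); the (horizontal) edge extension is traced in the opposite direction until $\lceil (p-1)/2\rceil$ vertical edges or vertices are intersected. The horizontal T-junction extension is the union of both. Vertical T-junction extensions (for T-junctions whose missing edge is vertical) are defined analogously, with $q$ in place of $p$ and the roles of horizontal and vertical exchanged. $\mathsf{T}$ is analysis-suitable if no horizontal T-junction extension intersects a vertical T-junction extension (as closed segments). The extended T-mesh $\mathsf{T}_{ext}$ is obtained by adding all T-junction extensions to $\mathsf{T}$; the collection of its open rectangular cells is $\mathsf{C}_{ext}$. Anchors. The set $\mathsf{A}$ of anchors consists of the following objects of $\mathsf{T}$ lying in $\mathsf{AR}$: the vertices $\{i\}\times\{j\}$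 if $p,q$ are both odd; the horizontal edges $(i_1,i_2)\times\{j\}$ if $p$ is even and $q$ is odd; the vertical edges $\{i\}\times(j_1,j_2)$ if $p$ is odd and $q$ is even; the cells $(i_1,i_2)\times(j_1,j_2)$ if $p,q$ are both even. Local index vectors. For an anchor $A=a\times b$, let $I_h(A)$ be the set of indices $i\in\{1,\dots,m\}$ with $\{i\}\times\bar b\subset v\mathsf{S}$ and $I_v(A)$ the set of indices $j\in\{1,\dots,n\}$ with $\bar a\times\{j\}\subset h\mathsf{S}$ (bar denotes closure). The horizontal local index vector $\{i_1<\dots<i_{p+2}\}$ consists of $p+2$ consecutive elements of $I_h(A)$, positioned so that $\{i_{(p+3)/2}\}=a$ if $p$ is odd and $(i_{p/2+1},i_{p/2+2})=a$ if $p$ is even. The vertical local index vector $\{j_1<\dots<j_{q+2}\}$ is defined in the same way from $I_v(A)$, $b$ and $q$. Knots and basis functions. The global knot vectors $\{s_1,\dots,s_m\}$ and $\{t_1,\dots,t_n\}$ are open: $0=s_1=\dots=s_{p+1}<s_{p+2}\le\dots\le s_{m-p-1}<s_{m-p}=\dots=s_m=1$ and $0=t_1=\dots=t_{q+1}<t_{q+2}\le\dots\le t_{n-q-1}<t_{n-q}=\dots=t_n=1$. For $A\in\mathsf{A}$ the T-spline basis function on $[0,1]^2$ is $N_A(s,t)=N[s_{i_1},\dots,s_{i_{p+2}}](s)\,N[t_{j_1},\dots,t_{j_{q+2}}](t)$, where $N[x_1,\dots,x_{d+2}]$ denotes the univariate B-spline of degree $d$ with knots $x_1\le\dots\le x_{d+2}$,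 given by the Cox–de Boor recursion $N[x_1,x_2](x)=1$ if $x_1\le x<x_2$ and $0$ otherwise, and $N[x_1,\dots,x_{d+2}](x)=\frac{x-x_1}{x_{d+1}-x_1}N[x_1,\dots,x_{d+1}](x)+\frac{x_{d+2}-x}{x_{d+2}-x_2}N[x_2,\dots,x_{d+2}](x)$, with terms having zero denominator taken to be zero. Bézier elements. A Bézier element is a cell $(i_l,i_r)\times(j_b,j_t)\in\mathsf{C}_{ext}$ of positive parametric area, i.e. $s_{i_l}<s_{i_r}$ and $t_{j_b}<t_{j_t}$; its parametric domain is $\hat\Omega^e=(s_{i_l},s_{i_r})\times(t_{j_b},t_{j_t})$. *)

theory Defs
  imports "HOL-Analysis.Analysis"
begin

text \<open>
  A box \<open>((i1, i2), (j1, j2))\<close> with \<open>i1 \<le> i2\<close> and \<open>j1 \<le> j2\<close> encodes all kinds of mesh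
  objects \<open>a \<times> b\<close>: a component \<open>(i1, i2)\<close> with \<open>i1 < i2\<close> stands for an open interval and a
  component \<open>(i, i)\<close> for the singleton of \<open>i\<close>.
\<close>

type_synonym ibox = "(nat \<times> nat) \<times> (nat \<times> nat)"

fun open_box :: "ibox \<Rightarrow> (real \<times> real) set" where
  "open_box ((i1, i2), (j1, j2)) = {real i1<..<real i2} \<times> {real j1<..<real j2}"

fun closed_box :: "ibox \<Rightarrow> (real \<times> real) set" where
  "closed_box ((i1, i2), (j1, j2)) = {real i1..real i2} \<times> {real j1..real j2}"

text \<open>A mesh is given by its dimensions \<open>m\<close>, \<open>n\<close> and its collection of cells.\<close>

record tmesh =
  xdim :: nat
  ydim :: nat
  cells :: "ibox set"

definition index_domain :: "tmesh \<Rightarrow> (real \<times> real) set" where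
  "index_domain T = {1..real (xdim T)} \<times> {1..real (ydim T)}"

definition vertices :: "tmesh \<Rightarrow> (nat \<times> nat) set" where
  "vertices T = (\<Union>((i1, i2), (j1, j2)) \<in> cells T. {i1, i2} \<times> {j1, j2})"

definition inner_vertices :: "tmesh \<Rightarrow> (nat \<times> nat) set" where
  "inner_vertices T = {(i, j) \<in> vertices T. 1 < i \<and> i < xdim T \<and> 1 < j \<and> j < ydim T}"

definition hedges :: "tmesh \<Rightarrow> ibox set" where
  "hedges T = {((i1, i2), (j, j)) | i1 i2 j. i1 < i2 \<and> (i1, j) \<in> vertices T \<and> (i2, j) \<in> vertices T
     \<and> (\<forall>i. i1 < i \<and> i < i2 \<longrightarrow> (i, j) \<notin> vertices T)
     \<and> (\<forall>C \<in> cells T. closed_box ((i1, i2), (j, j)) \<inter> open_box C = {})}"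

definition vedges :: "tmesh \<Rightarrow> ibox set" where
  "vedges T = {((i, i), (j1, j2)) | i j1 j2. j1 < j2 \<and> (i, j1) \<in> vertices T \<and> (i, j2) \<in> vertices T
     \<and> (\<forall>j. j1 < j \<and> j < j2 \<longrightarrow> (i, j) \<notin> vertices T)
     \<and> (\<forall>C \<in> cells T. closed_box ((i, i), (j1, j2)) \<inter> open_box C = {})}"

definition valence :: "tmesh \<Rightarrow> nat \<times> nat \<Rightarrow> nat" where
  "valence T v =
     card {E \<in> hedges T \<union> vedges T. (real (fst v), real (snd v)) \<in> closed_box E}"

definition hskel :: "tmesh \<Rightarrow> (real \<times> real) set" where
  "hskel T = (\<Union>E \<in> hedges T. closed_box E)"

definition vskel :: "tmesh \<Rightarrow> (real \<times> real) set" where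
  "vskel T = (\<Union>E \<in> vedges T. closed_box E)"

definition skel :: "tmesh \<Rightarrow> (real \<times> real) set" where
  "skel T = hskel T \<union> vskel T"

definition is_tmesh :: "tmesh \<Rightarrow> bool" where
  "is_tmesh T \<longleftrightarrow>
     (\<forall>((i1, i2), (j1, j2)) \<in> cells T. i1 < i2 \<and> j1 < j2)
   \<and> (\<forall>C \<in> cells T. \<forall>D \<in> cells T. C \<noteq> D \<longrightarrow> open_box C \<inter> open_box D = {})
   \<and> (\<Union>C \<in> cells T. closed_box C) = index_domain T
   \<and> (\<forall>v \<in> inner_vertices T. valence T v = 3 \<or> valence T v = 4)"

definition active_region :: "nat \<Rightarrow> nat \<Rightarrow> tmesh \<Rightarrow> (real \<times> real) set" where
  "active_region p q T =
     {1 + real ((p + 1) div 2)..real (xdim T) - real ((p + 1) div 2)}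
   \<times> {1 + real ((q + 1) div 2)..real (ydim T) - real ((q + 1) div 2)}"

definition frame_region :: "nat \<Rightarrow> nat \<Rightarrow> tmesh \<Rightarrow> (real \<times> real) set" where
  "frame_region p q T = closure (index_domain T - active_region p q T)"

text \<open>
  The truncated subtractions below are exact for meshes carrying open knot vectors, whose
  length for degree \<open>p\<close> is at least \<open>2 * p + 2\<close>.
\<close>

definition admissible :: "nat \<Rightarrow> nat \<Rightarrow> tmesh \<Rightarrow> bool" where
  "admissible p q T \<longleftrightarrow>
     (\<forall>i \<in> {1..(p + 1) div 2 + 1} \<union> {xdim T - (p + 1) div 2..xdim T}.
        {real i} \<times> {1..real (ydim T)} \<subseteq> skel T)
   \<and> (\<forall>j \<in> {1..(q + 1) div 2 + 1} \<union> {ydim T - (q + 1) div 2..ydim T}.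
        {1..real (xdim T)} \<times> {real j} \<subseteq> skel T)
   \<and> (\<forall>(i, j) \<in> inner_vertices T. (real i, real j) \<in> frame_region p q T \<longrightarrow> valence T (i, j) = 4)"

definition tjunctions :: "tmesh \<Rightarrow> (nat \<times> nat) set" where
  "tjunctions T = {v \<in> inner_vertices T. valence T v = 3}"

text \<open>
  The end points of a trace that starts at \<open>i\<close> and stops as soon as \<open>k\<close> elements of \<open>H\<close>
  other than \<open>i\<close> have been met; for \<open>k = 0\<close> this is \<open>i\<close> itself.
\<close>

definition trace_up :: "nat set \<Rightarrow> nat \<Rightarrow> nat \<Rightarrow> nat" where
  "trace_up H k i = (LEAST e. i \<le> e \<and> k \<le> card {x \<in> H. i < x \<and> x \<le> e})"

definition trace_down :: "nat set \<Rightarrow> nat \<Rightarrow> nat \<Rightarrow> nat" where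
  "trace_down H k i = (GREATEST e. e \<le> i \<and> k \<le> card {x \<in> H. e \<le> x \<and> x < i})"

definition row_hits :: "tmesh \<Rightarrow> nat \<Rightarrow> nat set" where
  "row_hits T j = {i. (real i, real j) \<in> vskel T \<or> (i, j) \<in> vertices T}"

definition col_hits :: "tmesh \<Rightarrow> nat \<Rightarrow> nat set" where
  "col_hits T i = {j. (real i, real j) \<in> hskel T \<or> (i, j) \<in> vertices T}"

text \<open>
  Each extension consists of the face part, traced across \<open>\<lfloor>(p + 1) / 2\<rfloor>\<close> hits in the
  direction of the missing edge, and the edge part, traced across
  \<open>\<lceil>(p - 1) / 2\<rceil> = p div 2\<close> hits in the opposite direction.
\<close>

definition hexts :: "nat \<Rightarrow> tmesh \<Rightarrow> ibox set" where
  "hexts p T =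
     {((trace_down (row_hits T j) (p div 2) i, trace_up (row_hits T j) ((p + 1) div 2) i), (j, j))
        | i j. (i, j) \<in> tjunctions T \<and> (\<nexists>k. ((i, k), (j, j)) \<in> hedges T)}
   \<union> {((trace_down (row_hits T j) ((p + 1) div 2) i, trace_up (row_hits T j) (p div 2) i), (j, j))
        | i j. (i, j) \<in> tjunctions T \<and> (\<nexists>k. ((k, i), (j, j)) \<in> hedges T)}"

definition vexts :: "nat \<Rightarrow> tmesh \<Rightarrow> ibox set" where
  "vexts q T =
     {((i, i), (trace_down (col_hits T i) (q div 2) j, trace_up (col_hits T i) ((q + 1) div 2) j))
        | i j. (i, j) \<in> tjunctions T \<and> (\<nexists>k. ((i, i), (j, k)) \<in> vedges T)}
   \<union> {((i, i), (trace_down (col_hits T i) ((q + 1) div 2) j, trace_up (col_hits T i) (q div 2) j))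
        | i j. (i, j) \<in> tjunctions T \<and> (\<nexists>k. ((i, i), (k, j)) \<in> vedges T)}"

definition analysis_suitable :: "nat \<Rightarrow> nat \<Rightarrow> tmesh \<Rightarrow> bool" where
  "analysis_suitable p q T \<longleftrightarrow>
     (\<forall>E \<in> hexts p T. \<forall>F \<in> vexts q T. closed_box E \<inter> closed_box F = {})"

definition ext_skel :: "nat \<Rightarrow> nat \<Rightarrow> tmesh \<Rightarrow> (real \<times> real) set" where
  "ext_skel p q T = skel T \<union> (\<Union>E \<in> hexts p T \<union> vexts q T. closed_box E)"

text \<open>The cells of the extended mesh are the open rectangles cut out by its skeleton.\<close>

definition ext_cells :: "nat \<Rightarrow> nat \<Rightarrow> tmesh \<Rightarrow> ibox set" where
  "ext_cells p q T = {((i1, i2), (j1, j2)) | i1 i2 j1 j2. i1 < i2 \<and> j1 < j2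
     \<and> open_box ((i1, i2), (j1, j2)) \<inter> ext_skel p q T = {}
     \<and> frontier (open_box ((i1, i2), (j1, j2))) \<subseteq> ext_skel p q T}"

definition anchors :: "nat \<Rightarrow> nat \<Rightarrow> tmesh \<Rightarrow> ibox set" where
  "anchors p q T =
     {A \<in> (if odd p \<and> odd q then {((i, i), (j, j)) | i j. (i, j) \<in> vertices T}
            else if even p \<and> odd q then hedges T
            else if odd p \<and> even q then vedges T
            else cells T).
      closed_box A \<subseteq> active_region p q T}"

fun hindices :: "tmesh \<Rightarrow> ibox \<Rightarrow> nat set" where
  "hindices T (a, (j1, j2)) = {i \<in> {1..xdim T}. {real i} \<times> {real j1..real j2} \<subseteq> vskel T}"

fun vindices :: "tmesh \<Rightarrow> ibox \<Rightarrow> nat set" where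
  "vindices T ((i1, i2), b) = {j \<in> {1..ydim T}. {real i1..real i2} \<times> {real j} \<subseteq> hskel T}"

text \<open>
  List positions count from 0, so \<open>v ! k\<close> is the entry with index \<open>k + 1\<close> in the usual
  numbering \<open>i_1 < \<dots> < i_(d + 2)\<close>.  The equation for \<open>set v\<close> says that the entries are consecutive
  in \<open>I\<close>.
\<close>

definition is_local_index_vector :: "nat \<Rightarrow> nat set \<Rightarrow> nat \<times> nat \<Rightarrow> nat list \<Rightarrow> bool" where
  "is_local_index_vector d I a v \<longleftrightarrow>
     length v = d + 2 \<and> sorted_wrt (<) v \<and> set v = I \<inter> {hd v..last v}
   \<and> (if odd d then (v ! ((d + 1) div 2), v ! ((d + 1) div 2)) = a
      else (v ! (d div 2), v ! (d div 2 + 1)) = a)"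

definition local_index_vector :: "nat \<Rightarrow> nat set \<Rightarrow> nat \<times> nat \<Rightarrow> nat list" where
  "local_index_vector d I a = (THE v. is_local_index_vector d I a v)"

text \<open>Knots are numbered from 1; no entry outside \<open>{1..m}\<close> is relevant.\<close>

definition open_knot_vector :: "nat \<Rightarrow> nat \<Rightarrow> (nat \<Rightarrow> real) \<Rightarrow> bool" where
  "open_knot_vector p m s \<longleftrightarrow>
     2 * p + 2 \<le> m
   \<and> (\<forall>i \<in> {1..p + 1}. s i = 0) \<and> (\<forall>i \<in> {m - p..m}. s i = 1)
   \<and> s (p + 1) < s (p + 2) \<and> s (m - p - 1) < s (m - p)
   \<and> (\<forall>i \<in> {1..<m}. s i \<le> s (i + 1))"

text \<open>
  \<open>bspline d \<xi> k\<close> is the B-spline of degree \<open>d\<close> with knots \<open>\<xi> k, \<dots>, \<xi> (k + d + 1)\<close>.  Terms with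
  zero denominator vanish because of \<open>x / 0 = 0\<close>.
\<close>

primrec bspline :: "nat \<Rightarrow> (nat \<Rightarrow> real) \<Rightarrow> nat \<Rightarrow> real \<Rightarrow> real" where
  "bspline 0 \<xi> k x = (if \<xi> k \<le> x \<and> x < \<xi> (k + 1) then 1 else 0)"
| "bspline (Suc d) \<xi> k x =
     (x - \<xi> k) / (\<xi> (k + d + 1) - \<xi> k) * bspline d \<xi> k x
   + (\<xi> (k + d + 2) - x) / (\<xi> (k + d + 2) - \<xi> (k + 1)) * bspline d \<xi> (k + 1) x"

definition tspline ::
    "nat \<Rightarrow> nat \<Rightarrow> tmesh \<Rightarrow> (nat \<Rightarrow> real) \<Rightarrow> (nat \<Rightarrow> real) \<Rightarrow> ibox \<Rightarrow> real \<times> real \<Rightarrow> real" where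
  "tspline p q T s t A z =
     bspline p (\<lambda>k. s (local_index_vector p (hindices T A) (fst A) ! k)) 0 (fst z)
   * bspline q (\<lambda>k. t (local_index_vector q (vindices T A) (snd A) ! k)) 0 (snd z)"

fun parametric_domain :: "(nat \<Rightarrow> real) \<Rightarrow> (nat \<Rightarrow> real) \<Rightarrow> ibox \<Rightarrow> (real \<times> real) set" where
  "parametric_domain s t ((i1, i2), (j1, j2)) = {s i1<..<s i2} \<times> {t j1<..<t j2}"

definition bezier_elements ::
    "nat \<Rightarrow> nat \<Rightarrow> tmesh \<Rightarrow> (nat \<Rightarrow> real) \<Rightarrow> (nat \<Rightarrow> real) \<Rightarrow> ibox set" where
  "bezier_elements p q T s t =
     {((i1, i2), (j1, j2)) \<in> ext_cells p q T. s i1 < s i2 \<and> t j1 < t j2}"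

definition active_anchors ::
    "nat \<Rightarrow> nat \<Rightarrow> tmesh \<Rightarrow> (nat \<Rightarrow> real) \<Rightarrow> (nat \<Rightarrow> real) \<Rightarrow> ibox \<Rightarrow> ibox set" where
  "active_anchors p q T s t E =
     {A \<in> anchors p q T. \<exists>z \<in> parametric_domain s t E. tspline p q T s t A z \<noteq> 0}"

end

theory Submission
  imports Defs
begin

text \<open>
  Any two anchors \<open>A \<noteq> B\<close> of an analysis-suitable mesh have, in at least one of the two directions,
  local index vectors that are different windows of one common increasing sequence.  Otherwise some
  column \<open>c\<close> belongs to one anchor but not to the other, and so does some row \<open>r\<close>; the T-junctions
  causing this lie on column \<open>c\<close> and row \<open>r\<close>, and both their extensions contain the point \<open>(c, r)\<close>.
  An extension reaches that far because the mesh lines it crosses on its way belong to the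
  index set of the anchor: this is shown by induction over the distance from the anchor, since a
  violation would yield a pair of crossing extensions closer to it.

  The same argument shows that over the support of an anchor its knot lines lie in the extended mesh,
  so that each basis function is a product of two polynomials on a Bezier element.  For a knot
  window \<open>\<xi>\<close> let \<open>\<lambda>\<^sub>\<xi>\<close> be the evaluation of the blossom at the inner knots of \<open>\<xi>\<close>.  It depends on
  \<open>\<xi>\<close> and the element only, and it annihilates the B-splines of all other windows of any common
  knot sequence.  Hence the tensor product of the functionals of \<open>A\<close> is \<open>1\<close> on \<open>N\<^sub>A\<close> and \<open>0\<close> on the
  other basis functions that are active on the element.
\<close>

text \<open>No knot sequence is common to all T-spline basis functions, so a dual basis cannot be
  taken from one B-spline space. The functional of a window, however, reads only that window and one
  knot span in it. A common sequence is therefore needed only for two functions at a time and in one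
  direction, since one vanishing factor kills a tensor product. The lengths of the extensions match
  a count: between the centre of an anchor and an end of its index support lie at most
  \<open>p div 2\<close> index columns. If the missing edge of a T-junction points away from the
  anchor, its face part crosses all those in the way: for odd \<open>p\<close> because
  \<open>(p + 1) div 2\<close> exceeds the count, for even \<open>p\<close> because the near side of
  the anchor is an index column already passed. If the missing edge points towards the anchor, only
  the shorter edge part helps, but then the T-junction sits on an index column itself, and one fewer
  remains to be crossed.\<close>

section \<open>Dual functionals of B-splines\<close>

text \<open>The polynomial to which a B-spline restricts on an interval (u, v) without knots inside;
  derivatives and blossoms need an actual polynomial. Division by zero removes the terms of
  collapsed knot intervals just as in \<open>bspline\<close>.\<close>

primrec bpoly :: "real \<Rightarrow> real \<Rightarrow> nat \<Rightarrow> (nat \<Rightarrow> real) \<Rightarrow> nat \<Rightarrow> real poly" where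
  "bpoly u v 0 \<xi> k = (if \<xi> k \<le> u \<and> v \<le> \<xi> (k + 1) then 1 else 0)"
| "bpoly u v (Suc d) \<xi> k =
     smult (1 / (\<xi> (k + d + 1) - \<xi> k)) ([:- \<xi> k, 1:] * bpoly u v d \<xi> k)
   + smult (1 / (\<xi> (k + d + 2) - \<xi> (k + 1))) ([:\<xi> (k + d + 2), -1:] * bpoly u v d \<xi> (k + 1))"

lemma poly_bpoly:
  assumes "u < x" "x < v" "\<And>i. k \<le> i \<Longrightarrow> i \<le> k + d + 1 \<Longrightarrow> \<xi> i \<le> u \<or> v \<le> \<xi> i"
  shows "poly (bpoly u v d \<xi> k) x = bspline d \<xi> k x"
  using assms(3)
proof (induction d arbitrary: k)
  case 0
  have "\<xi> k \<le> u \<or> v \<le> \<xi> k" "\<xi> (k + 1) \<le> u \<or> v \<le> \<xi> (k + 1)"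
    using 0[of k] 0[of "k + 1"] by auto
  with assms(1,2) have "(\<xi> k \<le> u \<and> v \<le> \<xi> (k + 1)) = (\<xi> k \<le> x \<and> x < \<xi> (k + 1))"
    by linarith
  then show ?case by simp
next
  case (Suc d)
  have "poly (bpoly u v d \<xi> k) x = bspline d \<xi> k x"
    "poly (bpoly u v d \<xi> (k + 1)) x = bspline d \<xi> (k + 1) x"
    using Suc.IH[of k] Suc.IH[of "k + 1"] Suc.prems by auto
  then show ?case by (simp add: algebra_simps add_divide_distrib diff_divide_distrib)
qed

lemma bpoly_shift: "bpoly u v d \<xi> (k + c) = bpoly u v d (\<lambda>i. \<xi> (i + c)) k"
proof (induction d arbitrary: k)
  case (Suc d)
  show ?case using Suc[of k] Suc[of "Suc k"] by (simp add: add_ac)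
qed simp

lemma bpoly_cong:
  assumes "\<And>i. k \<le> i \<Longrightarrow> i \<le> k + d + 1 \<Longrightarrow> \<xi> i = \<eta> i"
  shows "bpoly u v d \<xi> k = bpoly u v d \<eta> k"
  using assms
proof (induction d arbitrary: k)
  case (Suc d)
  have "bpoly u v d \<xi> k = bpoly u v d \<eta> k" "bpoly u v d \<xi> (k + 1) = bpoly u v d \<eta> (k + 1)"
    using Suc.IH[of k] Suc.IH[of "k + 1"] Suc.prems by auto
  then show ?case using Suc.prems by simp
qed simp

text \<open>Some degree-zero piece covering (u, v) must survive in the recursion. Its index becomes
  the parameter \<open>a\<close> of \<open>dual\<close>.\<close>

lemma bpoly_nonzero:
  assumes "bpoly u v d \<xi> k \<noteq> 0"
  shows "\<exists>a. k \<le> a \<and> a \<le> k + d \<and> \<xi> a \<le> u \<and> v \<le> \<xi> (a + 1)"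
  using assms
proof (induction d arbitrary: k)
  case 0
  then show ?case by (auto split: if_splits)
next
  case (Suc d)
  then have "bpoly u v d \<xi> k \<noteq> 0 \<or> bpoly u v d \<xi> (k + 1) \<noteq> 0" by auto
  then show ?case
  proof
    assume "bpoly u v d \<xi> k \<noteq> 0"
    from Suc.IH[OF this] show ?thesis by auto
  next
    assume "bpoly u v d \<xi> (k + 1) \<noteq> 0"
    from Suc.IH[OF this] obtain a where "k + 1 \<le> a" "a \<le> k + 1 + d" "\<xi> a \<le> u" "v \<le> \<xi> (a + 1)"
      by auto
    then show ?thesis by (intro exI[of _ a]) auto
  qed
qed

text \<open>The classical derivative formula, with repeated knots allowed because of x / 0 = 0. In
  the induction step the product rule yields the wanted difference once from the linear factors, and
  \<open>Suc d\<close> more times from the lower derivatives, which recombine by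
  \<open>key\<close>.\<close>

lemma pderiv_bpoly:
  assumes "mono \<xi>"
  shows "pderiv (bpoly u v (Suc d) \<xi> k) = smult (real (Suc d))
    (smult (1 / (\<xi> (k + d + 1) - \<xi> k)) (bpoly u v d \<xi> k)
     - smult (1 / (\<xi> (k + d + 2) - \<xi> (k + 1))) (bpoly u v d \<xi> (k + 1)))"
proof (induction d arbitrary: k)
  case 0
  have c: "\<exists>c. bpoly u v 0 \<xi> j = [:c:]" for j
    by (auto intro: exI[of _ 1] exI[of _ 0])
  from c[of k] c[of "k + 1"] obtain b c where "bpoly u v 0 \<xi> k = [:b:]" "bpoly u v 0 \<xi> (k + 1) = [:c:]"
    by blast
  then show ?case
    by (simp add: pderiv_add pderiv_smult pderiv_pCons del: bpoly.simps(1))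
next
  case (Suc d)
  let ?B = "\<lambda>d k. bpoly u v d \<xi> k"
  define e where "e i j = 1 / (\<xi> (k + j) - \<xi> (k + i))" for i j
  \<comment> \<open>Each reciprocal cancels against its difference unless
    \<open>\<xi> (k + d + 2) = \<xi> (k + 1)\<close>, and in that case \<open>e 1 (d + 2)\<close> is
    0 on both sides. By monotonicity the two longer knot intervals are nondegenerate whenever the
    shorter one is.\<close>
  have pos: "e 1 (d + 2) * e 0 (d + 2) * (\<xi> (k + d + 2) - \<xi> k)
           = e 1 (d + 2) * e 1 (d + 3) * (\<xi> (k + d + 3) - \<xi> (k + 1))"
  proof (cases "\<xi> (k + d + 2) = \<xi> (k + 1)")
    case True then show ?thesis by (simp add: e_def add_ac)
  next
    case False
    have "\<xi> k \<le> \<xi> (k + 1)" "\<xi> (k + 1) \<le> \<xi> (k + d + 2)" "\<xi> (k + d + 2) \<le> \<xi> (k + d + 3)"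
      using assms by (auto intro: monoD)
    then show ?thesis using False by (simp add: e_def add.assoc)
  qed
  have k3: "k + 1 + d + 2 = k + d + 3" "k + 1 + d + 1 = k + d + 2" "k + 1 + 1 = k + 2"
    "k + Suc d + 1 = k + d + 2" "k + Suc d + 2 = k + d + 3" by simp_all
  have D: "pderiv (?B (Suc d) k) = smult (real (Suc d)) (smult (e 0 (d + 1)) (?B d k) - smult (e 1 (d + 2)) (?B d (k + 1)))"
    unfolding Suc[of k] by (simp only: e_def add.assoc add_0_right)
  have D': "pderiv (?B (Suc d) (k + 1)) = smult (real (Suc d)) (smult (e 1 (d + 2)) (?B d (k + 1)) - smult (e 2 (d + 3)) (?B d (k + 2)))"
    unfolding Suc[of "k + 1"] k3 by (simp only: e_def add.assoc)
  have B: "?B (Suc d) k = smult (e 0 (d + 1)) ([:- \<xi> k, 1:] * ?B d k) + smult (e 1 (d + 2)) ([:\<xi> (k + d + 2), -1:] * ?B d (k + 1))"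
    unfolding bpoly.simps by (simp only: e_def add.assoc add_0_right)
  have B': "?B (Suc d) (k + 1) = smult (e 1 (d + 2)) ([:- \<xi> (k + 1), 1:] * ?B d (k + 1)) + smult (e 2 (d + 3)) ([:\<xi> (k + d + 3), -1:] * ?B d (k + 2))"
    unfolding bpoly.simps k3 by (simp only: e_def add.assoc)
  have BB: "?B (Suc (Suc d)) k = smult (e 0 (d + 2)) ([:- \<xi> k, 1:] * ?B (Suc d) k) + smult (e 1 (d + 3)) ([:\<xi> (k + d + 3), -1:] * ?B (Suc d) (k + 1))"
    unfolding bpoly.simps(2)[of u v "Suc d"] k3 by (simp only: e_def add.assoc add_0_right)
  \<comment> \<open>After expansion the two sides differ only in the coefficient of
    \<open>bpoly u v d \<xi> (k + 1)\<close>, which \<open>pos\<close> settles.\<close>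
  have key: "smult (e 0 (d + 2)) ([:- \<xi> k, 1:] * (smult (e 0 (d + 1)) (?B d k) - smult (e 1 (d + 2)) (?B d (k + 1))))
      + smult (e 1 (d + 3)) ([:\<xi> (k + d + 3), -1:] * (smult (e 1 (d + 2)) (?B d (k + 1)) - smult (e 2 (d + 3)) (?B d (k + 2))))
      = smult (e 0 (d + 2)) (?B (Suc d) k) - smult (e 1 (d + 3)) (?B (Suc d) (k + 1))" (is "?L = ?R")
  proof (rule poly_eq_poly_eq_iff[THEN iffD1], rule ext)
    fix x
    have "poly ?L x - poly ?R x = (e 1 (d + 2) * e 1 (d + 3) * (\<xi> (k + d + 3) - \<xi> (k + 1))
       - e 1 (d + 2) * e 0 (d + 2) * (\<xi> (k + d + 2) - \<xi> k)) * poly (?B d (k + 1)) x"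
      unfolding B B' by (simp add: algebra_simps del: bpoly.simps)
    then have "poly ?L x - poly ?R x = 0" unfolding pos by (simp only: diff_self mult_zero_left)
    then show "poly ?L x = poly ?R x" by (simp only: right_minus_eq)
  qed
  have "pderiv (?B (Suc (Suc d)) k) = smult (e 0 (d + 2)) (?B (Suc d) k) - smult (e 1 (d + 3)) (?B (Suc d) (k + 1))
     + smult (real (Suc d)) (smult (e 0 (d + 2)) ([:- \<xi> k, 1:] * (smult (e 0 (d + 1)) (?B d k) - smult (e 1 (d + 2)) (?B d (k + 1))))
      + smult (e 1 (d + 3)) ([:\<xi> (k + d + 3), -1:] * (smult (e 1 (d + 2)) (?B d (k + 1)) - smult (e 2 (d + 3)) (?B d (k + 2)))))"
    unfolding BB pderiv_add pderiv_smult pderiv_mult D D'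
    by (rule poly_eq_poly_eq_iff[THEN iffD1], rule ext)
       (simp add: pderiv_pCons algebra_simps del: bpoly.simps)
  also have "\<dots> = smult (real (Suc (Suc d))) (smult (e 0 (d + 2)) (?B (Suc d) k) - smult (e 1 (d + 3)) (?B (Suc d) (k + 1)))"
    unfolding key by (rule poly_eq_poly_eq_iff[THEN iffD1], rule ext)
       (simp add: algebra_simps del: bpoly.simps)
  finally show ?case unfolding k3 by (simp only: e_def add.assoc add_0_right)
qed

text \<open>Fixes one argument of the blossom of a polynomial of degree at most \<open>d\<close>.\<close>

definition polar :: "nat \<Rightarrow> real \<Rightarrow> real poly \<Rightarrow> real poly" where
  "polar d z f = f + smult (1 / real d) ([:z, -1:] * pderiv f)"

lemma polar_add: "polar d z (f + g) = polar d z f + polar d z g"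
  by (rule poly_eq_poly_eq_iff[THEN iffD1], rule ext) (simp add: polar_def pderiv_add algebra_simps)

lemma polar_smult: "polar d z (smult c f) = smult c (polar d z f)"
  by (rule poly_eq_poly_eq_iff[THEN iffD1], rule ext) (simp add: polar_def pderiv_smult algebra_simps)

text \<open>The derivative formula trades the variable in the linear factors of the recursion for
  the constant \<open>z\<close>. If \<open>z\<close> is a suitable knot, a coefficient vanishes;
  \<open>dual_bpoly\<close> lives on this.\<close>

lemma polar_bpoly:
  assumes "mono \<xi>"
  shows "polar (Suc d) z (bpoly u v (Suc d) \<xi> k) =
     smult ((z - \<xi> k) / (\<xi> (k + d + 1) - \<xi> k)) (bpoly u v d \<xi> k)
   + smult ((\<xi> (k + d + 2) - z) / (\<xi> (k + d + 2) - \<xi> (k + 1))) (bpoly u v d \<xi> (k + 1))"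
proof (rule poly_eq_poly_eq_iff[THEN iffD1], rule ext)
  fix x
  define e f where "e = 1 / (\<xi> (k + d + 1) - \<xi> k)" and "f = 1 / (\<xi> (k + d + 2) - \<xi> (k + 1))"
  define P Q where "P = poly (bpoly u v d \<xi> k) x" and "Q = poly (bpoly u v d \<xi> (k + 1)) x"
  have "poly (polar (Suc d) z (bpoly u v (Suc d) \<xi> k)) x
      = poly (bpoly u v (Suc d) \<xi> k) x + 1 / real (Suc d) * ((z - x) * (real (Suc d) * (e * P - f * Q)))"
    unfolding polar_def pderiv_bpoly[OF assms] e_def f_def P_def Q_def by (simp add: algebra_simps add_divide_distrib diff_divide_distrib del: bpoly.simps of_nat_Suc)
  also have "\<dots> = poly (bpoly u v (Suc d) \<xi> k) x + (z - x) * (e * P - f * Q)"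
    by (simp del: bpoly.simps of_nat_Suc)
  also have "poly (bpoly u v (Suc d) \<xi> k) x = e * (x - \<xi> k) * P + f * (\<xi> (k + d + 2) - x) * Q"
    unfolding bpoly.simps e_def[symmetric] f_def[symmetric] by (simp add: P_def Q_def algebra_simps)
  also have "\<dots> + (z - x) * (e * P - f * Q) = e * (z - \<xi> k) * P + f * (\<xi> (k + d + 2) - z) * Q"
    by (simp only: algebra_simps)
  finally show "poly (polar (Suc d) z (bpoly u v (Suc d) \<xi> k)) x = poly (smult ((z - \<xi> k) / (\<xi> (k + d + 1) - \<xi> k)) (bpoly u v d \<xi> k)
   + smult ((\<xi> (k + d + 2) - z) / (\<xi> (k + d + 2) - \<xi> (k + 1))) (bpoly u v d \<xi> (k + 1))) x"
    by (simp add: e_def f_def P_def Q_def)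
qed

text \<open>
  The blossom evaluated at the inner knots \<open>\<xi> (l + 1), \<dots>, \<xi> (l + d)\<close>, inserted in such an order
  that the remaining knots always surround the knot interval with index \<open>a\<close>.
\<close>

primrec dual :: "nat \<Rightarrow> (nat \<Rightarrow> real) \<Rightarrow> nat \<Rightarrow> nat \<Rightarrow> real poly \<Rightarrow> real" where
  "dual a \<xi> 0 l f = poly f 0"
| "dual a \<xi> (Suc d) l f =
     (if l < a then dual a \<xi> d (l + 1) (polar (Suc d) (\<xi> (l + 1)) f)
      else dual a \<xi> d l (polar (Suc d) (\<xi> (l + d + 1)) f))"

lemma dual_add: "dual a \<xi> d l (f + g) = dual a \<xi> d l f + dual a \<xi> d l g"
  by (induction d arbitrary: l f g) (simp_all add: polar_add)

lemma dual_smult: "dual a \<xi> d l (smult c f) = c * dual a \<xi> d l f"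
  by (induction d arbitrary: l f) (simp_all add: polar_smult)

lemma dual_zero: "dual a \<xi> d l 0 = 0"
  using dual_smult[of a \<xi> d l 0 0] by simp

lemma dual_sum: "dual a \<xi> d l (\<Sum>x\<in>S. f x) = (\<Sum>x\<in>S. dual a \<xi> d l (f x))"
  by (induction S rule: infinite_finite_induct) (simp_all add: dual_zero dual_add)

lemma dual_shift: "dual (a + c) \<xi> d (l + c) f = dual a (\<lambda>i. \<xi> (i + c)) d l f"
proof (induction d arbitrary: l f)
  case (Suc d)
  show ?case using Suc[of "Suc l"] Suc[of l] by (simp add: add_ac)
qed simp

lemma dual_cong:
  assumes "\<And>i. l \<le> i \<Longrightarrow> i \<le> l + d + 1 \<Longrightarrow> \<xi> i = \<eta> i"
  shows "dual a \<xi> d l f = dual a \<eta> d l f"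
  using assms
proof (induction d arbitrary: l f)
  case (Suc d)
  have "dual a \<xi> d l g = dual a \<eta> d l g" "dual a \<xi> d (l + 1) g = dual a \<eta> d (l + 1) g" for g
    using Suc.IH[of "l + 1" g] Suc.IH[of l g] Suc.prems by auto
  then show ?case using Suc.prems by simp
qed simp

text \<open>By induction the functional of lower degree picks out a single B-spline, so only two
  values of \<open>k\<close> matter. For one of them the coefficient has numerator 0. For the other
  it is a quotient of equal differences, which is 1 and not 0 / 0 because the two knots in it lie on
  either side of the span \<open>a\<close>.\<close>

lemma dual_bpoly:
  assumes "mono \<xi>" "u < v" "\<xi> a \<le> u" "v \<le> \<xi> (a + 1)" "l \<le> a" "a \<le> l + d"
  shows "dual a \<xi> d l (bpoly u v d \<xi> k) = (if k = l then 1 else 0)"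
  using assms(5,6)
proof (induction d arbitrary: l k)
  case 0
  have ka: "k = a" if "\<xi> k \<le> u" "v \<le> \<xi> (k + 1)"
  proof (rule ccontr)
    assume "k \<noteq> a"
    then have "k + 1 \<le> a \<or> a + 1 \<le> k" by auto
    then have "\<xi> (k + 1) \<le> \<xi> a \<or> \<xi> (a + 1) \<le> \<xi> k"
      using assms(1) by (meson monoD)
    with that assms show False by linarith
  qed
  have "l = a" using 0 by simp
  then have "(\<xi> k \<le> u \<and> v \<le> \<xi> (k + 1)) = (k = l)" using ka assms(3,4) by blast
  then show ?case by (simp only: bpoly.simps dual.simps if_distrib[of "\<lambda>f. poly f 0"] poly_1 poly_0)
next
  case (Suc d)
  have *: "\<xi> i < \<xi> j" if "i \<le> a" "a + 1 \<le> j" for i j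
    using monoD[OF assms(1) that(1)] monoD[OF assms(1) that(2)] assms(2-4) by linarith
  show ?case
  proof (cases "l < a")
    case True
    have IH: "dual a \<xi> d (l + 1) (bpoly u v d \<xi> k') = (if k' = l + 1 then 1 else 0)" for k'
      using Suc.IH[of "l + 1" k'] Suc.prems True by simp
    have "dual a \<xi> (Suc d) l (bpoly u v (Suc d) \<xi> k) =
      (\<xi> (l + 1) - \<xi> k) / (\<xi> (k + d + 1) - \<xi> k) * (if k = l + 1 then 1 else 0)
      + (\<xi> (k + d + 2) - \<xi> (l + 1)) / (\<xi> (k + d + 2) - \<xi> (k + 1)) * (if k + 1 = l + 1 then 1 else 0)"
      using True unfolding dual.simps polar_bpoly[OF assms(1)] dual_add dual_smult IH by simp
    also have "\<dots> = (if k = l then 1 else 0)"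
      using *[of "l + 1" "l + d + 2"] True Suc.prems by auto
    finally show ?thesis .
  next
    case False
    with Suc.prems have la: "l = a" by simp
    have IH: "dual a \<xi> d l (bpoly u v d \<xi> k') = (if k' = l then 1 else 0)" for k'
      using Suc.IH[of l k'] Suc.prems False by simp
    have "dual a \<xi> (Suc d) l (bpoly u v (Suc d) \<xi> k) =
      (\<xi> (l + d + 1) - \<xi> k) / (\<xi> (k + d + 1) - \<xi> k) * (if k = l then 1 else 0)
      + (\<xi> (k + d + 2) - \<xi> (l + d + 1)) / (\<xi> (k + d + 2) - \<xi> (k + 1)) * (if k + 1 = l then 1 else 0)"
      using False unfolding dual.simps polar_bpoly[OF assms(1)] dual_add dual_smult IH by simp
    also have "\<dots> = (if k = l then 1 else 0)"
      using *[of l "l + d + 1"] la by auto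
    finally show ?thesis .
  qed
qed

section \<open>Increasing lists as windows of a common sequence\<close>

lemma sorted_wrt_less_bounds:
  assumes "sorted_wrt (<) (v :: nat list)" "x \<in> set v"
  shows "hd v \<le> x" "x \<le> last v"
proof -
  obtain k where k: "k < length v" "v ! k = x" using assms(2) by (auto simp: in_set_conv_nth)
  then have ne: "v \<noteq> []" by auto
  have "v ! 0 \<le> v ! k" "v ! k \<le> v ! (length v - 1)"
    using k assms(1) by (auto intro!: sorted_nth_mono simp: strict_sorted_iff)
  then show "hd v \<le> x" "x \<le> last v" using k ne by (simp_all add: hd_conv_nth last_conv_nth)
qed

text \<open>Since \<open>w\<close> increases, filtering it below, within and above the range of
  \<open>v\<close> cuts it into three consecutive pieces. The middle one has the same entries as
  \<open>v\<close> and hence equals it.\<close>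

lemma sorted_window:
  fixes v w :: "nat list"
  assumes "sorted_wrt (<) v" "sorted_wrt (<) w" "v \<noteq> []" "set v = set w \<inter> {hd v..last v}"
  shows "\<exists>l. l + length v \<le> length w \<and> (\<forall>k < length v. v ! k = w ! (l + k))"
proof -
  let ?a = "hd v" and ?b = "last v"
  have le: "?a \<le> ?b" using sorted_wrt_less_bounds(1)[OF assms(1) last_in_set[OF assms(3)]] .
  have split: "filter (\<lambda>x. x < ?a) w @ filter (\<lambda>x. ?a \<le> x \<and> x \<le> ?b) w @ filter (\<lambda>x. ?b < x) w = w"
    using assms(2)
  proof (induction w)
    case (Cons x w)
    have IH: "filter (\<lambda>x. x < ?a) w @ filter (\<lambda>x. ?a \<le> x \<and> x \<le> ?b) w @ filter (\<lambda>x. ?b < x) w = w"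
      using Cons by simp
    have nil: "filter (\<lambda>y. y < ?a) w = []" if "?a \<le> x"
      using Cons.prems that by (auto simp: filter_empty_conv)
    have nil2: "filter (\<lambda>y. ?a \<le> y \<and> y \<le> ?b) w = []" if "?b < x"
      using Cons.prems that by (auto simp: filter_empty_conv)
    consider "x < ?a" | "?a \<le> x" "x \<le> ?b" | "?b < x" by linarith
    then show ?case
    proof cases
      case 1 then show ?thesis using IH le by simp
    next
      case 2 then show ?thesis using IH nil by simp
    next
      case 3 then show ?thesis using IH nil nil2 le by simp
    qed
  qed simp
  have "filter (\<lambda>x. ?a \<le> x \<and> x \<le> ?b) w = v"
  proof (rule sorted_distinct_set_unique)
    show "sorted (filter (\<lambda>x. ?a \<le> x \<and> x \<le> ?b) w)" "distinct (filter (\<lambda>x. ?a \<le> x \<and> x \<le> ?b) w)"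
      using assms(2) by (auto simp: strict_sorted_iff sorted_wrt_filter)
    show "sorted v" "distinct v" using assms(1) by (auto simp: strict_sorted_iff)
    show "set (filter (\<lambda>x. ?a \<le> x \<and> x \<le> ?b) w) = set v"
      by (subst assms(4)) auto
  qed
  with split obtain u z where w: "w = u @ v @ z" by metis
  have "\<forall>k < length v. v ! k = w ! (length u + k)" unfolding w by (simp add: nth_append)
  moreover have "length u + length v \<le> length w" unfolding w by simp
  ultimately show ?thesis by blast
qed

text \<open>For increasing lists this is equivalent to both being windows of the sorted union of
  their entries, but it mentions no offsets and can be tested entry by entry.\<close>

definition overlap :: "nat list \<Rightarrow> nat list \<Rightarrow> bool" where
  "overlap v w \<longleftrightarrow> set v \<inter> {hd w..last w} \<subseteq> set w \<and> set w \<inter> {hd v..last v} \<subseteq> set v"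

text \<open>Windows are compared by index and not by knot value, so repeated knots do no harm:
  different lists start at different positions of \<open>z\<close>, and \<open>dual_bpoly\<close>
  tells positions apart.\<close>

lemma dual_overlap:
  fixes s :: "nat \<Rightarrow> real"
  assumes mono: "mono_on D s" and D: "set v \<subseteq> D" "set w \<subseteq> D"
    and v: "sorted_wrt (<) v" "length v = d + 2" and w: "sorted_wrt (<) w" "length w = d + 2"
    and ov: "overlap v w" and a: "x < y" "a \<le> d" "s (v ! a) \<le> x" "y \<le> s (v ! (a + 1))"
  shows "dual a (\<lambda>k. s (v ! k)) d 0 (bpoly x y d (\<lambda>k. s (w ! k)) 0) = (if v = w then 1 else 0)"
proof -
  define z where "z = sorted_list_of_set (set v \<union> set w)"
  have z: "sorted_wrt (<) z" "set z = set v \<union> set w" by (simp_all add: z_def)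
  have ne: "v \<noteq> []" "w \<noteq> []" using v w by auto
  have "set v = set z \<inter> {hd v..last v}" "set w = set z \<inter> {hd w..last w}"
    using ov sorted_wrt_less_bounds[OF v(1)] sorted_wrt_less_bounds[OF w(1)]
    unfolding z(2) overlap_def by auto
  with sorted_window[OF v(1) z(1) ne(1)] sorted_window[OF w(1) z(1) ne(2)]
  obtain l k where l: "l + (d + 2) \<le> length z" "\<And>i. i < d + 2 \<Longrightarrow> v ! i = z ! (l + i)"
    and k: "k + (d + 2) \<le> length z" "\<And>i. i < d + 2 \<Longrightarrow> w ! i = z ! (k + i)"
    using v(2) w(2) by metis
  \<comment> \<open>Past the end of \<open>z\<close> the last knot is repeated, so that the sequence
    is monotone on all of \<open>nat\<close>.\<close>
  define \<xi> where "\<xi> i = s (z ! min i (length z - 1))" for i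
  have lz: "0 < length z" using l by linarith
  have "mono \<xi>"
  proof (rule monoI)
    fix i j :: nat assume "i \<le> j"
    have 1: "z ! min i (length z - 1) \<le> z ! min j (length z - 1)"
      using z(1) lz \<open>i \<le> j\<close> by (intro sorted_nth_mono) (auto simp: strict_sorted_iff min_less_iff_disj)
    have "z ! min i (length z - 1) \<in> set z" "z ! min j (length z - 1) \<in> set z"
      using lz by (auto intro!: nth_mem simp: min_less_iff_disj)
    then have "z ! min i (length z - 1) \<in> D" "z ! min j (length z - 1) \<in> D"
      using D z(2) by auto
    with 1 show "\<xi> i \<le> \<xi> j" using mono by (auto simp: \<xi>_def mono_on_def)
  qed
  have \<xi>v: "s (v ! i) = \<xi> (i + l)" if "i \<le> d + 1" for i
  proof -
    have "min (i + l) (length z - 1) = l + i" using l(1) that by linarith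
    then show ?thesis using l(2)[of i] that by (simp add: \<xi>_def)
  qed
  have \<xi>w: "s (w ! i) = \<xi> (i + k)" if "i \<le> d + 1" for i
  proof -
    have "min (i + k) (length z - 1) = k + i" using k(1) that by linarith
    then show ?thesis using k(2)[of i] that by (simp add: \<xi>_def)
  qed
  have "dual a (\<lambda>k. s (v ! k)) d 0 (bpoly x y d (\<lambda>k. s (w ! k)) 0)
      = dual a (\<lambda>i. \<xi> (i + l)) d 0 (bpoly x y d (\<lambda>k. s (w ! k)) 0)"
    using \<xi>v by (intro dual_cong) auto
  also have "\<dots> = dual a (\<lambda>i. \<xi> (i + l)) d 0 (bpoly x y d (\<lambda>i. \<xi> (i + k)) 0)"
    using \<xi>w by (intro arg_cong[where f = "dual a (\<lambda>i. \<xi> (i + l)) d 0"] bpoly_cong) auto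
  also have "\<dots> = dual (a + l) \<xi> d l (bpoly x y d \<xi> k)"
    using dual_shift[of a l \<xi> d 0] bpoly_shift[of x y d \<xi> 0 k] by simp
  also have "\<dots> = (if k = l then 1 else 0)"
    using a \<xi>v[of a] \<xi>v[of "a + 1"] by (intro dual_bpoly[OF \<open>mono \<xi>\<close>]) auto
  also have "k = l \<longleftrightarrow> v = w"
  proof
    assume "k = l" then show "v = w" using l k v w by (intro nth_equalityI) auto
  next
    assume "v = w"
    then have "z ! l = z ! k" using l(2)[of 0] k(2)[of 0] by simp
    then show "k = l" using z(1) l(1) k(1) nth_eq_iff_index_eq[of z k l] by (auto simp: strict_sorted_iff)
  qed
  finally show ?thesis .
qed

section \<open>T-junction extensions seen from an anchor\<close>

lemma card_uminus_Collect: "card {k :: int. P (- k)} = card {k. P k}"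
  by (rule bij_betw_same_card[of uminus]) (auto simp: bij_betw_def image_iff, metis minus_minus)

lemma int_change_down:
  fixes c :: int
  assumes "P c" "\<not> P b" "b \<le> c"
  shows "\<exists>x. b < x \<and> x \<le> c \<and> P x \<and> \<not> P (x - 1)"
proof -
  have "P b \<or> (\<exists>x. b < x \<and> x \<le> c \<and> P x \<and> \<not> P (x - 1))"
    using \<open>b \<le> c\<close>
  proof (induction b rule: int_le_induct)
    case base then show ?case using assms(1) by simp
  next
    case (step i)
    then show ?case by (smt (verit))
  qed
  then show ?thesis using assms(2) by blast
qed

lemma int_change_up:
  fixes c :: int
  assumes "P c" "\<not> P b" "c \<le> b"
  shows "\<exists>x. c \<le> x \<and> x < b \<and> P x \<and> \<not> P (x + 1)"
  using int_change_down[of "\<lambda>x. P (- x)" "- c" "- b"] assms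
  by (metis (no_types, opaque_lifting) add.inverse_inverse diff_conv_add_uminus minus_add_distrib neg_le_iff_le neg_less_iff_less minus_diff_eq uminus_add_conv_diff add.commute minus_le_iff minus_less_iff)

text \<open>
  Coordinates are doubled, so that even integers stand for mesh lines and odd ones for midpoints of
  unit edges: \<open>h x y\<close> says that \<open>(x / 2, y / 2)\<close> lies on the horizontal skeleton, and \<open>hx x y\<close> that
  it lies on a horizontal T-junction extension.  The anchor is \<open>[a1, a2] \<times> [b1, b2]\<close>, and its index
  support is \<open>[xl, xh] \<times> [yl, yh]\<close>.
\<close>

locale anchor_grid =
  fixes p q :: nat and h v hx vx :: "int \<Rightarrow> int \<Rightarrow> bool" and a1 a2 b1 b2 xl xh yl yh :: int
  assumes h_closed: "odd x \<Longrightarrow> h x y \<Longrightarrow> h (x + 1) y \<and> h (x - 1) y"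
    and v_closed: "odd y \<Longrightarrow> v x y \<Longrightarrow> v x (y + 1) \<and> v x (y - 1)"
    and tee_h: "\<lbrakk>even x; even y; h x y; \<not> h (x + \<sigma>) y; \<sigma> \<in> {1, -1};
        x \<in> {xl..xh}; x + \<sigma> \<in> {xl..xh}; y \<in> {yl..yh}\<rbrakk> \<Longrightarrow> v x (y + 1) \<and> v x (y - 1)"
    and tee_v: "\<lbrakk>even x; even y; v x y; \<not> v x (y + \<sigma>); \<sigma> \<in> {1, -1};
        x \<in> {xl..xh}; y \<in> {yl..yh}; y + \<sigma> \<in> {yl..yh}\<rbrakk> \<Longrightarrow> h (x + 1) y \<and> h (x - 1) y"
    and face_h: "\<lbrakk>even x; even y; h x y; \<not> h (x + \<sigma>) y; \<sigma> \<in> {1, -1};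
        x \<in> {xl..xh}; x + \<sigma> \<in> {xl..xh}; y \<in> {yl..yh}; c \<in> {xl..xh}; 0 < \<sigma> * (c - x);
        card {k. even k \<and> 0 < \<sigma> * (k - x) \<and> 0 < \<sigma> * (c - k) \<and> v k y} < (p + 1) div 2\<rbrakk> \<Longrightarrow> hx c y"
    and edge_h: "\<lbrakk>even x; even y; h x y; \<not> h (x + \<sigma>) y; \<sigma> \<in> {1, -1};
        x \<in> {xl..xh}; x + \<sigma> \<in> {xl..xh}; y \<in> {yl..yh}; c \<in> {xl..xh}; 0 \<le> \<sigma> * (x - c);
        c = x \<or> card {k. even k \<and> 0 < \<sigma> * (x - k) \<and> 0 < \<sigma> * (k - c) \<and> v k y} < p div 2\<rbrakk> \<Longrightarrow> hx c y"
    and face_v: "\<lbrakk>even x; even y; v x y; \<not> v x (y + \<sigma>); \<sigma> \<in> {1, -1};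
        x \<in> {xl..xh}; y \<in> {yl..yh}; y + \<sigma> \<in> {yl..yh}; c \<in> {yl..yh}; 0 < \<sigma> * (c - y);
        card {k. even k \<and> 0 < \<sigma> * (k - y) \<and> 0 < \<sigma> * (c - k) \<and> h x k} < (q + 1) div 2\<rbrakk> \<Longrightarrow> vx x c"
    and edge_v: "\<lbrakk>even x; even y; v x y; \<not> v x (y + \<sigma>); \<sigma> \<in> {1, -1};
        x \<in> {xl..xh}; y \<in> {yl..yh}; y + \<sigma> \<in> {yl..yh}; c \<in> {yl..yh}; 0 \<le> \<sigma> * (y - c);
        c = y \<or> card {k. even k \<and> 0 < \<sigma> * (y - k) \<and> 0 < \<sigma> * (k - c) \<and> h x k} < q div 2\<rbrakk> \<Longrightarrow> vx x c"
    and disj: "hx c r \<Longrightarrow> vx c r \<Longrightarrow> False"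
    and evens: "even a1" "even a2" "even b1" "even b2"
    and odd_p: "odd p \<Longrightarrow> a1 = a2" and even_p: "even p \<Longrightarrow> a1 < a2"
    and odd_q: "odd q \<Longrightarrow> b1 = b2" and even_q: "even q \<Longrightarrow> b1 < b2"
    and bounds: "xl \<le> a1" "a2 \<le> xh" "yl \<le> b1" "b2 \<le> yh"
    and inner_h: "\<lbrakk>even y; b1 < y; y < b2\<rbrakk> \<Longrightarrow> \<not> h ((a1 + a2) div 2) y"
    and inner_v: "\<lbrakk>even x; a1 < x; x < a2\<rbrakk> \<Longrightarrow> \<not> v x ((b1 + b2) div 2)"
    and side_v: "y \<in> {b1..b2} \<Longrightarrow> v a1 y \<and> v a2 y"
    and side_h: "x \<in> {a1..a2} \<Longrightarrow> h x b1 \<and> h x b2"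
    and right: "card {k. even k \<and> (a1 + a2) div 2 < k \<and> k < xh \<and> (\<forall>y\<in>{b1..b2}. v k y)} \<le> p div 2"
    and left: "card {k. even k \<and> xl < k \<and> k < (a1 + a2) div 2 \<and> (\<forall>y\<in>{b1..b2}. v k y)} \<le> p div 2"
    and above: "card {k. even k \<and> (b1 + b2) div 2 < k \<and> k < yh \<and> (\<forall>x\<in>{a1..a2}. h x k)} \<le> q div 2"
    and below: "card {k. even k \<and> yl < k \<and> k < (b1 + b2) div 2 \<and> (\<forall>x\<in>{a1..a2}. h x k)} \<le> q div 2"
begin

text \<open>The locale is symmetric under exchange of the axes and under reflections. The main
  estimates can thus be made for columns in the quadrant to the upper right of the centre and be
  carried over by interpretation.\<close>

lemma transposed:
  "anchor_grid q p (\<lambda>x y. v y x) (\<lambda>x y. h y x) (\<lambda>x y. vx y x) (\<lambda>x y. hx y x) b1 b2 a1 a2 yl yh xl xh"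
  by (intro anchor_grid.intro)
    ((rule v_closed h_closed tee_v tee_h face_v edge_v face_h edge_h inner_v inner_h side_h side_v; assumption)
     | fact evens odd_p even_p odd_q even_q bounds above below right left | (rule disj, assumption+))+

lemma reflected:
  "anchor_grid p q (\<lambda>x. h (- x)) (\<lambda>x. v (- x)) (\<lambda>x. hx (- x)) (\<lambda>x. vx (- x)) (- a2) (- a1) b1 b2 (- xh) (- xl) yl yh"
proof
  fix x y \<sigma> c r :: int
  show "h (- (x + 1)) y \<and> h (- (x - 1)) y" if "odd x" "h (- x) y"
    using h_closed[of "- x" y] that by simp
  show "v (- x) (y + 1) \<and> v (- x) (y - 1)" if "odd y" "v (- x) y"
    using v_closed that by blast
  show "hx (- c) y"
    if "even x" "even y" "h (- x) y" "\<not> h (- (x + \<sigma>)) y" "\<sigma> \<in> {1, -1}" "x \<in> {-xh..-xl}" "x + \<sigma> \<in> {-xh..-xl}"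
      "y \<in> {yl..yh}" "c \<in> {-xh..-xl}" "0 < \<sigma> * (c - x)"
      and card: "card {k. even k \<and> 0 < \<sigma> * (k - x) \<and> 0 < \<sigma> * (c - k) \<and> v (- k) y} < (p + 1) div 2"
  proof (rule face_h[of "- x" y "- \<sigma>"])
    show "card {k. even k \<and> 0 < - \<sigma> * (k - - x) \<and> 0 < - \<sigma> * (- c - k) \<and> v k y} < (p + 1) div 2"
      using card card_uminus_Collect[of "\<lambda>k. even k \<and> 0 < - \<sigma> * (k - - x) \<and> 0 < - \<sigma> * (- c - k) \<and> v k y"]
      by (simp add: algebra_simps)
  qed (use that(1-10) in \<open>auto simp: algebra_simps\<close>)
  show "hx (- c) y"
    if "even x" "even y" "h (- x) y" "\<not> h (- (x + \<sigma>)) y" "\<sigma> \<in> {1, -1}" "x \<in> {-xh..-xl}" "x + \<sigma> \<in> {-xh..-xl}"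
      "y \<in> {yl..yh}" "c \<in> {-xh..-xl}" "0 \<le> \<sigma> * (x - c)"
      and card: "c = x \<or> card {k. even k \<and> 0 < \<sigma> * (x - k) \<and> 0 < \<sigma> * (k - c) \<and> v (- k) y} < p div 2"
  proof (rule edge_h[of "- x" y "- \<sigma>"])
    show "- c = - x \<or> card {k. even k \<and> 0 < - \<sigma> * (- x - k) \<and> 0 < - \<sigma> * (k - - c) \<and> v k y} < p div 2"
      using card card_uminus_Collect[of "\<lambda>k. even k \<and> 0 < - \<sigma> * (- x - k) \<and> 0 < - \<sigma> * (k - - c) \<and> v k y"]
      by (simp add: algebra_simps)
  qed (use that(1-10) in \<open>auto simp: algebra_simps\<close>)
  have \<alpha>: "(- a2 + - a1) div 2 = - ((a1 + a2) div 2)" using evens by (auto elim!: evenE)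
  show "card {k. even k \<and> (- a2 + - a1) div 2 < k \<and> k < - xl \<and> (\<forall>y\<in>{b1..b2}. v (- k) y)} \<le> p div 2"
    using left card_uminus_Collect[of "\<lambda>k. even k \<and> xl < k \<and> k < (a1 + a2) div 2 \<and> (\<forall>y\<in>{b1..b2}. v k y)"]
    unfolding \<alpha> by (simp add: less_minus_iff[of _ xl] minus_less_iff conj_ac)
  show "card {k. even k \<and> - xh < k \<and> k < (- a2 + - a1) div 2 \<and> (\<forall>y\<in>{b1..b2}. v (- k) y)} \<le> p div 2"
    using right card_uminus_Collect[of "\<lambda>k. even k \<and> (a1 + a2) div 2 < k \<and> k < xh \<and> (\<forall>y\<in>{b1..b2}. v k y)"]
    unfolding \<alpha> by (simp add: less_minus_iff[of _ "(a1 + a2) div 2"] minus_less_iff conj_ac)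
  have im: "(\<forall>x\<in>{- a2..- a1}. P (- x)) = (\<forall>x\<in>{a1..a2}. P x)" for P :: "int \<Rightarrow> bool"
    by (metis atLeastAtMost_iff minus_le_iff le_minus_iff add.inverse_inverse)
  show "card {k. even k \<and> (b1 + b2) div 2 < k \<and> k < yh \<and> (\<forall>x\<in>{-a2..-a1}. h (- x) k)} \<le> q div 2"
    using above by (simp add: im[of "\<lambda>x. h x _"])
  show "card {k. even k \<and> yl < k \<and> k < (b1 + b2) div 2 \<and> (\<forall>x\<in>{-a2..-a1}. h (- x) k)} \<le> q div 2"
    using below by (simp add: im[of "\<lambda>x. h x _"])
  show "v (- x) (y + 1) \<and> v (- x) (y - 1)" if "even x" "even y" "h (- x) y" "\<not> h (- (x + \<sigma>)) y" "\<sigma> \<in> {1, -1}" "x \<in> {-xh..-xl}" "x + \<sigma> \<in> {-xh..-xl}"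
      "y \<in> {yl..yh}"
    using tee_h[of "- x" y "- \<sigma>"] that by auto
  show "h (- (x + 1)) y \<and> h (- (x - 1)) y" if "even x" "even y" "v (- x) y" "\<not> v (- x) (y + \<sigma>)" "\<sigma> \<in> {1, -1}" "x \<in> {-xh..-xl}"
      "y \<in> {yl..yh}" "y + \<sigma> \<in> {yl..yh}"
    using tee_v[of "- x" y \<sigma>] that by auto
  show "vx (- x) c" if "even x" "even y" "v (- x) y" "\<not> v (- x) (y + \<sigma>)" "\<sigma> \<in> {1, -1}"
        "x \<in> {-xh..-xl}" "y \<in> {yl..yh}" "y + \<sigma> \<in> {yl..yh}" "c \<in> {yl..yh}" "0 < \<sigma> * (c - y)"
        "card {k. even k \<and> 0 < \<sigma> * (k - y) \<and> 0 < \<sigma> * (c - k) \<and> h (- x) k} < (q + 1) div 2"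
    using face_v[of "- x" y \<sigma> c] that by auto
  show "vx (- x) c" if "even x" "even y" "v (- x) y" "\<not> v (- x) (y + \<sigma>)" "\<sigma> \<in> {1, -1}"
        "x \<in> {-xh..-xl}" "y \<in> {yl..yh}" "y + \<sigma> \<in> {yl..yh}" "c \<in> {yl..yh}" "0 \<le> \<sigma> * (y - c)"
        "c = y \<or> card {k. even k \<and> 0 < \<sigma> * (y - k) \<and> 0 < \<sigma> * (k - c) \<and> h (- x) k} < q div 2"
    using edge_v[of "- x" y \<sigma> c] that by auto
  show "\<not> h (- ((- a2 + - a1) div 2)) y" if "even y" "b1 < y" "y < b2"
    unfolding \<alpha> using inner_h that by simp
qed (use disj evens odd_p even_p odd_q even_q bounds inner_v side_h side_v in auto)

text \<open>The centre of the anchor. Mesh lines are going to be classified by whether they pass it,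
  in place of a condition along a whole side of the anchor; \<open>index_iff_v\<close> shows that
  this is the same.\<close>

definition "\<alpha> = (a1 + a2) div 2"
definition "\<beta> = (b1 + b2) div 2"
definition "right_cols = {k. even k \<and> \<alpha> < k \<and> k < xh \<and> (\<forall>y\<in>{b1..b2}. v k y)}"

lemma a_le: "a1 \<le> a2" using odd_p even_p by (cases "even p") auto
lemma b_le: "b1 \<le> b2" using odd_q even_q by (cases "even q") auto

lemma \<alpha>_bounds: "a1 \<le> \<alpha>" "\<alpha> \<le> a2" "even p \<Longrightarrow> a1 < \<alpha>" "even p \<Longrightarrow> \<alpha> < a2"
proof -
  obtain x y where "a1 = 2 * x" "a2 = 2 * y" using evens by (auto elim!: evenE)
  then show "a1 \<le> \<alpha>" "\<alpha> \<le> a2" "even p \<Longrightarrow> a1 < \<alpha>" "even p \<Longrightarrow> \<alpha> < a2"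
    using a_le even_p unfolding \<alpha>_def by auto
qed

lemma \<beta>_bounds: "b1 \<le> \<beta>" "\<beta> \<le> b2" "even q \<Longrightarrow> b1 < \<beta>" "even q \<Longrightarrow> \<beta> < b2"
proof -
  obtain x y where "b1 = 2 * x" "b2 = 2 * y" using evens by (auto elim!: evenE)
  then show "b1 \<le> \<beta>" "\<beta> \<le> b2" "even q \<Longrightarrow> b1 < \<beta>" "even q \<Longrightarrow> \<beta> < b2"
    using b_le even_q unfolding \<beta>_def by auto
qed

lemma card_right_cols: "card right_cols \<le> p div 2"
  using right by (simp add: right_cols_def \<alpha>_def)

lemma finite_right_cols: "finite right_cols"
  by (rule finite_subset[of _ "{\<alpha>..xh}"]) (auto simp: right_cols_def)

text \<open>One index column outside the counted set brings the count strictly below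
  \<open>p div 2\<close>, as a trace of that length requires.\<close>

lemma card_less_right_cols:
  assumes "S \<subseteq> right_cols" "x \<in> right_cols" "x \<notin> S"
  shows "card S < p div 2"
proof -
  have "card S < card right_cols"
    using assms by (intro psubset_card_mono finite_right_cols) auto
  then show ?thesis using card_right_cols by simp
qed

lemma change_down_h:
  assumes "h c y" "\<not> h b y" "b \<le> c"
  obtains x where "b < x" "x \<le> c" "h x y" "\<not> h (x - 1) y" "even x"
proof -
  obtain x where x: "b < x" "x \<le> c" "h x y" "\<not> h (x - 1) y"
    using int_change_down[of "\<lambda>x. h x y" c b] assms by auto
  moreover have "even x" using h_closed[of x y] x by auto
  ultimately show ?thesis using that by blast
qed

text \<open>On the way from \<open>c\<close> to \<open>b\<close> the column is lost right after some
  \<open>y\<close>, in direction \<sigma>. A midpoint of a unit edge has both neighbours on the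
  skeleton, so \<open>y\<close> is even.\<close>

lemma change_v:
  assumes "v x c" "\<not> v x b"
  obtains y \<sigma> where "v x y" "\<not> v x (y + \<sigma>)" "\<sigma> \<in> {1, -1}" "even y"
    "y \<in> {min b c..max b c}" "y + \<sigma> \<in> {min b c..max b c}" "y \<noteq> b"
proof (cases "b \<le> c")
  case True
  obtain y where y: "b < y" "y \<le> c" "v x y" "\<not> v x (y - 1)"
    using int_change_down[of "v x" c b] assms True by auto
  moreover have "even y" using v_closed[of y x] y by auto
  ultimately show ?thesis using True by (intro that[of y "- 1"]) auto
next
  case False
  obtain y where y: "c \<le> y" "y < b" "v x y" "\<not> v x (y + 1)"
    using int_change_up[of "v x" c b] assms False by auto
  moreover have "even y" using v_closed[of y x] y by auto
  ultimately show ?thesis using False by (intro that[of y 1]) auto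
qed

text \<open>
  Take the leftmost such junction.  The row through it reaches it from a T-junction on the left,
  and by minimality all columns hit in between belong to the anchor's index set, so that the edge
  extension of that T-junction is long enough to meet the junction.
\<close>

lemma no_inner_tee_v:
  assumes "even c" "even y" "v c y" "\<not> v c (y + \<tau>)" "\<tau> \<in> {1, -1}" "b1 < y" "y < b2" "\<alpha> \<le> c" "c \<le> xh"
  shows False
  using assms
proof (induction "nat (c - \<alpha>)" arbitrary: c y \<tau> rule: less_induct)
  case less
  have box: "c \<in> {xl..xh}" "y \<in> {yl..yh}" "y + \<tau> \<in> {yl..yh}"
    using less.prems bounds \<alpha>_bounds by auto
  have hc: "h (c + 1) y" "h (c - 1) y" using tee_v[OF less.prems(1-5) box] by auto
  then have "h c y" using h_closed[of "c - 1" y] less.prems(1) by auto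
  \<comment> \<open>No row strictly between the sides of the anchor passes its centre, so the row
    through the junction must begin to the right of the centre.\<close>
  moreover have "\<not> h \<alpha> y" using inner_h less.prems by (auto simp: \<alpha>_def)
  ultimately obtain x where x: "\<alpha> < x" "x \<le> c" "h x y" "\<not> h (x - 1) y" "even x"
    using change_down_h less.prems(8) by blast
  then have "x < c" using hc by (cases "x = c") auto
  have xbox: "x \<in> {xl..xh}" "x + - 1 \<in> {xl..xh}" using x box \<alpha>_bounds bounds by auto
  have hits: "k \<in> right_cols" if k: "even k" "x \<le> k" "k < c" "v k y" for k
  proof -
    have "v k y'" if y': "y' \<in> {b1..b2}" for y'
    proof (rule ccontr)
      assume "\<not> v k y'"
      from change_v[OF k(4) this] obtain y1 \<sigma> where y1: "v k y1" "\<not> v k (y1 + \<sigma>)" "\<sigma> \<in> {1, -1}" "even y1"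
        "y1 \<in> {min y' y..max y' y}" "y1 + \<sigma> \<in> {min y' y..max y' y}" "y1 \<noteq> y'" by blast
      have "b1 < y1" "y1 < b2" using y1 y' less.prems by auto
      then show False using less.hyps[OF _ k(1) y1(4,1,2,3)] k x less.prems by auto
    qed
    then show ?thesis using k x less.prems by (auto simp: right_cols_def)
  qed
  have "v x (y + 1)" using tee_h[OF x(5) less.prems(2) x(3) _ _ xbox box(2)] x(4) by auto
  then have "v x y" using v_closed[of "y + 1" x] less.prems(2) by auto
  then have "x \<in> right_cols" using hits x \<open>x < c\<close> by auto
  \<comment> \<open>\<open>x\<close> is an index column that is not counted here, which makes the
    bound strict.\<close>
  then have "card {k. even k \<and> x < k \<and> k < c \<and> v k y} < p div 2"
    using hits by (intro card_less_right_cols[of _ x]) auto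
  then have "hx c y"
    using edge_h[OF x(5) less.prems(2) x(3) _ _ xbox box(2,1)] x \<open>x < c\<close> by (simp add: conj_ac)
  \<comment> \<open>An extension contains its own T-junction even if \<open>q div 2\<close> is 0;
    this is the first disjunct in \<open>edge_v\<close>.\<close>
  moreover have "vx c y" using edge_v[OF less.prems(1-5) box] box less.prems(5) by auto
  ultimately show False using disj by blast
qed

text \<open>A column through the centre row that does not span the anchor would end at a T-junction
  strictly inside the height of the anchor.\<close>

lemma col_uniform:
  assumes "even c" "\<alpha> \<le> c" "c \<le> xh" "v c \<beta>" "y \<in> {b1..b2}"
  shows "v c y"
proof (rule ccontr)
  assume "\<not> v c y"
  then have "even q" using odd_q assms(4,5) \<beta>_bounds by fastforce
  from change_v[OF assms(4) \<open>\<not> v c y\<close>] obtain y1 \<sigma> where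
    y1: "v c y1" "\<not> v c (y1 + \<sigma>)" "\<sigma> \<in> {1, -1}" "even y1"
        "y1 \<in> {min y \<beta>..max y \<beta>}" "y1 + \<sigma> \<in> {min y \<beta>..max y \<beta>}" "y1 \<noteq> y" by blast
  have "b1 < y1" "y1 < b2" using y1 assms(5) \<beta>_bounds \<open>even q\<close> by auto
  then show False using no_inner_tee_v[OF assms(1) y1(4,1,2,3)] assms by auto
qed

text \<open>Witnesses that column \<open>c\<close> is interrupted between the centre row and row
  \<open>r\<close>. The neighbour of \<open>y\<close> is confined as well, so that the gap begins
  inside this range.\<close>

definition "vtee c r y \<tau> \<longleftrightarrow> even y \<and> \<tau> \<in> {1, -1} \<and> v c y \<and> \<not> v c (y + \<tau>) \<and> y \<in> {\<beta>..r} \<and> y + \<tau> \<in> {\<beta>..r}"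
definition "htee c r x \<tau> \<longleftrightarrow> even x \<and> \<tau> \<in> {1, -1} \<and> h x r \<and> \<not> h (x + \<tau>) r \<and> x \<in> {\<alpha>..c} \<and> x + \<tau> \<in> {\<alpha>..c}"
definition "top_rows = {k. even k \<and> \<beta> < k \<and> k < yh \<and> (\<forall>x\<in>{a1..a2}. h x k)}"

end

context anchor_grid begin

interpretation T: anchor_grid q p "\<lambda>x y. v y x" "\<lambda>x y. h y x" "\<lambda>x y. vx y x" "\<lambda>x y. hx y x" b1 b2 a1 a2 yl yh xl xh
  by (rule transposed)

lemma T_simps: "T.\<alpha> = \<beta>" "T.\<beta> = \<alpha>" "T.right_cols = top_rows"
  unfolding T.\<alpha>_def T.\<beta>_def \<alpha>_def \<beta>_def T.right_cols_def top_rows_def by auto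

lemma T_tee: "T.vtee r c x \<tau> = htee c r x \<tau>" "T.htee r c y \<tau> = vtee c r y \<tau>"
  unfolding T.vtee_def T.htee_def htee_def vtee_def T_simps by auto

lemmas row_uniform = T.col_uniform[unfolded T_simps]
lemmas change_h = T.change_v
lemmas card_top_rows = T.card_right_cols[unfolded T_simps]
lemmas card_less_top_rows = T.card_less_right_cols[unfolded T_simps]
lemmas finite_top_rows = T.finite_right_cols[unfolded T_simps]

end

context anchor_grid begin

text \<open>Crossed rows that reach back to the centre column are index rows by
  \<open>row_uniform\<close>, and at most \<open>q div 2\<close> of these lie above the centre.
  Where the bound has to be strict, the index row left out of the count depends on the direction of
  the missing edge.\<close>

lemma vtee_ext_if:
  assumes "even c" "\<alpha> \<le> c" "c \<le> xh" "\<beta> \<le> r" "r \<le> yh" and tee: "vtee c r y \<tau>"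
    and reg: "\<And>k. even k \<Longrightarrow> y \<le> k \<Longrightarrow> k < r \<Longrightarrow> vtee c k y \<tau> \<Longrightarrow> h c k \<Longrightarrow> h \<alpha> k"
  shows "vx c r"
proof -
  have y: "even y" "\<tau> \<in> {1, -1}" "v c y" "\<not> v c (y + \<tau>)" "y \<in> {\<beta>..r}" "y + \<tau> \<in> {\<beta>..r}"
    using tee by (auto simp: vtee_def)
  have box: "c \<in> {xl..xh}" "y \<in> {yl..yh}" "y + \<tau> \<in> {yl..yh}" "r \<in> {yl..yh}"
    using y assms bounds \<alpha>_bounds \<beta>_bounds by auto
  have hits: "k \<in> top_rows" if k: "even k" "y \<le> k" "k < r" "h c k" "\<beta> < k" "vtee c k y \<tau>" for k
  proof -
    have "h \<alpha> k" using reg k by blast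
    then have "h x k" if "x \<in> {a1..a2}" for x
      using row_uniform[of k x] k that assms by auto
    then show ?thesis using k assms by (auto simp: top_rows_def)
  qed
  show ?thesis
  proof (cases "\<tau> = 1")
    case True
    let ?S = "{k. even k \<and> y < k \<and> k < r \<and> h c k}"
    have sub: "?S \<subseteq> top_rows"
      using y True by (auto intro!: hits simp: vtee_def)
    have "card ?S < (q + 1) div 2"
    proof (cases "even q")
      case False
      have "card ?S \<le> card top_rows" by (rule card_mono[OF finite_top_rows sub])
      then show ?thesis using card_top_rows False by (auto elim!: oddE)
    next
      case True
      \<comment> \<open>For even \<open>q\<close> the face part crosses only \<open>q div 2\<close>
        hits, so an uncounted index row is needed. The upper side of the anchor is one: it is not
        above \<open>y\<close>, because the column cannot end strictly inside the height of the
        anchor.\<close>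
      have "b2 \<le> y"
        using no_inner_tee_v[OF assms(1) y(1,3,4,2)] assms(2,3) y(5) \<beta>_bounds(3)[OF True]
        by (intro leI notI) auto
      then have "b2 \<in> top_rows"
        using \<beta>_bounds(4)[OF True] y \<open>\<tau> = 1\<close> evens assms side_h by (auto simp: top_rows_def)
      then have "card ?S < q div 2"
        by (rule card_less_top_rows[OF sub]) (use \<open>b2 \<le> y\<close> in auto)
      then show ?thesis using True by auto
    qed
    then show ?thesis
      using face_v[OF assms(1) y(1,3,4,2) box] True y by (simp add: conj_ac)
  next
    case False
    then have [simp]: "\<tau> = - 1" using y by auto
    let ?S = "{k. even k \<and> y < k \<and> k < r \<and> h c k}"
    have "r = y \<or> card ?S < q div 2"
    proof (cases "y = r")
      case False
      then have "y < r" using y by auto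
      have sub: "?S \<subseteq> top_rows"
        using y by (auto intro!: hits simp: vtee_def)
      \<comment> \<open>With the missing edge below, the row through the T-junction is itself an
        index row, and it is not counted.\<close>
      have "h (c + 1) y" using tee_v[OF assms(1) y(1,3,4,2) box(1-3)] by auto
      then have "h c y" using h_closed[of "c + 1" y] assms(1) by auto
      then have "y \<in> top_rows" using y \<open>y < r\<close> by (intro hits) (auto simp: vtee_def)
      then show ?thesis using card_less_top_rows[OF sub] by auto
    qed auto
    then show ?thesis
      using edge_v[OF assms(1) y(1,3,4,2) box] y by (auto simp: conj_ac)
  qed
qed

end

context anchor_grid begin

interpretation T: anchor_grid q p "\<lambda>x y. v y x" "\<lambda>x y. h y x" "\<lambda>x y. vx y x" "\<lambda>x y. hx y x" b1 b2 a1 a2 yl yh xl xh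
  by (rule transposed)

lemmas htee_ext_if = T.vtee_ext_if[unfolded T_simps T_tee]

text \<open>Rows and columns have to be treated together. If a row \<open>k\<close> crossed by
  column \<open>c\<close> fails to reach the centre, then (c, k) carries the same kind of pair; if a
  column \<open>k\<close> crossed by row \<open>r\<close> fails, then (k, r) does. Both points have
  a smaller sum of distances. If nothing fails, both extensions contain (c, r).\<close>

lemma not_both_tees:
  assumes "even c" "even r" "\<alpha> \<le> c" "c \<le> xh" "\<beta> \<le> r" "r \<le> yh" "vtee c r y \<tau>" "htee c r x \<sigma>"
  shows False
  using assms
proof (induction "nat (c + r - \<alpha> - \<beta>)" arbitrary: c r x y \<sigma> \<tau> rule: less_induct)
  case less
  have "vx c r"
  proof (rule vtee_ext_if[OF less.prems(1,3-7)])
    fix k assume k: "even k" "y \<le> k" "k < r" "vtee c k y \<tau>" "h c k"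
    show "h \<alpha> k"
    proof (rule ccontr)
      assume "\<not> h \<alpha> k"
      from change_h[OF k(5) this] less.prems(3) obtain x' \<sigma>' where "htee c k x' \<sigma>'"
        unfolding htee_def by (metis max.absorb2 min.absorb1)
      then show False using less.hyps[of c k y \<tau> x' \<sigma>'] k less.prems by (auto simp: vtee_def)
    qed
  qed
  moreover have "hx c r"
  proof (rule htee_ext_if[OF less.prems(2,5,6,3,4,8)])
    fix k assume k: "even k" "x \<le> k" "k < c" "htee k r x \<sigma>" "v k r"
    show "v k \<beta>"
    proof (rule ccontr)
      assume "\<not> v k \<beta>"
      from change_v[OF k(5) this] less.prems(5) obtain y' \<tau>' where "vtee k r y' \<tau>'"
        unfolding vtee_def by (metis max.absorb2 min.absorb1)
      then show False using less.hyps[of k r y' \<tau>' x \<sigma>] k less.prems by (auto simp: htee_def)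
    qed
  qed
  ultimately show False by (rule disj[rotated])
qed

text \<open>A crossed row that misses the centre column would be interrupted before
  \<open>c\<close>, and together with the interrupted column \<open>c\<close> it would form the pair
  excluded by \<open>not_both_tees\<close>. This discharges the premise \<open>reg\<close> of
  \<open>vtee_ext_if\<close>.\<close>

lemma vtee_ext:
  assumes "even c" "\<alpha> \<le> c" "c \<le> xh" "\<beta> \<le> r" "r \<le> yh" "vtee c r y \<tau>"
  shows "vx c r"
proof (rule vtee_ext_if[OF assms])
  fix k assume k: "even k" "y \<le> k" "k < r" "vtee c k y \<tau>" "h c k"
  show "h \<alpha> k"
  proof (rule ccontr)
    assume "\<not> h \<alpha> k"
    from change_h[OF k(5) this] assms(2) obtain x' \<sigma>' where "htee c k x' \<sigma>'"
      unfolding htee_def by (metis max.absorb2 min.absorb1)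
    then show False using not_both_tees[OF assms(1) k(1) assms(2,3) _ _ k(4)] k assms by (auto simp: vtee_def)
  qed
qed

end

context anchor_grid begin

interpretation R: anchor_grid p q "\<lambda>x. h (- x)" "\<lambda>x. v (- x)" "\<lambda>x. hx (- x)" "\<lambda>x. vx (- x)"
  "- a2" "- a1" b1 b2 "- xh" "- xl" yl yh
  by (rule reflected)

lemma tee_above_ext:
  assumes "even c" "even y" "v c y" "\<not> v c (y + \<tau>)" "\<tau> \<in> {1, -1}" "c \<in> {xl..xh}"
    "r \<le> yh" "y \<in> {\<beta>..r}" "y + \<tau> \<in> {\<beta>..r}"
  shows "vx c r"
proof (cases "\<alpha> \<le> c")
  case True
  then show ?thesis using assms by (intro vtee_ext[of c r y \<tau>]) (auto simp: vtee_def)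
next
  case False
  have "R.\<alpha> = - \<alpha>" unfolding R.\<alpha>_def \<alpha>_def using evens by (auto elim!: evenE)
  moreover have "R.\<beta> = \<beta>" unfolding R.\<beta>_def \<beta>_def by simp
  ultimately have "vx (- (- c)) r"
    using assms False by (intro R.vtee_ext[of "- c" r y \<tau>]) (auto simp: R.vtee_def)
  then show ?thesis by simp
qed

end

context anchor_grid begin

interpretation Y: anchor_grid p q "\<lambda>x y. h x (- y)" "\<lambda>x y. v x (- y)" "\<lambda>x y. hx x (- y)" "\<lambda>x y. vx x (- y)"
  a1 a2 "- b2" "- b1" xl xh "- yh" "- yl"
  by (rule anchor_grid.transposed[OF anchor_grid.reflected[OF transposed]])

text \<open>Rows below the centre follow by reflection in the vertical direction; \<open>Y\<close>
  is \<open>reflected\<close> conjugated by the transposition.\<close>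

lemma tee_v_ext:
  assumes "even c" "even y" "v c y" "\<not> v c (y + \<tau>)" "\<tau> \<in> {1, -1}" "c \<in> {xl..xh}" "r \<in> {yl..yh}"
    "y \<in> {min \<beta> r..max \<beta> r}" "y + \<tau> \<in> {min \<beta> r..max \<beta> r}"
  shows "vx c r"
proof (cases "\<beta> \<le> r")
  case True
  then show ?thesis using assms by (intro tee_above_ext[of c y \<tau>]) auto
next
  case False
  have "Y.\<beta> = - \<beta>" unfolding Y.\<beta>_def \<beta>_def using evens by (auto elim!: evenE)
  then have "vx c (- (- r))"
    using assms False by (intro Y.tee_above_ext[of c "- y" "- \<tau>"]) (auto simp: add.commute)
  then show ?thesis by simp
qed

end

context anchor_grid begin

text \<open>If the column is interrupted between the centre and row \<open>y\<close>, the extension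
  of the T-junction found there reaches \<open>y\<close>. Hence, over the support, a knot line of an
  anchor never runs through the inside of an extended cell.\<close>

lemma index_line_v:
  assumes "even c" "c \<in> {xl..xh}" "v c \<beta>" "y \<in> {yl..yh}"
  shows "v c y \<or> vx c y"
proof (rule disjCI)
  assume "\<not> vx c y"
  show "v c y"
  proof (rule ccontr)
    assume n: "\<not> v c y"
    from change_v[OF assms(3) n] show False
      using tee_v_ext[OF assms(1) _ _ _ _ assms(2,4)] \<open>\<not> vx c y\<close> by (metis min.commute max.commute)
  qed
qed

end

context anchor_grid begin

interpretation T: anchor_grid q p "\<lambda>x y. v y x" "\<lambda>x y. h y x" "\<lambda>x y. vx y x" "\<lambda>x y. hx y x" b1 b2 a1 a2 yl yh xl xh
  by (rule transposed)

lemmas index_line_h = T.index_line_v[unfolded T_simps]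

end

context anchor_grid begin

interpretation R: anchor_grid p q "\<lambda>x. h (- x)" "\<lambda>x. v (- x)" "\<lambda>x. hx (- x)" "\<lambda>x. vx (- x)"
  "- a2" "- a1" b1 b2 "- xh" "- xl" yl yh
  by (rule reflected)

text \<open>Index sets of different anchors refer to different sides; the test at the centre makes
  them comparable.\<close>

lemma index_iff_v:
  assumes "even c" "c \<in> {xl..xh}"
  shows "(\<forall>y\<in>{b1..b2}. v c y) \<longleftrightarrow> v c ((b1 + b2) div 2)"
proof
  show "v c ((b1 + b2) div 2)" if "\<forall>y\<in>{b1..b2}. v c y"
    using that \<beta>_bounds by (simp add: \<beta>_def)
  assume "v c ((b1 + b2) div 2)"
  moreover have "R.\<alpha> = - \<alpha>" unfolding R.\<alpha>_def \<alpha>_def using evens by (auto elim!: evenE)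
  ultimately show "\<forall>y\<in>{b1..b2}. v c y"
    using col_uniform[of c] R.col_uniform[of "- c"] assms
    by (cases "\<alpha> \<le> c") (auto simp: \<beta>_def R.\<beta>_def)
qed

end

context anchor_grid begin

interpretation T: anchor_grid q p "\<lambda>x y. v y x" "\<lambda>x y. h y x" "\<lambda>x y. vx y x" "\<lambda>x y. hx y x" b1 b2 a1 a2 yl yh xl xh
  by (rule transposed)

lemmas index_iff_h = T.index_iff_v

end

section \<open>Interruptions seen from two anchors\<close>

lemma two_anchors_ext_v:
  assumes G: "anchor_grid p q h v hx vx a1 a2 b1 b2 xl xh yl yh"
    and G': "anchor_grid p q h v hx vx a1' a2' b1' b2' xl' xh' yl' yh'"
    and c: "even c" "c \<in> {xl..xh}" "c \<in> {xl'..xh'}" and r: "r \<in> {yl..yh}" "r \<in> {yl'..yh'}"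
    and "v c ((b1 + b2) div 2)" "\<not> v c ((b1' + b2') div 2)"
  shows "vx c r"
proof -
  interpret G: anchor_grid p q h v hx vx a1 a2 b1 b2 xl xh yl yh by (rule G)
  interpret G': anchor_grid p q h v hx vx a1' a2' b1' b2' xl' xh' yl' yh' by (rule G')
  have "v c G.\<beta>" "\<not> v c G'.\<beta>" using assms by (simp_all add: G.\<beta>_def G'.\<beta>_def)
  from G.change_v[OF this] obtain y \<sigma> where y: "v c y" "\<not> v c (y + \<sigma>)" "\<sigma> \<in> {1, -1}" "even y"
    "y \<in> {min G'.\<beta> G.\<beta>..max G'.\<beta> G.\<beta>}" "y + \<sigma> \<in> {min G'.\<beta> G.\<beta>..max G'.\<beta> G.\<beta>}" by blast
  \<comment> \<open>The gap begins between the two centre rows, and the integer \<open>r\<close>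
    cannot split the step from \<open>y\<close> to \<open>y + \<sigma>\<close>. So wherever
    \<open>r\<close> lies, this step is between \<open>r\<close> and one of the centres, and the
    extension can be followed from the anchor with that centre.\<close>
  then have "(y \<in> {min G.\<beta> r..max G.\<beta> r} \<and> y + \<sigma> \<in> {min G.\<beta> r..max G.\<beta> r})
    \<or> (y \<in> {min G'.\<beta> r..max G'.\<beta> r} \<and> y + \<sigma> \<in> {min G'.\<beta> r..max G'.\<beta> r})"
    by (auto simp: min_def max_def split: if_splits)
  then show ?thesis
    using G.tee_v_ext[OF c(1) y(4,1,2,3) c(2) r(1)] G'.tee_v_ext[OF c(1) y(4,1,2,3) c(3) r(2)] by blast
qed

lemma two_anchors_ext_h:
  assumes G: "anchor_grid p q h v hx vx a1 a2 b1 b2 xl xh yl yh"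
    and G': "anchor_grid p q h v hx vx a1' a2' b1' b2' xl' xh' yl' yh'"
    and "even r" "c \<in> {xl..xh}" "c \<in> {xl'..xh'}" "r \<in> {yl..yh}" "r \<in> {yl'..yh'}"
    "h ((a1 + a2) div 2) r" "\<not> h ((a1' + a2') div 2) r"
  shows "hx c r"
  using two_anchors_ext_v[OF anchor_grid.transposed[OF G] anchor_grid.transposed[OF G'] assms(3,6,7,4,5,8,9)] .

lemma no_crossing_defects:
  assumes G: "anchor_grid p q h v hx vx a1 a2 b1 b2 xl xh yl yh"
    and G': "anchor_grid p q h v hx vx a1' a2' b1' b2' xl' xh' yl' yh'"
    and "even c" "even r" "c \<in> {xl..xh}" "c \<in> {xl'..xh'}" "r \<in> {yl..yh}" "r \<in> {yl'..yh'}"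
    and "v c ((b1 + b2) div 2) \<noteq> v c ((b1' + b2') div 2)"
    and "h ((a1 + a2) div 2) r \<noteq> h ((a1' + a2') div 2) r"
  shows False
proof -
  have "vx c r"
    using two_anchors_ext_v[OF G G'] two_anchors_ext_v[OF G' G] assms(3-9) by blast
  moreover have "hx c r"
    using two_anchors_ext_h[OF G G'] two_anchors_ext_h[OF G' G] assms(3-8,10) by blast
  ultimately show False by (rule anchor_grid.disj[OF G, rotated])
qed

section \<open>Grids of T-meshes\<close>

lemma in_closed_box_iff:
  "z \<in> closed_box C \<longleftrightarrow> real (fst (fst C)) \<le> fst z \<and> fst z \<le> real (snd (fst C))
     \<and> real (fst (snd C)) \<le> snd z \<and> snd z \<le> real (snd (snd C))"
  by (induct C rule: closed_box.induct) (auto simp: mem_Times_iff)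

lemma vertices_iff:
  "(i, j) \<in> vertices T \<longleftrightarrow>
     (\<exists>i1 i2 j1 j2. ((i1, i2), (j1, j2)) \<in> cells T \<and> (i = i1 \<or> i = i2) \<and> (j = j1 \<or> j = j2))"
  by (fastforce simp: vertices_def)

lemma hedges_iff:
  "((i1, i2), (j1, j2)) \<in> hedges T \<longleftrightarrow> j1 = j2 \<and> i1 < i2 \<and> (i1, j1) \<in> vertices T \<and> (i2, j1) \<in> vertices T
     \<and> (\<forall>i. i1 < i \<and> i < i2 \<longrightarrow> (i, j1) \<notin> vertices T)
     \<and> (\<forall>C \<in> cells T. closed_box ((i1, i2), (j1, j2)) \<inter> open_box C = {})"
  by (auto simp: hedges_def simp del: closed_box.simps)

lemma vedges_iff:
  "((i1, i2), (j1, j2)) \<in> vedges T \<longleftrightarrow> i1 = i2 \<and> j1 < j2 \<and> (i1, j1) \<in> vertices T \<and> (i1, j2) \<in> vertices T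
     \<and> (\<forall>j. j1 < j \<and> j < j2 \<longrightarrow> (i1, j) \<notin> vertices T)
     \<and> (\<forall>C \<in> cells T. closed_box ((i1, i2), (j1, j2)) \<inter> open_box C = {})"
  by (auto simp: vedges_def simp del: closed_box.simps)

section \<open>Exchange of the coordinates\<close>

definition transp_mesh :: "tmesh \<Rightarrow> tmesh" where
  "transp_mesh T = \<lparr>xdim = ydim T, ydim = xdim T, cells = prod.swap ` cells T\<rparr>"

lemma transp_simps [simp]:
  "xdim (transp_mesh T) = ydim T" "ydim (transp_mesh T) = xdim T"
  "cells (transp_mesh T) = prod.swap ` cells T" "transp_mesh (transp_mesh T) = T"
  by (simp_all add: transp_mesh_def image_image)

lemma open_box_swap: "open_box (prod.swap C) = prod.swap ` open_box C"
  by (cases C rule: open_box.cases) (auto simp: image_iff)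

lemma closed_box_swap: "closed_box (prod.swap C) = prod.swap ` closed_box C"
  by (cases C rule: closed_box.cases) (auto simp: image_iff)

lemma swap_disjoint: "prod.swap ` X \<inter> prod.swap ` Y = {} \<longleftrightarrow> X \<inter> Y = {}"
  by auto

lemma in_swap_image: "(x, y) \<in> prod.swap ` X \<longleftrightarrow> (y, x) \<in> X"
  by (metis imageE image_eqI swap_simp swap_swap)

lemma vertices_transp: "(i, j) \<in> vertices (transp_mesh T) \<longleftrightarrow> (j, i) \<in> vertices T"
  by (auto simp: vertices_iff in_swap_image)

lemma inner_vertices_transp: "(i, j) \<in> inner_vertices (transp_mesh T) \<longleftrightarrow> (j, i) \<in> inner_vertices T"
  by (auto simp: inner_vertices_def vertices_transp)

lemma disjoint_cells_transp:
  "(\<forall>C \<in> cells (transp_mesh T). closed_box (a, b) \<inter> open_box C = {})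
     \<longleftrightarrow> (\<forall>C \<in> cells T. closed_box (b, a) \<inter> open_box C = {})"
  using closed_box_swap[of "(b, a)"] by (simp add: open_box_swap swap_disjoint)

lemma hedges_transp: "(a, b) \<in> hedges (transp_mesh T) \<longleftrightarrow> (b, a) \<in> vedges T"
proof -
  obtain i1 i2 j1 j2 where "a = (i1, i2)" "b = (j1, j2)" by fastforce
  then show ?thesis
    by (simp only: hedges_iff vedges_iff vertices_transp disjoint_cells_transp)
qed

lemma vedges_transp: "(a, b) \<in> vedges (transp_mesh T) \<longleftrightarrow> (b, a) \<in> hedges T"
  using hedges_transp[of b a "transp_mesh T"] by simp

lemma hedges_transp_image: "hedges (transp_mesh T) = prod.swap ` vedges T"
  unfolding set_eq_iff by (simp add: split_paired_all hedges_transp in_swap_image)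

lemma vedges_transp_image: "vedges (transp_mesh T) = prod.swap ` hedges T"
  unfolding set_eq_iff by (simp add: split_paired_all vedges_transp in_swap_image)

lemma valence_transp: "valence (transp_mesh T) (i, j) = valence T (j, i)"
proof -
  have "{E \<in> hedges (transp_mesh T) \<union> vedges (transp_mesh T). (real i, real j) \<in> closed_box E}
      = prod.swap ` {E \<in> hedges T \<union> vedges T. (real j, real i) \<in> closed_box E}"
    unfolding hedges_transp_image vedges_transp_image by (auto simp: closed_box_swap in_swap_image image_iff)
  then show ?thesis unfolding valence_def by (simp add: card_image)
qed

lemma hskel_transp: "hskel (transp_mesh T) = prod.swap ` vskel T"
  unfolding hskel_def vskel_def hedges_transp_image by (auto simp: closed_box_swap)

lemma vskel_transp: "vskel (transp_mesh T) = prod.swap ` hskel T"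
  unfolding hskel_def vskel_def vedges_transp_image by (auto simp: closed_box_swap)

lemma skel_transp: "skel (transp_mesh T) = prod.swap ` skel T"
  unfolding skel_def hskel_transp vskel_transp by auto

lemma index_domain_transp: "index_domain (transp_mesh T) = prod.swap ` index_domain T"
  unfolding index_domain_def by (auto simp: image_iff)

lemma is_tmesh_transp:
  assumes "is_tmesh T"
  shows "is_tmesh (transp_mesh T)"
proof -
  have 1: "\<forall>((i1, i2), (j1, j2)) \<in> cells (transp_mesh T). i1 < i2 \<and> j1 < j2"
    using assms unfolding is_tmesh_def by fastforce
  have 2: "\<forall>C \<in> cells (transp_mesh T). \<forall>D \<in> cells (transp_mesh T). C \<noteq> D \<longrightarrow> open_box C \<inter> open_box D = {}"
    using assms unfolding is_tmesh_def transp_simps ball_simps open_box_swap swap_disjoint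
    by (metis swap_swap)
  have "(\<Union>C \<in> cells (transp_mesh T). closed_box C) = prod.swap ` (\<Union>C \<in> cells T. closed_box C)"
    by (simp add: closed_box_swap image_UN)
  then have 3: "(\<Union>C \<in> cells (transp_mesh T). closed_box C) = index_domain (transp_mesh T)"
    using assms unfolding is_tmesh_def index_domain_transp by simp
  have 4: "\<forall>v \<in> inner_vertices (transp_mesh T). valence (transp_mesh T) v = 3 \<or> valence (transp_mesh T) v = 4"
    using assms unfolding is_tmesh_def by (auto simp: inner_vertices_transp valence_transp)
  show ?thesis unfolding is_tmesh_def using 1 2 3 4 by blast
qed

lemma tjunctions_transp: "(i, j) \<in> tjunctions (transp_mesh T) \<longleftrightarrow> (j, i) \<in> tjunctions T"
  unfolding tjunctions_def by (simp add: inner_vertices_transp valence_transp)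

lemma row_hits_transp: "row_hits (transp_mesh T) j = col_hits T j"
  unfolding row_hits_def col_hits_def vskel_transp by (simp add: in_swap_image vertices_transp)

lemma hexts_transp: "hexts p (transp_mesh T) = prod.swap ` vexts p T"
proof -
  have "(a, b) \<in> hexts p (transp_mesh T) \<longleftrightarrow> (b, a) \<in> vexts p T" for a b
    unfolding hexts_def vexts_def
    by (simp add: row_hits_transp tjunctions_transp hedges_transp) blast
  then show ?thesis unfolding set_eq_iff by (simp add: split_paired_all in_swap_image)
qed

lemma vexts_transp: "vexts q (transp_mesh T) = prod.swap ` hexts q T"
  using hexts_transp[of q "transp_mesh T"] by (simp add: image_image)

lemma analysis_suitable_transp:
  assumes "analysis_suitable p q T"
  shows "analysis_suitable q p (transp_mesh T)"
  using assms unfolding analysis_suitable_def hexts_transp vexts_transp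
  by (auto simp: closed_box_swap swap_disjoint Int_commute)

text \<open>A \<open>LEAST\<close> without a witness is unspecified, so \<open>k\<close> hits must
  be known to occur up to some \<open>m\<close>. The full lines of the frame will provide
  them.\<close>

lemma trace_up_props:
  assumes "k \<le> card {x \<in> H. i < x \<and> x \<le> m}" "i \<le> m"
  shows "i \<le> trace_up H k i" "trace_up H k i \<le> m" "k \<le> card {x \<in> H. i < x \<and> x \<le> trace_up H k i}"
proof -
  let ?P = "\<lambda>e. i \<le> e \<and> k \<le> card {x \<in> H. i < x \<and> x \<le> e}"
  have "?P (trace_up H k i)" unfolding trace_up_def by (rule LeastI[of ?P m]) (use assms in auto)
  then show "i \<le> trace_up H k i" "k \<le> card {x \<in> H. i < x \<and> x \<le> trace_up H k i}" by auto
  show "trace_up H k i \<le> m" unfolding trace_up_def by (rule Least_le) (use assms in auto)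
qed

lemma trace_down_props:
  assumes "k \<le> card {x \<in> H. m \<le> x \<and> x < i}" "m \<le> i"
  shows "trace_down H k i \<le> i" "m \<le> trace_down H k i" "k \<le> card {x \<in> H. trace_down H k i \<le> x \<and> x < i}"
proof -
  let ?P = "\<lambda>e. e \<le> i \<and> k \<le> card {x \<in> H. e \<le> x \<and> x < i}"
  have "?P (trace_down H k i)" unfolding trace_down_def
    by (rule GreatestI_nat[of ?P m i]) (use assms in auto)
  then show "trace_down H k i \<le> i" "k \<le> card {x \<in> H. trace_down H k i \<le> x \<and> x < i}" by auto
  show "m \<le> trace_down H k i" unfolding trace_down_def
    by (rule Greatest_le_nat[of ?P m i]) (use assms in auto)
qed

text \<open>The trace has met \<open>k\<close> hits when it ends. If it ended before
  \<open>c\<close>, they would all lie strictly before \<open>c\<close>, where there are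
  fewer.\<close>

lemma trace_up_reach:
  fixes c :: int
  assumes "k \<le> card {x \<in> H. i < x \<and> x \<le> m}" "i \<le> m"
    and "card {z. even z \<and> 2 * int i < z \<and> z < c \<and> P z} < k" "\<And>x. x \<in> H \<Longrightarrow> i < x \<Longrightarrow> P (2 * int x)"
  shows "c \<le> 2 * int (trace_up H k i)"
proof (rule ccontr)
  assume n: "\<not> c \<le> 2 * int (trace_up H k i)"
  have "card {x \<in> H. i < x \<and> x \<le> trace_up H k i} \<le> card {z. even z \<and> 2 * int i < z \<and> z < c \<and> P z}"
    by (rule card_inj_on_le[of "\<lambda>x. 2 * int x"])
      (use n assms(4) in \<open>auto simp: inj_on_def intro: finite_subset[of _ "{2 * int i..c}"]\<close>)
  then show False using trace_up_props(3)[OF assms(1,2)] assms(3) by linarith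
qed

lemma trace_down_reach:
  fixes c :: int
  assumes "k \<le> card {x \<in> H. m \<le> x \<and> x < i}" "m \<le> i"
    and "card {z. even z \<and> c < z \<and> z < 2 * int i \<and> P z} < k" "\<And>x. x \<in> H \<Longrightarrow> x < i \<Longrightarrow> P (2 * int x)"
  shows "2 * int (trace_down H k i) \<le> c"
proof (rule ccontr)
  assume n: "\<not> 2 * int (trace_down H k i) \<le> c"
  have "card {x \<in> H. trace_down H k i \<le> x \<and> x < i} \<le> card {z. even z \<and> c < z \<and> z < 2 * int i \<and> P z}"
    by (rule card_inj_on_le[of "\<lambda>x. 2 * int x"])
      (use n assms(4) in \<open>auto simp: inj_on_def intro: finite_subset[of _ "{c..2 * int i}"]\<close>)
  then show False using trace_down_props(3)[OF assms(1,2)] assms(3) by linarith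
qed

section \<open>Skeletons and extensions at half-integer points\<close>

definition on_hskel :: "tmesh \<Rightarrow> int \<Rightarrow> int \<Rightarrow> bool" where
  "on_hskel T x y \<longleftrightarrow> (real_of_int x / 2, real_of_int y / 2) \<in> hskel T"

definition on_vskel :: "tmesh \<Rightarrow> int \<Rightarrow> int \<Rightarrow> bool" where
  "on_vskel T x y \<longleftrightarrow> (real_of_int x / 2, real_of_int y / 2) \<in> vskel T"

definition on_hext :: "nat \<Rightarrow> tmesh \<Rightarrow> int \<Rightarrow> int \<Rightarrow> bool" where
  "on_hext p T x y \<longleftrightarrow> (\<exists>E\<in>hexts p T. (real_of_int x / 2, real_of_int y / 2) \<in> closed_box E)"

definition on_vext :: "nat \<Rightarrow> tmesh \<Rightarrow> int \<Rightarrow> int \<Rightarrow> bool" where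
  "on_vext q T x y \<longleftrightarrow> (\<exists>E\<in>vexts q T. (real_of_int x / 2, real_of_int y / 2) \<in> closed_box E)"

lemma on_hskel_transp: "on_hskel (transp_mesh T) = (\<lambda>x y. on_vskel T y x)"
  by (intro ext) (simp add: on_hskel_def on_vskel_def hskel_transp in_swap_image)

lemma on_vskel_transp: "on_vskel (transp_mesh T) = (\<lambda>x y. on_hskel T y x)"
  by (intro ext) (simp add: on_hskel_def on_vskel_def vskel_transp in_swap_image)

lemma on_hext_transp: "on_hext q (transp_mesh T) = (\<lambda>x y. on_vext q T y x)"
  by (intro ext) (simp add: on_hext_def on_vext_def hexts_transp closed_box_swap in_swap_image)

lemma on_hskel_iff:
  "on_hskel T x y \<longleftrightarrow> (\<exists>i1 i2 j. ((i1, i2), (j, j)) \<in> hedges T \<and> y = 2 * int j \<and> 2 * int i1 \<le> x \<and> x \<le> 2 * int i2)"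
proof -
  have *: "(real_of_int x / 2, real_of_int y / 2) \<in> closed_box ((i1, i2), (j, j))
     \<longleftrightarrow> y = 2 * int j \<and> 2 * int i1 \<le> x \<and> x \<le> 2 * int i2" for i1 i2 j
    unfolding in_closed_box_iff by (simp, linarith)
  have **: "\<exists>i1 i2 j. E = ((i1, i2), (j, j))" if "E \<in> hedges T" for E
    using that unfolding hedges_def by blast
  show ?thesis
  proof
    assume "on_hskel T x y"
    then obtain E where E: "E \<in> hedges T" "(real_of_int x / 2, real_of_int y / 2) \<in> closed_box E"
      unfolding on_hskel_def hskel_def by blast
    with ** obtain i1 i2 j where "E = ((i1, i2), (j, j))" by blast
    with E * show "\<exists>i1 i2 j. ((i1, i2), (j, j)) \<in> hedges T \<and> y = 2 * int j \<and> 2 * int i1 \<le> x \<and> x \<le> 2 * int i2"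
      by blast
  next
    assume "\<exists>i1 i2 j. ((i1, i2), (j, j)) \<in> hedges T \<and> y = 2 * int j \<and> 2 * int i1 \<le> x \<and> x \<le> 2 * int i2"
    with * show "on_hskel T x y" unfolding on_hskel_def hskel_def by blast
  qed
qed

lemma on_hskel_odd: "odd x \<Longrightarrow> on_hskel T x y \<Longrightarrow> on_hskel T (x + 1) y \<and> on_hskel T (x - 1) y"
proof -
  assume "odd x" "on_hskel T x y"
  then obtain i1 i2 j where e: "((i1, i2), (j, j)) \<in> hedges T" "y = 2 * int j" "2 * int i1 \<le> x" "x \<le> 2 * int i2"
    unfolding on_hskel_iff by blast
  have "2 * int i1 \<noteq> x" "2 * int i2 \<noteq> x" using \<open>odd x\<close> by auto
  then show ?thesis unfolding on_hskel_iff using e by (intro conjI exI[of _ i1] exI[of _ i2] exI[of _ j]) auto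
qed

text \<open>Edges have positive length, so the skeleton has no isolated points.\<close>

lemma on_hskel_even: "on_hskel T x y \<Longrightarrow> on_hskel T (x - 1) y \<or> on_hskel T (x + 1) y"
proof -
  assume "on_hskel T x y"
  then obtain i1 i2 j where e: "((i1, i2), (j, j)) \<in> hedges T" "y = 2 * int j" "2 * int i1 \<le> x" "x \<le> 2 * int i2"
    unfolding on_hskel_iff by blast
  then have "i1 < i2" by (simp add: hedges_iff)
  then have "(2 * int i1 \<le> x - 1 \<and> x - 1 \<le> 2 * int i2) \<or> (2 * int i1 \<le> x + 1 \<and> x + 1 \<le> 2 * int i2)"
    using e by linarith
  then show ?thesis unfolding on_hskel_iff using e by blast
qed

lemma hedge_unique_right:
  assumes "((i, k), (j, j)) \<in> hedges T" "((i, k'), (j, j)) \<in> hedges T"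
  shows "k = k'"
  using assms unfolding hedges_iff by (metis linorder_neqE_nat)

lemma hedge_unique_left:
  assumes "((k, i), (j, j)) \<in> hedges T" "((k', i), (j, j)) \<in> hedges T"
  shows "k = k'"
  using assms unfolding hedges_iff by (metis linorder_neqE_nat)

lemma hedge_right: "((i, k), (j, j)) \<in> hedges T \<Longrightarrow> on_hskel T (2 * int i + 1) (2 * int j)"
  unfolding on_hskel_iff by (intro exI[of _ i] exI[of _ k] exI[of _ j]) (auto simp: hedges_iff)

lemma hedge_left: "((k, i), (j, j)) \<in> hedges T \<Longrightarrow> on_hskel T (2 * int i - 1) (2 * int j)"
  unfolding on_hskel_iff by (intro exI[of _ k] exI[of _ i] exI[of _ j]) (auto simp: hedges_iff)

lemma card_unique:
  assumes "\<And>x y. x \<in> S \<Longrightarrow> y \<in> S \<Longrightarrow> x = y" "S \<noteq> {} \<Longrightarrow> b"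
  shows "finite S \<and> card S \<le> of_bool b"
proof (cases "S = {}")
  case False
  then obtain x where "S = {x}" using assms(1) by blast
  then show ?thesis using assms(2) by simp
qed auto

text \<open>The condition of \<open>admissible\<close> on the frame is replaced by its consequence
  for T-junctions, which avoids closures and is visibly preserved by transposition.\<close>

locale mesh =
  fixes p q :: nat and T :: tmesh
  assumes p: "1 \<le> p" and q: "1 \<le> q" and tmesh: "is_tmesh T"
    and dims: "2 * p + 2 \<le> xdim T" "2 * q + 2 \<le> ydim T"
    and cols: "\<And>i. i \<in> {1..(p + 1) div 2 + 1} \<union> {xdim T - (p + 1) div 2..xdim T} \<Longrightarrow>
      {real i} \<times> {1..real (ydim T)} \<subseteq> skel T"
    and rows: "\<And>j. j \<in> {1..(q + 1) div 2 + 1} \<union> {ydim T - (q + 1) div 2..ydim T} \<Longrightarrow>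
      {1..real (xdim T)} \<times> {real j} \<subseteq> skel T"
    and frame: "\<And>i j. (i, j) \<in> tjunctions T \<Longrightarrow>
      (p + 1) div 2 + 1 < i \<and> i + (p + 1) div 2 < xdim T \<and> (q + 1) div 2 + 1 < j \<and> j + (q + 1) div 2 < ydim T"
    and suitable: "analysis_suitable p q T"
begin

lemma mesh_transp: "mesh q p (transp_mesh T)"
proof
  show "{real i} \<times> {1..real (ydim (transp_mesh T))} \<subseteq> skel (transp_mesh T)"
    if "i \<in> {1..(q + 1) div 2 + 1} \<union> {xdim (transp_mesh T) - (q + 1) div 2..xdim (transp_mesh T)}" for i
    using rows[of i] that by (auto simp: skel_transp in_swap_image)
  show "{1..real (xdim (transp_mesh T))} \<times> {real j} \<subseteq> skel (transp_mesh T)"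
    if "j \<in> {1..(p + 1) div 2 + 1} \<union> {ydim (transp_mesh T) - (p + 1) div 2..ydim (transp_mesh T)}" for j
    using cols[of j] that by (auto simp: skel_transp in_swap_image)
qed (use p q tmesh dims suitable frame in \<open>auto simp: is_tmesh_transp analysis_suitable_transp tjunctions_transp\<close>)

lemma cell_bounds:
  assumes "((i1, i2), (j1, j2)) \<in> cells T"
  shows "1 \<le> i1" "i1 < i2" "i2 \<le> xdim T" "1 \<le> j1" "j1 < j2" "j2 \<le> ydim T"
proof -
  show l: "i1 < i2" "j1 < j2" using tmesh assms unfolding is_tmesh_def by fastforce+
  have "closed_box ((i1, i2), (j1, j2)) \<subseteq> index_domain T"
    using tmesh assms unfolding is_tmesh_def by blast
  moreover have "(real i1, real j1) \<in> closed_box ((i1, i2), (j1, j2))" "(real i2, real j2) \<in> closed_box ((i1, i2), (j1, j2))"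
    using l by auto
  ultimately have "(real i1, real j1) \<in> index_domain T" "(real i2, real j2) \<in> index_domain T" by blast+
  then show "1 \<le> i1" "i2 \<le> xdim T" "1 \<le> j1" "j2 \<le> ydim T"
    unfolding index_domain_def by auto
qed

lemma vertex_bounds:
  assumes "(i, j) \<in> vertices T"
  shows "1 \<le> i" "i \<le> xdim T" "1 \<le> j" "j \<le> ydim T"
  using assms cell_bounds unfolding vertices_iff by (meson le_trans less_imp_le)+

lemma on_hskel_bounds:
  assumes "on_hskel T x y"
  shows "2 \<le> x" "x \<le> 2 * int (xdim T)" "2 \<le> y" "y \<le> 2 * int (ydim T)" "even y"
proof -
  obtain i1 i2 j where e: "((i1, i2), (j, j)) \<in> hedges T" "y = 2 * int j" "2 * int i1 \<le> x" "x \<le> 2 * int i2"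
    using assms unfolding on_hskel_iff by blast
  then have v: "(i1, j) \<in> vertices T" "(i2, j) \<in> vertices T" by (auto simp: hedges_iff)
  show "2 \<le> x" "x \<le> 2 * int (xdim T)" "2 \<le> y" "y \<le> 2 * int (ydim T)" "even y"
    using vertex_bounds[OF v(1)] vertex_bounds[OF v(2)] e by auto
qed

text \<open>Admissibility speaks of the union of both skeletons. No vertical edge passes through the
  midpoint of a horizontal unit segment, so at midpoints it must be the horizontal skeleton; all
  other points are ends of such segments.\<close>

lemma full_rows:
  assumes "j \<in> {1..(q + 1) div 2 + 1} \<union> {ydim T - (q + 1) div 2..ydim T}"
    and x: "2 \<le> x" "x \<le> 2 * int (xdim T)"
  shows "on_hskel T x (2 * int j)"
proof -
  have o: "on_hskel T x (2 * int j)" if "odd x" "2 \<le> x" "x \<le> 2 * int (xdim T)" for x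
  proof -
    have "(real_of_int x / 2, real j) \<in> skel T" using rows[OF assms(1)] that by force
    moreover have "(real_of_int x / 2, real j) \<notin> vskel T"
    proof
      assume "(real_of_int x / 2, real j) \<in> vskel T"
      then have "\<exists>i. real_of_int x / 2 = real i"
        unfolding vskel_def vedges_def by fastforce
      then obtain i where "real_of_int x / 2 = real i" by blast
      then have "x = 2 * int i" by linarith
      then show False using \<open>odd x\<close> by simp
    qed
    ultimately show ?thesis unfolding skel_def on_hskel_def by simp
  qed
  show ?thesis
  proof (cases "odd x")
    case False
    then have "odd (x + 1)" "odd (x - 1)" by auto
    have "x + 1 \<le> 2 * int (xdim T) \<or> 2 \<le> x - 1" using x dims p by linarith
    then show ?thesis
      using o[of "x + 1"] o[of "x - 1"] on_hskel_odd[of "x + 1" T "2 * int j"] on_hskel_odd[of "x - 1" T "2 * int j"] x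
        \<open>odd (x + 1)\<close> \<open>odd (x - 1)\<close> by auto
  qed (use o x in auto)
qed

end

context mesh begin

lemmas full_cols = mesh.full_rows[OF mesh_transp, simplified, unfolded on_hskel_transp]
lemmas on_vskel_bounds = mesh.on_hskel_bounds[OF mesh_transp, simplified, unfolded on_hskel_transp]

text \<open>An edge through a point that is not a vertex continues on both sides of it, and at least
  one of these sides is inside the cell.\<close>

lemma crossing_aux:
  assumes "((i1, i2), (j1, j2)) \<in> cells T" "i1 < i" "i < i2" "j1 \<le> j" "j \<le> j2"
    and "on_vskel T (2 * int i) (2 * int j)" "(i, j) \<notin> vertices T"
  shows False
proof -
  have "on_hskel (transp_mesh T) (2 * int j) (2 * int i)" using assms(6) by (simp add: on_hskel_transp)
  then obtain a b where e: "((i, i), (a, b)) \<in> vedges T" "a \<le> j" "j \<le> b"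
    unfolding on_hskel_iff by (auto simp: hedges_transp)
  then have ab: "a < j" "j < b"
    using assms(7) by (auto simp: vedges_iff le_less)
  \<comment> \<open>Half a unit from \<open>j\<close> into the cell; since cell and edge have
    integer ends, the point stays in both.\<close>
  define y where "y = (if j < j2 then real j + 1 / 2 else real j - 1 / 2)"
  have "(real i, y) \<in> open_box ((i1, i2), (j1, j2))"
    using assms cell_bounds[OF assms(1)] by (auto simp: y_def)
  moreover have "(real i, y) \<in> closed_box ((i, i), (a, b))"
    using ab by (auto simp: y_def)
  ultimately show False using e(1) assms(1) unfolding vedges_iff by blast
qed

end

context mesh begin

text \<open>In a closed cell containing the point it is not a corner, so one of its coordinates is
  strictly between the sides. The skeleton line with that fixed coordinate would then enter the open
  cell.\<close>

lemma crossing_vertex: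
  assumes H: "on_hskel T (2 * int i) (2 * int j)" and V: "on_vskel T (2 * int i) (2 * int j)"
  shows "(i, j) \<in> vertices T"
proof (rule ccontr)
  assume n: "(i, j) \<notin> vertices T"
  have "(real i, real j) \<in> index_domain T"
    using on_hskel_bounds[OF H] unfolding index_domain_def by auto
  moreover have "(\<Union>C \<in> cells T. closed_box C) = index_domain T"
    using tmesh unfolding is_tmesh_def by simp
  ultimately obtain C where "C \<in> cells T" "(real i, real j) \<in> closed_box C" by blast
  moreover obtain i1 i2 j1 j2 where "C = ((i1, i2), (j1, j2))" by (metis surj_pair)
  ultimately have C: "((i1, i2), (j1, j2)) \<in> cells T" "i1 \<le> i" "i \<le> i2" "j1 \<le> j" "j \<le> j2" by auto
  have "(i1 < i \<and> i < i2) \<or> (j1 < j \<and> j < j2)"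
    using n C unfolding vertices_iff by (metis le_neq_implies_less)
  then show False
  proof
    assume "i1 < i \<and> i < i2"
    then show False using crossing_aux[OF C(1) _ _ C(4,5) V n] by blast
  next
    assume "j1 < j \<and> j < j2"
    then show False
      using mesh.crossing_aux[OF mesh_transp, of j1 j2 i1 i2 j i] C H n
      by (simp add: in_swap_image on_vskel_transp vertices_transp)
  qed
qed

lemma hedges_at_vertex:
  assumes "(i, j) \<in> vertices T"
  shows "finite {E \<in> hedges T. (real i, real j) \<in> closed_box E} \<and>
     card {E \<in> hedges T. (real i, real j) \<in> closed_box E}
     \<le> of_bool (on_hskel T (2 * int i + 1) (2 * int j)) + of_bool (on_hskel T (2 * int i - 1) (2 * int j))"
proof -
  let ?R = "{((i, k), (j, j)) | k. ((i, k), (j, j)) \<in> hedges T}" and ?L = "{((k, i), (j, j)) | k. ((k, i), (j, j)) \<in> hedges T}"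
  have R: "finite ?R \<and> card ?R \<le> of_bool (on_hskel T (2 * int i + 1) (2 * int j))"
    by (rule card_unique) (use hedge_unique_right hedge_right in blast)+
  have L: "finite ?L \<and> card ?L \<le> of_bool (on_hskel T (2 * int i - 1) (2 * int j))"
    by (rule card_unique) (use hedge_unique_left hedge_left in blast)+
  have "{E \<in> hedges T. (real i, real j) \<in> closed_box E} \<subseteq> ?R \<union> ?L"
  proof clarify
    fix a b c d assume e: "((a, b), (c, d)) \<in> hedges T" "(real i, real j) \<in> closed_box ((a, b), (c, d))"
      and n: "\<nexists>k. ((a, b), (c, d)) = ((k, i), (j, j)) \<and> ((k, i), (j, j)) \<in> hedges T"
    then have cd: "c = d" and abj: "c = j" "a \<le> i" "i \<le> b" by (auto simp: hedges_iff)
    have "\<not> (a < i \<and> i < b)" using e(1) assms abj unfolding hedges_iff by blast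
    then have "i = a" using n e abj cd by auto
    then show "\<exists>k. ((a, b), (c, d)) = ((i, k), (j, j)) \<and> ((i, k), (j, j)) \<in> hedges T" using e cd abj by blast
  qed
  then show ?thesis using R L card_mono[of "?R \<union> ?L"] card_Un_le[of ?R ?L] finite_subset
    by (smt (verit) add_mono finite_Un le_trans)
qed

end

context mesh begin

text \<open>Edges are minimal, so at a vertex each of the four directions carries at most one. As
  the valence of an inner vertex is at least three, at most one direction can be empty
  there.\<close>

lemma valence_le:
  assumes "(i, j) \<in> vertices T"
  shows "valence T (i, j) \<le> of_bool (on_hskel T (2 * int i + 1) (2 * int j)) + of_bool (on_hskel T (2 * int i - 1) (2 * int j))
     + of_bool (on_vskel T (2 * int i) (2 * int j + 1)) + of_bool (on_vskel T (2 * int i) (2 * int j - 1))"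
proof -
  have eq: "{E \<in> vedges T. (real i, real j) \<in> closed_box E}
      = prod.swap ` {E \<in> hedges (transp_mesh T). (real j, real i) \<in> closed_box E}"
    unfolding hedges_transp_image
  proof (intro equalityI subsetI)
    fix E assume "E \<in> {E \<in> vedges T. (real i, real j) \<in> closed_box E}"
    then show "E \<in> prod.swap ` {E \<in> prod.swap ` vedges T. (real j, real i) \<in> closed_box E}"
      by (intro image_eqI[of _ _ "prod.swap E"]) (auto simp: closed_box_swap in_swap_image)
  qed (auto simp: closed_box_swap in_swap_image)
  have "card {E \<in> vedges T. (real i, real j) \<in> closed_box E}
     \<le> of_bool (on_vskel T (2 * int i) (2 * int j + 1)) + of_bool (on_vskel T (2 * int i) (2 * int j - 1))"
    using mesh.hedges_at_vertex[OF mesh_transp, of j i] assms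
    unfolding eq by (simp add: card_image vertices_transp on_hskel_transp)
  moreover have "valence T (i, j) \<le> card {E \<in> hedges T. (real i, real j) \<in> closed_box E}
      + card {E \<in> vedges T. (real i, real j) \<in> closed_box E}"
  proof -
    let ?P = "\<lambda>E. (real i, real j) \<in> closed_box E"
    have "{E \<in> hedges T \<union> vedges T. ?P E} = {E \<in> hedges T. ?P E} \<union> {E \<in> vedges T. ?P E}"
      by (rule Collect_disj_eq[THEN trans[rotated]]) (simp add: conj_disj_distribR)
    then have "valence T (i, j) = card ({E \<in> hedges T. ?P E} \<union> {E \<in> vedges T. ?P E})"
      by (simp only: valence_def fst_conv snd_conv)
    then show ?thesis using card_Un_le by simp
  qed
  ultimately show ?thesis using hedges_at_vertex[OF assms] by linarith
qed

lemma inner_valence: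
  assumes "(i, j) \<in> vertices T" "1 < i" "i < xdim T" "1 < j" "j < ydim T"
  shows "valence T (i, j) \<ge> 3"
proof -
  have "(i, j) \<in> inner_vertices T" using assms by (simp add: inner_vertices_def)
  then have "valence T (i, j) = 3 \<or> valence T (i, j) = 4" using tmesh unfolding is_tmesh_def by blast
  then show ?thesis by linarith
qed

lemma inner_vertex_skel:
  assumes "(i, j) \<in> vertices T" "1 < i" "i < xdim T" "1 < j" "j < ydim T"
  shows "on_hskel T (2 * int i) (2 * int j)" "on_vskel T (2 * int i) (2 * int j)"
proof -
  have "on_hskel T (2 * int i + 1) (2 * int j) \<or> on_hskel T (2 * int i - 1) (2 * int j)"
    "on_vskel T (2 * int i) (2 * int j + 1) \<or> on_vskel T (2 * int i) (2 * int j - 1)"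
    using valence_le[OF assms(1)] inner_valence[OF assms] by (auto simp: of_bool_def split: if_splits)
  then show "on_hskel T (2 * int i) (2 * int j)" "on_vskel T (2 * int i) (2 * int j)"
    using on_hskel_odd[of "2 * int i + 1" T "2 * int j"] on_hskel_odd[of "2 * int i - 1" T "2 * int j"]
      on_hskel_odd[of "2 * int j + 1" "transp_mesh T" "2 * int i"] on_hskel_odd[of "2 * int j - 1" "transp_mesh T" "2 * int i"]
    by (auto simp: on_hskel_transp)
qed

text \<open>With one direction empty and valence at least three, the other three are occupied. The
  boundary is excluded: the outermost rows are complete, and on an outermost column the only
  horizontal direction inside the domain cannot be empty, as the skeleton has no isolated
  points.\<close>

lemma tee:
  assumes "on_hskel T (2 * int i) (2 * int j)" "\<not> on_hskel T (2 * int i + \<sigma>) (2 * int j)" "\<sigma> \<in> {1, -1}"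
    "2 \<le> 2 * int i + \<sigma>" "2 * int i + \<sigma> \<le> 2 * int (xdim T)"
  shows "(i, j) \<in> tjunctions T" "on_vskel T (2 * int i) (2 * int j + 1)" "on_vskel T (2 * int i) (2 * int j - 1)"
    "1 < i" "i < xdim T" "1 < j" "j < ydim T"
proof -
  have "j \<noteq> 1" "j \<noteq> ydim T" using full_rows[of j "2 * int i + \<sigma>"] assms by auto
  then show j: "1 < j" "j < ydim T" using on_hskel_bounds[OF assms(1)] by auto
  have "i \<noteq> 1" "i \<noteq> xdim T"
    using assms on_hskel_even[OF assms(1)] on_hskel_bounds(1,2)[of "2 * int i - 1" "2 * int j"] on_hskel_bounds(1,2)[of "2 * int i + 1" "2 * int j"]
    by auto
  then show i: "1 < i" "i < xdim T" using on_hskel_bounds[OF assms(1)] by auto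
  have v: "(i, j) \<in> vertices T"
  proof (rule ccontr)
    assume n: "(i, j) \<notin> vertices T"
    obtain i1 i2 where e: "((i1, i2), (j, j)) \<in> hedges T" "i1 \<le> i" "i \<le> i2"
      using assms(1) unfolding on_hskel_iff by auto
    then have "i1 < i" "i < i2" using n by (auto simp: hedges_iff le_less)
    then have "on_hskel T (2 * int i + \<sigma>) (2 * int j)"
      unfolding on_hskel_iff using assms(3) e by (intro exI[of _ i1] exI[of _ i2] exI[of _ j]) auto
    then show False using assms(2) by simp
  qed
  have "valence T (i, j) \<ge> 3" by (rule inner_valence[OF v i j])
  then have "valence T (i, j) = 3 \<and> on_vskel T (2 * int i) (2 * int j + 1) \<and> on_vskel T (2 * int i) (2 * int j - 1)"
    using valence_le[OF v] assms(2,3) by (auto simp: of_bool_def split: if_splits)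
  then show "(i, j) \<in> tjunctions T" "on_vskel T (2 * int i) (2 * int j + 1)" "on_vskel T (2 * int i) (2 * int j - 1)"
    using v i j by (auto simp: tjunctions_def inner_vertices_def)
qed

end

section \<open>Reach and domain of the extensions\<close>

context mesh begin

text \<open>An inner vertex has at most one empty direction, hence a vertical edge; on the two
  boundary columns admissibility provides one.\<close>

lemma row_hits_iff:
  assumes "1 < j" "j < ydim T"
  shows "i \<in> row_hits T j \<longleftrightarrow> on_vskel T (2 * int i) (2 * int j)"
proof -
  have "on_vskel T (2 * int i) (2 * int j)" if v: "(i, j) \<in> vertices T"
  proof (cases "1 < i \<and> i < xdim T")
    case True
    then show ?thesis using inner_vertex_skel[OF v] assms by blast
  next
    case False
    then have "i = 1 \<or> i = xdim T" using vertex_bounds[OF v] by linarith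
    then show ?thesis using full_cols[of i "2 * int j"] assms by auto
  qed
  then show ?thesis unfolding row_hits_def on_vskel_def by auto
qed

text \<open>A T-junction lies strictly inside the active region, so the last
  \<open>(p + 1) div 2\<close> columns, which are full, are all to its right. This guarantees that
  traces end.\<close>

lemma hits_right:
  assumes "(i, j) \<in> tjunctions T"
  shows "(p + 1) div 2 \<le> card {x \<in> row_hits T j. i < x \<and> x \<le> xdim T}"
proof -
  have j: "1 < j" "j < ydim T" using frame[OF assms] by auto
  have "card {xdim T - (p + 1) div 2 + 1..xdim T} \<le> card {x \<in> row_hits T j. i < x \<and> x \<le> xdim T}"
  proof (rule card_mono)
    show "{xdim T - (p + 1) div 2 + 1..xdim T} \<subseteq> {x \<in> row_hits T j. i < x \<and> x \<le> xdim T}"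
    proof
      fix x assume "x \<in> {xdim T - (p + 1) div 2 + 1..xdim T}"
      then show "x \<in> {x \<in> row_hits T j. i < x \<and> x \<le> xdim T}"
        using full_cols[of x "2 * int j"] j frame[OF assms] by (auto simp: row_hits_iff)
    qed
  qed auto
  then show ?thesis using dims by auto
qed

lemma hits_left:
  assumes "(i, j) \<in> tjunctions T"
  shows "(p + 1) div 2 \<le> card {x \<in> row_hits T j. 1 \<le> x \<and> x < i}"
proof -
  have j: "1 < j" "j < ydim T" using frame[OF assms] by auto
  have "card {1..(p + 1) div 2} \<le> card {x \<in> row_hits T j. 1 \<le> x \<and> x < i}"
  proof (rule card_mono)
    show "{1..(p + 1) div 2} \<subseteq> {x \<in> row_hits T j. 1 \<le> x \<and> x < i}"
    proof
      fix x assume "x \<in> {1..(p + 1) div 2}"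
      then show "x \<in> {x \<in> row_hits T j. 1 \<le> x \<and> x < i}"
        using full_cols[of x "2 * int j"] j frame[OF assms] by (auto simp: row_hits_iff)
    qed
  qed auto
  then show ?thesis by auto
qed

lemma hits_right_le: "(i, j) \<in> tjunctions T \<Longrightarrow> k \<le> (p + 1) div 2 \<Longrightarrow>
    k \<le> card {x \<in> row_hits T j. i < x \<and> x \<le> xdim T} \<and> i \<le> xdim T"
  using hits_right[of i j] frame[of i j] by fastforce

lemma hits_left_le: "(i, j) \<in> tjunctions T \<Longrightarrow> k \<le> (p + 1) div 2 \<Longrightarrow>
    k \<le> card {x \<in> row_hits T j. 1 \<le> x \<and> x < i} \<and> 1 \<le> i"
  using hits_left[of i j] frame[of i j] by fastforce

lemma on_hext_right:
  assumes t: "(i, j) \<in> tjunctions T" and n: "\<not> on_hskel T (2 * int i + 1) (2 * int j)"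
    and c: "2 * int (trace_down (row_hits T j) (p div 2) i) \<le> c"
      "c \<le> 2 * int (trace_up (row_hits T j) ((p + 1) div 2) i)"
  shows "on_hext p T c (2 * int j)"
proof -
  have "((trace_down (row_hits T j) (p div 2) i, trace_up (row_hits T j) ((p + 1) div 2) i), (j, j)) \<in> hexts p T"
    using t n hedge_right unfolding hexts_def by blast
  then show ?thesis unfolding on_hext_def
    by (rule bexI[rotated]) (use c in auto)
qed

lemma on_hext_left:
  assumes t: "(i, j) \<in> tjunctions T" and n: "\<not> on_hskel T (2 * int i - 1) (2 * int j)"
    and c: "2 * int (trace_down (row_hits T j) ((p + 1) div 2) i) \<le> c"
      "c \<le> 2 * int (trace_up (row_hits T j) (p div 2) i)"
  shows "on_hext p T c (2 * int j)"
proof -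
  have "((trace_down (row_hits T j) ((p + 1) div 2) i, trace_up (row_hits T j) (p div 2) i), (j, j)) \<in> hexts p T"
    using t n hedge_left unfolding hexts_def by blast
  then show ?thesis unfolding on_hext_def
    by (rule bexI[rotated]) (use c in auto)
qed

text \<open>The target lies on the face side in the first claim and on the edge side in the second.
  The end of the extension on that side is controlled by the number of hits, the other end by the
  fact that both traces start at \<open>i\<close>.\<close>

lemma face_edge_ext:
  assumes H: "on_hskel T (2 * int i) (2 * int j)" "\<not> on_hskel T (2 * int i + \<sigma>) (2 * int j)" "\<sigma> \<in> {1, -1}"
    "2 \<le> 2 * int i + \<sigma>" "2 * int i + \<sigma> \<le> 2 * int (xdim T)"
  shows "0 < \<sigma> * (c - 2 * int i) \<Longrightarrow>
      card {k. even k \<and> 0 < \<sigma> * (k - 2 * int i) \<and> 0 < \<sigma> * (c - k) \<and> on_vskel T k (2 * int j)} < (p + 1) div 2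
      \<Longrightarrow> on_hext p T c (2 * int j)"
    and "0 \<le> \<sigma> * (2 * int i - c) \<Longrightarrow> c = 2 * int i \<or>
      card {k. even k \<and> 0 < \<sigma> * (2 * int i - k) \<and> 0 < \<sigma> * (k - c) \<and> on_vskel T k (2 * int j)} < p div 2
      \<Longrightarrow> on_hext p T c (2 * int j)"
proof -
  have t: "(i, j) \<in> tjunctions T" and ij: "1 < i" "i < xdim T" "1 < j" "j < ydim T"
    using tee[OF H] by auto
  have hit: "on_vskel T (2 * int x) (2 * int j)" if "x \<in> row_hits T j" for x
    using that row_hits_iff ij by blast
  have kk: "(p + 1) div 2 \<le> (p + 1) div 2" "p div 2 \<le> (p + 1) div 2" by auto
  note up = trace_up_reach[OF conjunct1[OF hits_right_le[OF t]] conjunct2[OF hits_right_le[OF t]], where P = "\<lambda>k. on_vskel T k (2 * int j)"]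
  note down = trace_down_reach[OF conjunct1[OF hits_left_le[OF t]] conjunct2[OF hits_left_le[OF t]], where P = "\<lambda>k. on_vskel T k (2 * int j)"]
  note up' = trace_up_props(1)[OF conjunct1[OF hits_right_le[OF t]] conjunct2[OF hits_right_le[OF t]]]
  note down' = trace_down_props(1)[OF conjunct1[OF hits_left_le[OF t]] conjunct2[OF hits_left_le[OF t]]]
  show "on_hext p T c (2 * int j)" if "0 < \<sigma> * (c - 2 * int i)"
      "card {k. even k \<and> 0 < \<sigma> * (k - 2 * int i) \<and> 0 < \<sigma> * (c - k) \<and> on_vskel T k (2 * int j)} < (p + 1) div 2"
  proof (cases "\<sigma> = 1")
    case True
    show ?thesis
    proof (rule on_hext_right[OF t])
      show "c \<le> 2 * int (trace_up (row_hits T j) ((p + 1) div 2) i)"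
        using that True hit by (intro up[OF kk(1) kk(1)]) auto
      show "2 * int (trace_down (row_hits T j) (p div 2) i) \<le> c"
        using that True down'[OF kk(2) kk(2)] by auto
    qed (use H True in auto)
  next
    case False
    then have s: "\<sigma> = - 1" using H by auto
    show ?thesis
    proof (rule on_hext_left[OF t])
      show "2 * int (trace_down (row_hits T j) ((p + 1) div 2) i) \<le> c"
        using that s hit by (intro down[OF kk(1) kk(1)]) (auto simp: conj_ac)
      show "c \<le> 2 * int (trace_up (row_hits T j) (p div 2) i)"
        using that s up'[OF kk(2) kk(2)] by auto
    qed (use H s in auto)
  qed
  show "on_hext p T c (2 * int j)" if "0 \<le> \<sigma> * (2 * int i - c)" and c: "c = 2 * int i \<or>
      card {k. even k \<and> 0 < \<sigma> * (2 * int i - k) \<and> 0 < \<sigma> * (k - c) \<and> on_vskel T k (2 * int j)} < p div 2"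
  proof (cases "\<sigma> = 1")
    case True
    show ?thesis
    proof (rule on_hext_right[OF t])
      show "2 * int (trace_down (row_hits T j) (p div 2) i) \<le> c"
        using c
      proof
        assume "c = 2 * int i" then show ?thesis using down'[OF kk(2) kk(2)] by auto
      next
        assume "card {k. even k \<and> 0 < \<sigma> * (2 * int i - k) \<and> 0 < \<sigma> * (k - c) \<and> on_vskel T k (2 * int j)} < p div 2"
        then show ?thesis using True hit by (intro down[OF kk(2) kk(2)]) (auto simp: conj_ac)
      qed
      show "c \<le> 2 * int (trace_up (row_hits T j) ((p + 1) div 2) i)"
        using that True up'[OF kk(1) kk(1)] by auto
    qed (use H True in auto)
  next
    case False
    then have s: "\<sigma> = - 1" using H by auto
    show ?thesis
    proof (rule on_hext_left[OF t])
      show "c \<le> 2 * int (trace_up (row_hits T j) (p div 2) i)"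
        using c
      proof
        assume "c = 2 * int i" then show ?thesis using up'[OF kk(2) kk(2)] by auto
      next
        assume "card {k. even k \<and> 0 < \<sigma> * (2 * int i - k) \<and> 0 < \<sigma> * (k - c) \<and> on_vskel T k (2 * int j)} < p div 2"
        then show ?thesis using s hit by (intro up[OF kk(2) kk(2)]) (auto simp: conj_ac)
      qed
      show "2 * int (trace_down (row_hits T j) ((p + 1) div 2) i) \<le> c"
        using that s down'[OF kk(1) kk(1)] by auto
    qed (use H s in auto)
  qed
qed

lemma hexts_domain:
  assumes "E \<in> hexts p T"
  shows "closed_box E \<subseteq> index_domain T"
proof -
  have b: "1 \<le> trace_down (row_hits T j) k i \<and> trace_up (row_hits T j) k' i \<le> xdim T \<and> 1 \<le> j \<and> j \<le> ydim T"
    if t: "(i, j) \<in> tjunctions T" and k: "k \<le> (p + 1) div 2" "k' \<le> (p + 1) div 2" for i j k k'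
    using trace_up_props(2)[OF conjunct1[OF hits_right_le[OF t k(2)]] conjunct2[OF hits_right_le[OF t k(2)]]]
      trace_down_props(2)[OF conjunct1[OF hits_left_le[OF t k(1)]] conjunct2[OF hits_left_le[OF t k(1)]]]
      frame[OF t] by auto
  have "p div 2 \<le> (p + 1) div 2" by auto
  then have "\<exists>x1 x2 j. E = ((x1, x2), (j, j)) \<and> 1 \<le> x1 \<and> x2 \<le> xdim T \<and> 1 \<le> j \<and> j \<le> ydim T"
    using assms b unfolding hexts_def by blast
  then show ?thesis unfolding index_domain_def by auto
qed

lemma hskel_domain: "hskel T \<subseteq> index_domain T"
proof -
  have "closed_box E \<subseteq> index_domain T" if "E \<in> hedges T" for E
  proof -
    have "\<exists>i1 i2 j. E = ((i1, i2), (j, j))" using that unfolding hedges_def by blast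
    then obtain i1 i2 j where E: "E = ((i1, i2), (j, j))" by blast
    then have "(i1, j) \<in> vertices T" "(i2, j) \<in> vertices T" using that by (auto simp: hedges_iff)
    from vertex_bounds[OF this(1)] vertex_bounds[OF this(2)] show ?thesis
      unfolding E index_domain_def by auto
  qed
  then show ?thesis unfolding hskel_def by blast
qed

end

context mesh begin

lemma vexts_domain:
  assumes "E \<in> vexts q T"
  shows "closed_box E \<subseteq> index_domain T"
proof -
  have "prod.swap E \<in> hexts q (transp_mesh T)" using assms by (simp add: hexts_transp)
  from mesh.hexts_domain[OF mesh_transp this] show ?thesis
    unfolding closed_box_swap index_domain_transp by auto
qed

lemma vskel_domain: "vskel T \<subseteq> index_domain T"
  using mesh.hskel_domain[OF mesh_transp] unfolding hskel_transp index_domain_transp by auto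

lemma ext_skel_domain: "ext_skel p q T \<subseteq> index_domain T"
  using hexts_domain vexts_domain hskel_domain vskel_domain unfolding ext_skel_def skel_def by blast

lemma on_hext_Vx_disjoint: "on_hext p T x y \<Longrightarrow> on_vext q T x y \<Longrightarrow> False"
  using suitable unfolding analysis_suitable_def on_hext_def on_vext_def by blast

lemma grid_in_ext_skel:
  assumes "on_vskel T x y \<or> on_vext q T x y"
  shows "(real_of_int x / 2, real_of_int y / 2) \<in> ext_skel p q T"
  using assms unfolding on_vskel_def on_vext_def ext_skel_def skel_def by blast

end

section \<open>Local index vectors\<close>

text \<open>The window is cut out of the increasing list of all indices, starting \<open>k\<close>
  places before \<open>i1\<close>; the two counting hypotheses say that it fits.\<close>

lemma exists_index_vector:
  assumes fin: "finite I" and "i1 \<in> I" "i2 \<in> I" and odd: "odd d \<Longrightarrow> i1 = i2" and even: "even d \<Longrightarrow> i1 < i2"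
    and gap: "\<And>i. i1 < i \<Longrightarrow> i < i2 \<Longrightarrow> i \<notin> I"
    and left: "(d + 1) div 2 \<le> card {x \<in> I. x < i1}" and right: "(d + 1) div 2 \<le> card {x \<in> I. i2 < x}"
  shows "\<exists>v. is_local_index_vector d I (i1, i2) v"
proof -
  define L where "L = sorted_list_of_set I"
  have L: "sorted_wrt (<) L" "set L = I" "distinct L" using fin by (auto simp: L_def)
  obtain n where n: "n < length L" "L ! n = i1" using \<open>i1 \<in> I\<close> L(2) by (metis in_set_conv_nth)
  have less: "L ! a < L ! b \<longleftrightarrow> a < b" if "a < length L" "b < length L" for a b
    using L(1) that by (metis linorder_neqE_nat not_less_iff_gr_or_eq sorted_wrt_iff_nth_less)
  define k where "k = (d + 1) div 2"
  have "{x \<in> I. x < i1} \<subseteq> (!) L ` {..<n}"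
  proof
    fix x assume x: "x \<in> {x \<in> I. x < i1}"
    then obtain a where "a < length L" "x = L ! a" using L(2) by (metis (mono_tags) in_set_conv_nth mem_Collect_eq)
    then show "x \<in> (!) L ` {..<n}" using x n less by auto
  qed
  then have "card {x \<in> I. x < i1} \<le> n" by (metis card_lessThan finite_lessThan surj_card_le)
  then have kn: "k \<le> n" using left by (simp add: k_def)
  have big: "{x \<in> I. i1 < x} \<subseteq> (!) L ` {n + 1..<length L}"
  proof
    fix x assume x: "x \<in> {x \<in> I. i1 < x}"
    then obtain a where "a < length L" "x = L ! a" using L(2) by (metis (mono_tags) in_set_conv_nth mem_Collect_eq)
    then show "x \<in> (!) L ` {n + 1..<length L}" using x n less by auto
  qed
  have "d div 2 + 1 \<le> card {x \<in> I. i1 < x}"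
  proof (cases "even d")
    case True
    have "insert i2 {x \<in> I. i2 < x} \<subseteq> {x \<in> I. i1 < x}" using even[OF True] \<open>i2 \<in> I\<close> by auto
    then have "card (insert i2 {x \<in> I. i2 < x}) \<le> card {x \<in> I. i1 < x}" using fin by (intro card_mono) auto
    then show ?thesis using right fin True by simp
  next
    case False
    then show ?thesis using right odd by (auto elim!: oddE)
  qed
  also have "\<dots> \<le> card ((!) L ` {n + 1..<length L})" using big by (intro card_mono) auto
  also have "\<dots> \<le> length L - (n + 1)" by (metis card_image_le card_atLeastLessThan finite_atLeastLessThan)
  finally have len: "n - k + (d + 2) \<le> length L" using n kn unfolding k_def by linarith
  define v where "v = map (\<lambda>t. L ! (n - k + t)) [0..<d + 2]"
  have v: "length v = d + 2" "\<And>t. t < d + 2 \<Longrightarrow> v ! t = L ! (n - k + t)"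
    by (simp_all add: v_def del: upt_Suc)
  have hl: "hd v = L ! (n - k)" "last v = L ! (n - k + (d + 1))"
    using v by (simp_all add: hd_conv_nth last_conv_nth flip: length_greater_0_conv)
  have "sorted_wrt (<) v" unfolding sorted_wrt_iff_nth_less using v less len by auto
  moreover have "set v = I \<inter> {hd v..last v}"
  proof (intro equalityI subsetI)
    fix x assume "x \<in> set v"
    then obtain t where "t < d + 2" "x = L ! (n - k + t)" using v by (metis in_set_conv_nth)
    then have "x \<in> I" using len L(2) nth_mem[of "n - k + t" L] by auto
    then show "x \<in> I \<inter> {hd v..last v}"
      using sorted_wrt_less_bounds[OF \<open>sorted_wrt (<) v\<close> \<open>x \<in> set v\<close>] by auto
  next
    fix x assume x: "x \<in> I \<inter> {hd v..last v}"
    then obtain a where a: "a < length L" "x = L ! a" using L(2) by (metis IntD1 in_set_conv_nth)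
    have "n - k \<le> a" "a \<le> n - k + (d + 1)"
      using x a less[of a "n - k"] less[of "n - k + (d + 1)" a] len unfolding hl by (auto simp: not_le)
    then have "v ! (a - (n - k)) = x" using v(2)[of "a - (n - k)"] a by auto
    then show "x \<in> set v" using v(1) \<open>n - k \<le> a\<close> \<open>a \<le> n - k + (d + 1)\<close> by (metis in_set_conv_nth less_Suc_eq_le
          add_2_eq_Suc' add.commute Suc_eq_plus1 le_diff_conv)
  qed
  moreover have vk: "v ! k = i1" using v(2)[of k] kn n by (simp add: k_def)
  moreover have "v ! (k + 1) = i2" if "even d"
  proof -
    have n1: "n + 1 < length L" using len kn that by (auto simp: k_def)
    have "v ! (k + 1) = L ! (n + 1)" using v(2)[of "k + 1"] kn that by (simp add: k_def)
    moreover have "L ! (n + 1) \<in> I" "i1 < L ! (n + 1)" using n1 L(2) n less by auto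
    moreover obtain a where a: "a < length L" "i2 = L ! a" using \<open>i2 \<in> I\<close> L(2) by (metis in_set_conv_nth)
    moreover have "n < a" using even[OF that] a n less by auto
    ultimately show ?thesis using gap[of "L ! (n + 1)"] less[of a "n + 1"] less[of "n + 1" a] n1
      by (metis Suc_eq_plus1 linorder_neqE_nat not_less_eq)
  qed
  ultimately have "is_local_index_vector d I (i1, i2) v"
    unfolding is_local_index_vector_def using v(1) odd by (auto simp: k_def)
  then show ?thesis by blast
qed

text \<open>The positions \<open>(d + 1) div 2\<close> and \<open>d div 2 + 1\<close> coincide for
  odd \<open>d\<close> and are the two middle ones for even \<open>d\<close>, so that both parities
  can be treated alike.\<close>

lemma index_vector_positions:
  assumes "is_local_index_vector d I (i1, i2) v"
  shows "v ! ((d + 1) div 2) = i1" "v ! (d div 2 + 1) = i2" "length v = d + 2" "sorted_wrt (<) v"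
    "set v = I \<inter> {hd v..last v}" "hd v = v ! 0" "last v = v ! (d + 1)" "v \<noteq> []"
proof -
  show *: "length v = d + 2" "sorted_wrt (<) v" "set v = I \<inter> {hd v..last v}"
    using assms by (auto simp: is_local_index_vector_def)
  show "v \<noteq> []" using * by auto
  then show "hd v = v ! 0" "last v = v ! (d + 1)" using * by (simp_all add: hd_conv_nth last_conv_nth)
  show "v ! ((d + 1) div 2) = i1" "v ! (d div 2 + 1) = i2"
    using assms by (cases "odd d"; auto simp: is_local_index_vector_def elim!: oddE)+
qed

lemma unique_index_vector:
  assumes "finite I" "is_local_index_vector d I (i1, i2) v" "is_local_index_vector d I (i1, i2) w"
  shows "v = w"
proof -
  define L where "L = sorted_list_of_set I"
  have L: "sorted_wrt (<) L" "set L = I" "distinct L" using assms(1) by (auto simp: L_def)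
  note v = index_vector_positions[OF assms(2)] and w = index_vector_positions[OF assms(3)]
  obtain l where l: "l + (d + 2) \<le> length L" "\<And>t. t < d + 2 \<Longrightarrow> v ! t = L ! (l + t)"
    using sorted_window[OF v(4) L(1) v(8)] v(3,5) unfolding L(2) by auto
  obtain l' where l': "l' + (d + 2) \<le> length L" "\<And>t. t < d + 2 \<Longrightarrow> w ! t = L ! (l' + t)"
    using sorted_window[OF w(4) L(1) w(8)] w(3,5) unfolding L(2) by auto
  have k: "(d + 1) div 2 < d + 2" by auto
  have "L ! (l + (d + 1) div 2) = L ! (l' + (d + 1) div 2)"
    using l(2)[OF k] l'(2)[OF k] v(1) w(1) by simp
  then have "l = l'" using nth_eq_iff_index_eq[OF L(3)] l(1) l'(1) k by auto
  then show ?thesis using v(3) w(3) l l' by (intro nth_equalityI) auto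
qed

lemma local_index_vector_props:
  assumes "finite I" "i1 \<in> I" "i2 \<in> I" "odd d \<Longrightarrow> i1 = i2" "even d \<Longrightarrow> i1 < i2"
    "\<And>i. i1 < i \<Longrightarrow> i < i2 \<Longrightarrow> i \<notin> I"
    "(d + 1) div 2 \<le> card {x \<in> I. x < i1}" "(d + 1) div 2 \<le> card {x \<in> I. i2 < x}"
  shows "is_local_index_vector d I (i1, i2) (local_index_vector d I (i1, i2))"
  unfolding local_index_vector_def
  using exists_index_vector[OF assms] unique_index_vector[OF assms(1)] by (metis theI')

text \<open>\<open>int i1 + int i2\<close> is the centre in doubled coordinates. To its right,
  without the last entry, are the positions \<open>(d + 1) div 2 + 1\<close> to \<open>d\<close>; to
  its left, without the first, the positions 1 to \<open>d div 2\<close>. Both ranges have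
  \<open>d div 2\<close> members.\<close>

lemma index_vector_count:
  assumes v: "is_local_index_vector d I (i1, i2) v" and "i1 \<le> i2"
    and P: "\<And>k. P k \<Longrightarrow> \<exists>c\<in>I. k = 2 * int c"
  shows "card {k. int i1 + int i2 < k \<and> k < 2 * int (last v) \<and> P k} \<le> d div 2" (is "card ?R \<le> _")
    and "card {k. 2 * int (hd v) < k \<and> k < int i1 + int i2 \<and> P k} \<le> d div 2" (is "card ?L \<le> _")
proof -
  note v = index_vector_positions[OF v]
  have less: "a < b" if "v ! a < v ! b" "a < d + 2" "b < d + 2" for a b
    using v(3,4) that by (metis linorder_neqE_nat not_less_iff_gr_or_eq sorted_wrt_iff_nth_less)
  have pos: "(d + 1) div 2 < d + 2" "d div 2 + 1 < d + 2" by auto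
  have i: "hd v \<le> i1" "i1 \<le> last v" "hd v \<le> i2" "i2 \<le> last v"
    using sorted_wrt_less_bounds[OF v(4)] v(1,2,3) pos nth_mem by metis+
  have "?R \<subseteq> (\<lambda>t. 2 * int (v ! t)) ` {(d + 1) div 2 + 1..d}"
  proof
    fix k assume k: "k \<in> ?R"
    then obtain c where c: "c \<in> I" "k = 2 * int c" using P by blast
    have "i1 < c" "c < last v" using k c \<open>i1 \<le> i2\<close> by auto
    then have "c \<in> set v" using c i v(5) by auto
    then obtain t where t: "t < d + 2" "c = v ! t" using v(3) by (metis in_set_conv_nth)
    have "(d + 1) div 2 < t" using \<open>i1 < c\<close> less[of "(d + 1) div 2" t] t v(1) pos by auto
    moreover have "t < d + 1" using \<open>c < last v\<close> less[of t "d + 1"] t v(7) by auto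
    ultimately show "k \<in> (\<lambda>t. 2 * int (v ! t)) ` {(d + 1) div 2 + 1..d}" using c t by auto
  qed
  then have "card ?R \<le> card {(d + 1) div 2 + 1..d}" by (rule surj_card_le[rotated]) auto
  then show "card ?R \<le> d div 2" by simp
  have "?L \<subseteq> (\<lambda>t. 2 * int (v ! t)) ` {1..d div 2}"
  proof
    fix k assume k: "k \<in> ?L"
    then obtain c where c: "c \<in> I" "k = 2 * int c" using P by blast
    have "c < i2" "hd v < c" using k c \<open>i1 \<le> i2\<close> by auto
    then have "c \<in> set v" using c i v(5) by auto
    then obtain t where t: "t < d + 2" "c = v ! t" using v(3) by (metis in_set_conv_nth)
    have "t < d div 2 + 1" using \<open>c < i2\<close> less[of t "d div 2 + 1"] t v(2) pos by auto
    moreover have "0 < t" using \<open>hd v < c\<close> less[of 0 t] t v(6) by auto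
    ultimately show "k \<in> (\<lambda>t. 2 * int (v ! t)) ` {1..d div 2}" using c t by auto
  qed
  then have "card ?L \<le> card {1..d div 2}" by (rule surj_card_le[rotated]) auto
  then show "card ?L \<le> d div 2" by simp
qed

text \<open>Edges have integer ends, so an edge containing the midpoint of a unit segment contains
  the whole segment.\<close>

lemma segment_hskel_iff:
  assumes "i1 \<le> i2"
  shows "{real i1..real i2} \<times> {real j} \<subseteq> hskel T \<longleftrightarrow> (\<forall>x\<in>{2 * int i1..2 * int i2}. on_hskel T x (2 * int j))"
proof (intro iffI ballI subsetI)
  fix x assume "{real i1..real i2} \<times> {real j} \<subseteq> hskel T" "x \<in> {2 * int i1..2 * int i2}"
  moreover from this(2) have "(real_of_int x / 2, real j) \<in> {real i1..real i2} \<times> {real j}" by auto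
  ultimately show "on_hskel T x (2 * int j)" unfolding on_hskel_def by auto
next
  fix z assume H: "\<forall>x\<in>{2 * int i1..2 * int i2}. on_hskel T x (2 * int j)" and "z \<in> {real i1..real i2} \<times> {real j}"
  then obtain x where z: "z = (x, real j)" and x: "real i1 \<le> x" "x \<le> real i2" by auto
  define f where "f = \<lfloor>2 * x\<rfloor>"
  have f: "real_of_int f \<le> 2 * x" "2 * x < real_of_int f + 1" unfolding f_def by linarith+
  have fb: "2 * int i1 \<le> f" "f \<le> 2 * int i2" using x unfolding f_def by linarith+
  show "z \<in> hskel T"
  proof (cases "2 * x = real_of_int f")
    case True
    have "(real_of_int f / 2, real j) \<in> hskel T" using H fb unfolding on_hskel_def by auto
    moreover have "real_of_int f / 2 = x" using True by simp
    ultimately show ?thesis unfolding z by simp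
  next
    case False
    then have "real_of_int f < 2 * real i2" using f x by linarith
    then have fb': "f + 1 \<le> 2 * int i2" by linarith
    \<comment> \<open>The odd one of \<open>f\<close> and \<open>f + 1\<close> is, in doubled
      coordinates, the midpoint of a unit segment containing \<open>x\<close>.\<close>
    have "on_hskel T (if odd f then f else f + 1) (2 * int j)" using H fb fb' by auto
    then obtain a b where e: "((a, b), (j, j)) \<in> hedges T"
      "2 * int a \<le> (if odd f then f else f + 1)" "(if odd f then f else f + 1) \<le> 2 * int b"
      unfolding on_hskel_iff by auto
    have "2 * int a \<le> f" "f + 1 \<le> 2 * int b" using e(2,3) by (cases "odd f"; simp; presburger)+
    then have "real a \<le> x" "x \<le> real b" using f by linarith+
    then have "z \<in> closed_box ((a, b), (j, j))" unfolding z by simp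
    then show ?thesis using e(1) unfolding hskel_def by blast
  qed
qed

lemma segment_vskel_iff:
  assumes "j1 \<le> j2"
  shows "{real i} \<times> {real j1..real j2} \<subseteq> vskel T \<longleftrightarrow> (\<forall>y\<in>{2 * int j1..2 * int j2}. on_vskel T (2 * int i) y)"
proof -
  have "{real i} \<times> {real j1..real j2} \<subseteq> vskel T \<longleftrightarrow> {real j1..real j2} \<times> {real i} \<subseteq> hskel (transp_mesh T)"
    unfolding hskel_transp by (auto simp: in_swap_image)
  then show ?thesis using segment_hskel_iff[OF assms, of i "transp_mesh T"] by (simp add: on_hskel_transp)
qed

section \<open>Cells, edges and anchors\<close>

context mesh begin

lemma segment_between_vertices:
  assumes "i1 < i2" "(i1, j) \<in> vertices T" "(i2, j) \<in> vertices T"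
    "\<forall>C\<in>cells T. closed_box ((i1, i2), (j, j)) \<inter> open_box C = {}" "2 * int i1 \<le> x" "x \<le> 2 * int i2"
  shows "on_hskel T x (2 * int j)"
  using assms
proof (induction "i2 - i1" arbitrary: i1 i2 rule: less_induct)
  case less
  show ?case
  proof (cases "\<exists>i. i1 < i \<and> i < i2 \<and> (i, j) \<in> vertices T")
    case True
    then obtain i where i: "i1 < i" "i < i2" "(i, j) \<in> vertices T" by blast
    have "closed_box ((i1, i), (j, j)) \<subseteq> closed_box ((i1, i2), (j, j))"
      "closed_box ((i, i2), (j, j)) \<subseteq> closed_box ((i1, i2), (j, j))" using i by auto
    then have d: "\<forall>C\<in>cells T. closed_box ((i1, i), (j, j)) \<inter> open_box C = {}"
      "\<forall>C\<in>cells T. closed_box ((i, i2), (j, j)) \<inter> open_box C = {}" using less.prems(4) by blast+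
    show ?thesis
      using less.hyps[of i i1, OF _ i(1) less.prems(2) i(3) d(1)] less.hyps[of i2 i, OF _ i(2) i(3) less.prems(3) d(2)]
        less.prems i by (cases "x \<le> 2 * int i") auto
  next
    case False
    then have "((i1, i2), (j, j)) \<in> hedges T" using less.prems unfolding hedges_iff by blast
    then show ?thesis using less.prems unfolding on_hskel_iff by blast
  qed
qed

text \<open>A cell crossing one of the sides would overlap the given cell. So a side joins two
  vertices without meeting an open cell, and it splits into edges.\<close>

lemma cell_sides:
  assumes C: "((i1, i2), (j1, j2)) \<in> cells T" and x: "2 * int i1 \<le> x" "x \<le> 2 * int i2"
  shows "on_hskel T x (2 * int j1)" "on_hskel T x (2 * int j2)"
proof -
  note b = cell_bounds[OF C]
  have d: "closed_box ((i1, i2), (j, j)) \<inter> open_box D = {}" if j: "j = j1 \<or> j = j2" and D: "D \<in> cells T" for j D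
  proof (rule ccontr)
    assume "\<not> ?thesis"
    moreover obtain a b c d where Dabcd: "D = ((a, b), (c, d))" by (metis surj_pair)
    ultimately obtain z where z: "real i1 \<le> z" "z \<le> real i2" "real a < z" "z < real b" "c < j" "j < d" by auto
    \<comment> \<open>The centre of the intersection of the two open boxes, which is nonempty
      because \<open>D\<close> reaches beyond row \<open>j\<close> on both sides.\<close>
    define X where "X = (max (real i1) (real a) + min (real i2) (real b)) / 2"
    define Y where "Y = (max (real j1) (real c) + min (real j2) (real d)) / 2"
    have "max (real i1) (real a) < min (real i2) (real b)" using z b by auto
    moreover have "max (real j1) (real c) < min (real j2) (real d)" using z b j by auto
    ultimately have "(X, Y) \<in> open_box D \<inter> open_box ((i1, i2), (j1, j2))"
      unfolding Dabcd X_def Y_def by auto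
    then have "D = ((i1, i2), (j1, j2))" using tmesh C D unfolding is_tmesh_def by blast
    then show False using z j Dabcd by auto
  qed
  have v: "(i, j) \<in> vertices T" if "i = i1 \<or> i = i2" "j = j1 \<or> j = j2" for i j
    using that C unfolding vertices_iff by blast
  show "on_hskel T x (2 * int j1)" "on_hskel T x (2 * int j2)"
    using segment_between_vertices[OF b(2) v v _ x] d by blast+
qed

lemma on_hskel_not_in_cell:
  assumes "C \<in> cells T" "on_hskel T x y" "(real_of_int x / 2, real_of_int y / 2) \<in> open_box C"
  shows False
  using assms unfolding on_hskel_def hskel_def by (auto simp: hedges_def simp del: closed_box.simps)

lemma hedge_facts:
  assumes e: "((i1, i2), (j, j)) \<in> hedges T" and b: "1 < i1" "i2 < xdim T" "1 < j" "j < ydim T"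
  shows "on_vskel T (2 * int i1) (2 * int j)" "on_vskel T (2 * int i2) (2 * int j)"
    "2 * int i1 \<le> x \<Longrightarrow> x \<le> 2 * int i2 \<Longrightarrow> on_hskel T x (2 * int j)"
    "i1 < i \<Longrightarrow> i < i2 \<Longrightarrow> \<not> on_vskel T (2 * int i) (2 * int j)" "i1 < i2"
proof -
  show "i1 < i2" using e by (simp add: hedges_iff)
  show H: "2 * int i1 \<le> x \<Longrightarrow> x \<le> 2 * int i2 \<Longrightarrow> on_hskel T x (2 * int j)" for x
    unfolding on_hskel_iff using e by blast
  have v: "(i1, j) \<in> vertices T" "(i2, j) \<in> vertices T" using e by (auto simp: hedges_iff)
  show "on_vskel T (2 * int i1) (2 * int j)" "on_vskel T (2 * int i2) (2 * int j)"
    using inner_vertex_skel(2)[OF v(1)] inner_vertex_skel(2)[OF v(2)] b \<open>i1 < i2\<close> by auto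
  show "i1 < i \<Longrightarrow> i < i2 \<Longrightarrow> \<not> on_vskel T (2 * int i) (2 * int j)"
    using crossing_vertex[of i j] H[of "2 * int i"] e unfolding hedges_iff by auto
qed

end

context mesh begin

lemma cell_sides_v:
  assumes C: "((i1, i2), (j1, j2)) \<in> cells T" and y: "2 * int j1 \<le> y" "y \<le> 2 * int j2"
  shows "on_vskel T (2 * int i1) y" "on_vskel T (2 * int i2) y"
  using mesh.cell_sides[OF mesh_transp, of j1 j2 i1 i2 y] assms by (simp_all add: in_swap_image on_hskel_transp)

lemma on_vskel_not_in_cell:
  assumes "C \<in> cells T" "on_vskel T x y" "(real_of_int x / 2, real_of_int y / 2) \<in> open_box C"
  shows False
  using mesh.on_hskel_not_in_cell[OF mesh_transp, of "prod.swap C" y x] assms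
  by (simp add: on_hskel_transp open_box_swap in_swap_image)

lemma vedge_facts:
  assumes e: "((i, i), (j1, j2)) \<in> vedges T" and b: "1 < i" "i < xdim T" "1 < j1" "j2 < ydim T"
  shows "on_hskel T (2 * int i) (2 * int j1)" "on_hskel T (2 * int i) (2 * int j2)"
    "2 * int j1 \<le> y \<Longrightarrow> y \<le> 2 * int j2 \<Longrightarrow> on_vskel T (2 * int i) y"
    "j1 < j \<Longrightarrow> j < j2 \<Longrightarrow> \<not> on_hskel T (2 * int i) (2 * int j)" "j1 < j2"
  using mesh.hedge_facts[OF mesh_transp, of j1 j2 i] assms
  by (simp_all add: hedges_transp on_hskel_transp on_vskel_transp)

lemma anchor_shape:
  assumes A: "((i1, i2), (j1, j2)) \<in> anchors p q T"
  shows "odd p \<Longrightarrow> i1 = i2" "even p \<Longrightarrow> i1 < i2" "odd q \<Longrightarrow> j1 = j2" "even q \<Longrightarrow> j1 < j2" "i1 \<le> i2" "j1 \<le> j2"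
proof -
  show *: "odd p \<Longrightarrow> i1 = i2" "even p \<Longrightarrow> i1 < i2" "odd q \<Longrightarrow> j1 = j2" "even q \<Longrightarrow> j1 < j2"
    using A cell_bounds(2,5)[of i1 i2 j1 j2] unfolding anchors_def
    by (auto simp: hedges_iff vedges_iff split: if_splits simp del: closed_box.simps)
  show "i1 \<le> i2" "j1 \<le> j2" using * by (cases "even p"; cases "even q"; force)+
qed

lemma anchor_bounds:
  assumes A: "((i1, i2), (j1, j2)) \<in> anchors p q T"
  shows "(p + 1) div 2 < i1" "i2 + (p + 1) div 2 \<le> xdim T" "(q + 1) div 2 < j1" "j2 + (q + 1) div 2 \<le> ydim T"
proof -
  have "(real i1, real j1) \<in> closed_box ((i1, i2), (j1, j2))" "(real i2, real j2) \<in> closed_box ((i1, i2), (j1, j2))"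
    using anchor_shape(5,6)[OF A] by auto
  moreover have "closed_box ((i1, i2), (j1, j2)) \<subseteq> active_region p q T"
    using A unfolding anchors_def by blast
  ultimately have "(real i1, real j1) \<in> active_region p q T" "(real i2, real j2) \<in> active_region p q T" by blast+
  then show "(p + 1) div 2 < i1" "i2 + (p + 1) div 2 \<le> xdim T" "(q + 1) div 2 < j1" "j2 + (q + 1) div 2 \<le> ydim T"
    unfolding active_region_def by auto
qed

text \<open>What \<open>anchor_grid\<close> asks of the anchor itself, in one form for all parities.
  No mesh line crosses at the centre: for an edge it would create a vertex inside, by
  \<open>crossing_vertex\<close>, and for a cell it would enter the open box.\<close>

lemma anchor_facts:
  assumes A: "((i1, i2), (j1, j2)) \<in> anchors p q T"
  shows "j1 < j \<Longrightarrow> j < j2 \<Longrightarrow> \<not> on_hskel T (int i1 + int i2) (2 * int j)"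
    and "i1 < i \<Longrightarrow> i < i2 \<Longrightarrow> \<not> on_vskel T (2 * int i) (int j1 + int j2)"
    and "2 * int j1 \<le> y \<Longrightarrow> y \<le> 2 * int j2 \<Longrightarrow> on_vskel T (2 * int i1) y \<and> on_vskel T (2 * int i2) y"
    and "2 * int i1 \<le> x \<Longrightarrow> x \<le> 2 * int i2 \<Longrightarrow> on_hskel T x (2 * int j1) \<and> on_hskel T x (2 * int j2)"
proof -
  have k: "1 \<le> (p + 1) div 2" "1 \<le> (q + 1) div 2" using p q by auto
  have b: "1 < i1" "i2 < xdim T" "1 < j1" "j2 < ydim T" "i1 \<le> i2" "j1 \<le> j2"
    using anchor_bounds[OF A] anchor_shape(5,6)[OF A] k by linarith+
  have goal: "(\<forall>j. j1 < j \<and> j < j2 \<longrightarrow> \<not> on_hskel T (int i1 + int i2) (2 * int j)) \<and>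
    (\<forall>i. i1 < i \<and> i < i2 \<longrightarrow> \<not> on_vskel T (2 * int i) (int j1 + int j2)) \<and>
    (\<forall>y. 2 * int j1 \<le> y \<and> y \<le> 2 * int j2 \<longrightarrow> on_vskel T (2 * int i1) y \<and> on_vskel T (2 * int i2) y) \<and>
    (\<forall>x. 2 * int i1 \<le> x \<and> x \<le> 2 * int i2 \<longrightarrow> on_hskel T x (2 * int j1) \<and> on_hskel T x (2 * int j2))"
  proof (cases "odd p")
    case op: True
    then have i: "i2 = i1" using anchor_shape(1)[OF A] by simp
    show ?thesis
    proof (cases "odd q")
      case True
      then have j: "j2 = j1" using anchor_shape(3)[OF A] by simp
      have "(i1, j1) \<in> vertices T" using A op True i j unfolding anchors_def by auto
      from inner_vertex_skel[OF this] b i j show ?thesis by auto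
    next
      case False
      then have "((i1, i1), (j1, j2)) \<in> vedges T" using A op i unfolding anchors_def by auto
      note f = vedge_facts[OF this]
      show ?thesis using f b i by (auto simp: order_antisym_conv)
    qed
  next
    case ep: False
    show ?thesis
    proof (cases "odd q")
      case True
      then have j: "j2 = j1" using anchor_shape(3)[OF A] by simp
      then have "((i1, i2), (j1, j1)) \<in> hedges T" using A ep True unfolding anchors_def by auto
      note f = hedge_facts[OF this]
      show ?thesis using f b j by (auto simp: order_antisym_conv)
    next
      case False
      then have C: "((i1, i2), (j1, j2)) \<in> cells T" using A ep unfolding anchors_def by auto
      have "\<not> on_hskel T (int i1 + int i2) (2 * int j)" if "j1 < j" "j < j2" for j
        using on_hskel_not_in_cell[OF C, of "int i1 + int i2" "2 * int j"] cell_bounds[OF C] that by auto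
      moreover have "\<not> on_vskel T (2 * int i) (int j1 + int j2)" if "i1 < i" "i < i2" for i
        using on_vskel_not_in_cell[OF C, of "2 * int i" "int j1 + int j2"] cell_bounds[OF C] that by auto
      ultimately show ?thesis using cell_sides[OF C] cell_sides_v[OF C] by blast
    qed
  qed
  show "j1 < j \<Longrightarrow> j < j2 \<Longrightarrow> \<not> on_hskel T (int i1 + int i2) (2 * int j)"
    "i1 < i \<Longrightarrow> i < i2 \<Longrightarrow> \<not> on_vskel T (2 * int i) (int j1 + int j2)"
    "2 * int j1 \<le> y \<Longrightarrow> y \<le> 2 * int j2 \<Longrightarrow> on_vskel T (2 * int i1) y \<and> on_vskel T (2 * int i2) y"
    "2 * int i1 \<le> x \<Longrightarrow> x \<le> 2 * int i2 \<Longrightarrow> on_hskel T x (2 * int j1) \<and> on_hskel T x (2 * int j2)"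
    using goal by blast+
qed

lemma anchors_transp: "(a, b) \<in> anchors p q T \<Longrightarrow> (b, a) \<in> anchors q p (transp_mesh T)"
proof -
  assume A: "(a, b) \<in> anchors p q T"
  have "active_region q p (transp_mesh T) = prod.swap ` active_region p q T"
    unfolding active_region_def by (auto simp: image_iff)
  moreover have "closed_box (b, a) = prod.swap ` closed_box (a, b)"
    using closed_box_swap[of "(a, b)"] by simp
  ultimately have "closed_box (b, a) \<subseteq> active_region q p (transp_mesh T)"
    using A unfolding anchors_def by blast
  moreover have "(b, a) \<in> (if odd q \<and> odd p then {((i, i), (j, j)) | i j. (i, j) \<in> vertices (transp_mesh T)}
      else if even q \<and> odd p then hedges (transp_mesh T)
      else if odd q \<and> even p then vedges (transp_mesh T) else cells (transp_mesh T))"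
  proof (cases "odd p \<and> odd q")
    case True
    then show ?thesis using A unfolding anchors_def by (auto simp: vertices_transp)
  next
    case False
    have "(a, b) \<in> (if odd p \<and> odd q then {((i, i), (j, j)) | i j. (i, j) \<in> vertices T}
      else if even p \<and> odd q then hedges T else if odd p \<and> even q then vedges T else cells T)"
      using A unfolding anchors_def by blast
    with False show ?thesis
      by (cases "odd p"; cases "odd q") (simp_all add: hedges_transp vedges_transp in_swap_image)
  qed
  ultimately show ?thesis unfolding anchors_def by blast
qed

lemma hindices_iff:
  assumes "j1 \<le> j2"
  shows "i \<in> hindices T (a, (j1, j2)) \<longleftrightarrow> (\<forall>y\<in>{2 * int j1..2 * int j2}. on_vskel T (2 * int i) y)"
proof -
  have "i \<in> {1..xdim T}" if "\<forall>y\<in>{2 * int j1..2 * int j2}. on_vskel T (2 * int i) y"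
    using on_vskel_bounds[of "2 * int i" "2 * int j1"] that assms by auto
  then show ?thesis using segment_vskel_iff[OF assms, of i T] by auto
qed

definition hvec :: "ibox \<Rightarrow> nat list" where
  "hvec A = local_index_vector p (hindices T A) (fst A)"

definition vvec :: "ibox \<Rightarrow> nat list" where
  "vvec A = local_index_vector q (vindices T A) (snd A)"

text \<open>Anchors lie in the active region, so on either side there are
  \<open>(p + 1) div 2\<close> full columns of the frame, and these belong to every index
  set.\<close>

lemma hvec_props:
  assumes A: "((i1, i2), (j1, j2)) \<in> anchors p q T"
  shows "is_local_index_vector p (hindices T ((i1, i2), (j1, j2))) (i1, i2) (hvec ((i1, i2), (j1, j2)))"
  unfolding hvec_def fst_conv
proof (rule local_index_vector_props)
  let ?I = "hindices T ((i1, i2), (j1, j2))"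
  note s = anchor_shape[OF A] and b = anchor_bounds[OF A] and f = anchor_facts[OF A]
  note h = hindices_iff[OF s(6), of _ "(i1, i2)"]
  have fin: "finite ?I" by (rule finite_subset[of _ "{1..xdim T}"]) auto
  then show "finite ?I" .
  show "i1 \<in> ?I" "i2 \<in> ?I" unfolding h using f(3) by auto
  show "odd p \<Longrightarrow> i1 = i2" "even p \<Longrightarrow> i1 < i2" by (fact s)+
  show "i \<notin> ?I" if "i1 < i" "i < i2" for i
    unfolding h using f(2)[OF that] s(6) by auto
  have full: "x \<in> ?I" if "x \<in> {1..(p + 1) div 2 + 1} \<union> {xdim T - (p + 1) div 2..xdim T}" for x
    unfolding h using full_cols[of x] that b by auto
  have "card {1..(p + 1) div 2} \<le> card {x \<in> ?I. x < i1}"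
    using b fin by (intro card_mono) (auto intro!: full simp del: hindices.simps)
  then show "(p + 1) div 2 \<le> card {x \<in> ?I. x < i1}" by simp
  have "card {xdim T - (p + 1) div 2 + 1..xdim T} \<le> card {x \<in> ?I. i2 < x}"
    using b fin by (intro card_mono) (auto intro!: full simp del: hindices.simps)
  then show "(p + 1) div 2 \<le> card {x \<in> ?I. i2 < x}" using dims by simp
qed

end

context mesh begin

lemma vindices_transp: "vindices T (a, b) = hindices (transp_mesh T) (b, a)"
proof -
  have "{real i1..real i2} \<times> {real j} \<subseteq> hskel T \<longleftrightarrow> {real j} \<times> {real i1..real i2} \<subseteq> vskel (transp_mesh T)" for i1 i2 j
    unfolding vskel_transp by (auto simp: in_swap_image)
  then show ?thesis by (cases a) auto
qed

lemma vvec_transp: "vvec (a, b) = mesh.hvec q (transp_mesh T) (b, a)"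
  unfolding vvec_def mesh.hvec_def[OF mesh_transp] by (simp add: vindices_transp)

lemma vvec_props:
  assumes A: "((i1, i2), (j1, j2)) \<in> anchors p q T"
  shows "is_local_index_vector q (vindices T ((i1, i2), (j1, j2))) (j1, j2) (vvec ((i1, i2), (j1, j2)))"
  using mesh.hvec_props[OF mesh_transp anchors_transp[OF A]] by (simp only: vvec_transp vindices_transp)

lemma vindices_iff:
  assumes "i1 \<le> i2"
  shows "j \<in> vindices T ((i1, i2), b) \<longleftrightarrow> (\<forall>x\<in>{2 * int i1..2 * int i2}. on_hskel T x (2 * int j))"
  using mesh.hindices_iff[OF mesh_transp assms, of j b] by (simp only: vindices_transp on_vskel_transp)

end

section \<open>Overlap of the index vectors of two anchors\<close>

lemma not_overlapD:
  assumes "set v = I \<inter> {hd v..last v}" "set w = J \<inter> {hd w..last w}" "\<not> overlap v w"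
  obtains c where "c \<in> {hd v..last v}" "c \<in> {hd w..last w}" "(c \<in> I) \<noteq> (c \<in> J)"
  using assms unfolding overlap_def by blast

context mesh begin

lemma tee_grid:
  assumes "even x" "even y" "on_hskel T x y" "\<not> on_hskel T (x + \<sigma>) y" "\<sigma> \<in> {1, -1}" "x + \<sigma> \<in> {2..2 * int (xdim T)}"
  shows "on_vskel T x (y + 1) \<and> on_vskel T x (y - 1)"
    and "0 < \<sigma> * (c - x) \<Longrightarrow> card {k. even k \<and> 0 < \<sigma> * (k - x) \<and> 0 < \<sigma> * (c - k) \<and> on_vskel T k y} < (p + 1) div 2
      \<Longrightarrow> on_hext p T c y"
    and "0 \<le> \<sigma> * (x - c) \<Longrightarrow> c = x \<or> card {k. even k \<and> 0 < \<sigma> * (x - k) \<and> 0 < \<sigma> * (k - c) \<and> on_vskel T k y} < p div 2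
      \<Longrightarrow> on_hext p T c y"
proof -
  define i j where "i = nat (x div 2)" "j = nat (y div 2)"
  have ij: "x = 2 * int i" "y = 2 * int j" using on_hskel_bounds[OF assms(3)] assms(1,2) by (auto simp: i_j_def)
  note a = assms(3-5)[unfolded ij] assms(6)[unfolded ij atLeastAtMost_iff, THEN conjunct1] assms(6)[unfolded ij atLeastAtMost_iff, THEN conjunct2]
  show "on_vskel T x (y + 1) \<and> on_vskel T x (y - 1)" unfolding ij using tee(2,3)[OF a] by blast
  show "0 < \<sigma> * (c - x) \<Longrightarrow> card {k. even k \<and> 0 < \<sigma> * (k - x) \<and> 0 < \<sigma> * (c - k) \<and> on_vskel T k y} < (p + 1) div 2
      \<Longrightarrow> on_hext p T c y"
    unfolding ij by (rule face_edge_ext(1)[OF a])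
  show "0 \<le> \<sigma> * (x - c) \<Longrightarrow> c = x \<or> card {k. even k \<and> 0 < \<sigma> * (x - k) \<and> 0 < \<sigma> * (k - c) \<and> on_vskel T k y} < p div 2
      \<Longrightarrow> on_hext p T c y"
    unfolding ij by (rule face_edge_ext(2)[OF a])
qed

lemma hvec_count:
  assumes A: "((i1, i2), (j1, j2)) \<in> anchors p q T"
  defines "v \<equiv> hvec ((i1, i2), (j1, j2))"
  shows "card {k. even k \<and> (2 * int i1 + 2 * int i2) div 2 < k \<and> k < 2 * int (last v)
      \<and> (\<forall>y\<in>{2 * int j1..2 * int j2}. on_vskel T k y)} \<le> p div 2"
    and "card {k. even k \<and> 2 * int (hd v) < k \<and> k < (2 * int i1 + 2 * int i2) div 2
      \<and> (\<forall>y\<in>{2 * int j1..2 * int j2}. on_vskel T k y)} \<le> p div 2"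
proof -
  let ?P = "\<lambda>k. even k \<and> (\<forall>y\<in>{2 * int j1..2 * int j2}. on_vskel T k y)"
  have P: "\<exists>c\<in>hindices T ((i1, i2), (j1, j2)). k = 2 * int c" if "?P k" for k
  proof -
    have "on_vskel T k (2 * int j1)" using that anchor_shape(6)[OF A] by auto
    then have "k = 2 * int (nat (k div 2))" using on_vskel_bounds[of k] that by fastforce
    moreover from this have "nat (k div 2) \<in> hindices T ((i1, i2), (j1, j2))"
      using that unfolding hindices_iff[OF anchor_shape(6)[OF A]] by metis
    ultimately show ?thesis by blast
  qed
  note c = index_vector_count[OF hvec_props[OF A] anchor_shape(5)[OF A], of ?P, OF P]
  have m: "(2 * int i1 + 2 * int i2) div 2 = int i1 + int i2" by simp
  show "card {k. even k \<and> (2 * int i1 + 2 * int i2) div 2 < k \<and> k < 2 * int (last v)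
      \<and> (\<forall>y\<in>{2 * int j1..2 * int j2}. on_vskel T k y)} \<le> p div 2"
    using c(1) unfolding m v_def by (simp add: conj_ac)
  show "card {k. even k \<and> 2 * int (hd v) < k \<and> k < (2 * int i1 + 2 * int i2) div 2
      \<and> (\<forall>y\<in>{2 * int j1..2 * int j2}. on_vskel T k y)} \<le> p div 2"
    using c(2) unfolding m v_def by (simp add: conj_ac)
qed

lemma hvec_bounds:
  assumes A: "((i1, i2), (j1, j2)) \<in> anchors p q T"
  defines "v \<equiv> hvec ((i1, i2), (j1, j2))"
  shows "set v \<subseteq> {1..xdim T}" "1 \<le> hd v" "hd v \<le> i1" "i2 \<le> last v" "last v \<le> xdim T" "hd v < last v"
proof -
  note v = index_vector_positions[OF hvec_props[OF A], folded v_def]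
  show s: "set v \<subseteq> {1..xdim T}" using v(5) by auto
  have "hd v \<in> set v" "last v \<in> set v" using v(8) by auto
  then show "1 \<le> hd v" "last v \<le> xdim T" using s by auto
  have "i1 \<in> set v" "i2 \<in> set v" using v(1,2,3) nth_mem[of "(p + 1) div 2" v] nth_mem[of "p div 2 + 1" v] by auto
  then show "hd v \<le> i1" "i2 \<le> last v" using sorted_wrt_less_bounds[OF v(4)] by auto
  show "hd v < last v" using v(3,4,6,7) by (simp add: sorted_wrt_iff_nth_less)
qed

end

context mesh begin

lemmas tee_grid_v = mesh.tee_grid[OF mesh_transp, unfolded on_hskel_transp on_vskel_transp on_hext_transp transp_simps]

lemma vvec_count:
  assumes A: "((i1, i2), (j1, j2)) \<in> anchors p q T"
  defines "w \<equiv> vvec ((i1, i2), (j1, j2))"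
  shows "card {k. even k \<and> (2 * int j1 + 2 * int j2) div 2 < k \<and> k < 2 * int (last w)
      \<and> (\<forall>x\<in>{2 * int i1..2 * int i2}. on_hskel T x k)} \<le> q div 2"
    and "card {k. even k \<and> 2 * int (hd w) < k \<and> k < (2 * int j1 + 2 * int j2) div 2
      \<and> (\<forall>x\<in>{2 * int i1..2 * int i2}. on_hskel T x k)} \<le> q div 2"
  using mesh.hvec_count[OF mesh_transp anchors_transp[OF A]]
  unfolding w_def vvec_transp on_vskel_transp by blast+

lemma vvec_bounds:
  assumes A: "((i1, i2), (j1, j2)) \<in> anchors p q T"
  defines "w \<equiv> vvec ((i1, i2), (j1, j2))"
  shows "set w \<subseteq> {1..ydim T}" "1 \<le> hd w" "hd w \<le> j1" "j2 \<le> last w" "last w \<le> ydim T" "hd w < last w"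
  using mesh.hvec_bounds[OF mesh_transp anchors_transp[OF A]]
  unfolding w_def vvec_transp by simp_all

text \<open>The index support is the range of the two local index vectors. It lies in the index
  domain, so a line that stops there without leaving the support does stop at a T-junction.\<close>

lemma anchor_grid_mesh:
  assumes A: "((i1, i2), (j1, j2)) \<in> anchors p q T"
  defines "v \<equiv> hvec ((i1, i2), (j1, j2))" and "w \<equiv> vvec ((i1, i2), (j1, j2))"
  shows "anchor_grid p q (on_hskel T) (on_vskel T) (on_hext p T) (on_vext q T) (2 * int i1) (2 * int i2) (2 * int j1) (2 * int j2)
     (2 * int (hd v)) (2 * int (last v)) (2 * int (hd w)) (2 * int (last w))"
proof -
  note hb = hvec_bounds[OF A, folded v_def] and vb = vvec_bounds[OF A, folded w_def]
  note s = anchor_shape[OF A] and f = anchor_facts[OF A]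
  have xr: "z \<in> {2..2 * int (xdim T)}" if "z \<in> {2 * int (hd v)..2 * int (last v)}" for z
    using that hb(2,5) by auto
  have yr: "z \<in> {2..2 * int (ydim T)}" if "z \<in> {2 * int (hd w)..2 * int (last w)}" for z
    using that vb(2,5) by auto
  show ?thesis
  proof
    fix x y \<sigma> c r :: int
    show "on_hskel T (x + 1) y \<and> on_hskel T (x - 1) y" if "odd x" "on_hskel T x y" using on_hskel_odd that by blast
    show "on_vskel T x (y + 1) \<and> on_vskel T x (y - 1)" if "odd y" "on_vskel T x y"
      using on_hskel_odd[of y "transp_mesh T" x] that by (simp add: on_hskel_transp)
    show "on_vskel T x (y + 1) \<and> on_vskel T x (y - 1)" if "even x" "even y" "on_hskel T x y" "\<not> on_hskel T (x + \<sigma>) y" "\<sigma> \<in> {1, -1}"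
      "x + \<sigma> \<in> {2 * int (hd v)..2 * int (last v)}"
      using tee_grid(1)[OF that(1-5) xr[OF that(6)]] .
    show "on_hskel T (x + 1) y \<and> on_hskel T (x - 1) y" if "even x" "even y" "on_vskel T x y" "\<not> on_vskel T x (y + \<sigma>)" "\<sigma> \<in> {1, -1}"
      "y + \<sigma> \<in> {2 * int (hd w)..2 * int (last w)}"
      using tee_grid_v(1)[OF that(2,1,3-5) yr[OF that(6)]] .
    show "on_hext p T c y" if "even x" "even y" "on_hskel T x y" "\<not> on_hskel T (x + \<sigma>) y" "\<sigma> \<in> {1, -1}"
      "x + \<sigma> \<in> {2 * int (hd v)..2 * int (last v)}" "0 < \<sigma> * (c - x)"
      "card {k. even k \<and> 0 < \<sigma> * (k - x) \<and> 0 < \<sigma> * (c - k) \<and> on_vskel T k y} < (p + 1) div 2"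
      using tee_grid(2)[OF that(1-5) xr[OF that(6)] that(7,8)] .
    show "on_hext p T c y" if "even x" "even y" "on_hskel T x y" "\<not> on_hskel T (x + \<sigma>) y" "\<sigma> \<in> {1, -1}"
      "x + \<sigma> \<in> {2 * int (hd v)..2 * int (last v)}" "0 \<le> \<sigma> * (x - c)"
      "c = x \<or> card {k. even k \<and> 0 < \<sigma> * (x - k) \<and> 0 < \<sigma> * (k - c) \<and> on_vskel T k y} < p div 2"
      using tee_grid(3)[OF that(1-5) xr[OF that(6)] that(7,8)] .
    show "on_vext q T x c" if "even x" "even y" "on_vskel T x y" "\<not> on_vskel T x (y + \<sigma>)" "\<sigma> \<in> {1, -1}"
      "y + \<sigma> \<in> {2 * int (hd w)..2 * int (last w)}" "0 < \<sigma> * (c - y)"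
      "card {k. even k \<and> 0 < \<sigma> * (k - y) \<and> 0 < \<sigma> * (c - k) \<and> on_hskel T x k} < (q + 1) div 2"
      using tee_grid_v(2)[OF that(2,1,3-5) yr[OF that(6)] that(7,8)] .
    show "on_vext q T x c" if "even x" "even y" "on_vskel T x y" "\<not> on_vskel T x (y + \<sigma>)" "\<sigma> \<in> {1, -1}"
      "y + \<sigma> \<in> {2 * int (hd w)..2 * int (last w)}" "0 \<le> \<sigma> * (y - c)"
      "c = y \<or> card {k. even k \<and> 0 < \<sigma> * (y - k) \<and> 0 < \<sigma> * (k - c) \<and> on_hskel T x k} < q div 2"
      using tee_grid_v(3)[OF that(2,1,3-5) yr[OF that(6)] that(7,8)] .
    show "on_hext p T c r \<Longrightarrow> on_vext q T c r \<Longrightarrow> False" by (rule on_hext_Vx_disjoint)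
    show "\<not> on_hskel T ((2 * int i1 + 2 * int i2) div 2) y" if "even y" "2 * int j1 < y" "y < 2 * int j2"
    proof -
      have "y = 2 * int (nat (y div 2))" using that by auto
      moreover from this have "j1 < nat (y div 2)" "nat (y div 2) < j2" using that by linarith+
      ultimately show ?thesis using f(1) by (metis distrib_left nonzero_mult_div_cancel_left zero_neq_numeral)
    qed
    show "\<not> on_vskel T x ((2 * int j1 + 2 * int j2) div 2)" if "even x" "2 * int i1 < x" "x < 2 * int i2"
    proof -
      have "x = 2 * int (nat (x div 2))" using that by auto
      moreover from this have "i1 < nat (x div 2)" "nat (x div 2) < i2" using that by linarith+
      ultimately show ?thesis using f(2) by (metis distrib_left nonzero_mult_div_cancel_left zero_neq_numeral)
    qed
    show "on_vskel T (2 * int i1) y \<and> on_vskel T (2 * int i2) y" if "y \<in> {2 * int j1..2 * int j2}"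
      using f(3) that by auto
    show "on_hskel T x (2 * int j1) \<and> on_hskel T x (2 * int j2)" if "x \<in> {2 * int i1..2 * int i2}"
      using f(4) that by auto
  qed (fact hvec_count[OF A, folded v_def] vvec_count[OF A, folded w_def]
       | use s hb(3,4) vb(3,4) in \<open>simp; fail\<close>)+
qed

text \<open>Overlap alone does not suffice; the windows must also differ in that direction. If they
  are equal, the anchors agree in that component and hence share the index set of the other
  direction. There the windows overlap, and they differ because the anchors do.\<close>

lemma partial_overlap:
  assumes A: "A \<in> anchors p q T" and B: "B \<in> anchors p q T" and "A \<noteq> B"
  shows "(hvec A \<noteq> hvec B \<and> overlap (hvec A) (hvec B)) \<or> (vvec A \<noteq> vvec B \<and> overlap (vvec A) (vvec B))"
proof -
  obtain i1 i2 j1 j2 where A': "A = ((i1, i2), (j1, j2))" by (metis surj_pair)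
  obtain k1 k2 l1 l2 where B': "B = ((k1, k2), (l1, l2))" by (metis surj_pair)
  note A = A[unfolded A'] and B = B[unfolded B']
  note hA = index_vector_positions[OF hvec_props[OF A], folded A']
    and hB = index_vector_positions[OF hvec_props[OF B], folded B']
    and vA = index_vector_positions[OF vvec_props[OF A], folded A']
    and vB = index_vector_positions[OF vvec_props[OF B], folded B']
  have h_eq: "(i1, i2) = (k1, k2)" if "hvec A = hvec B" using hA(1,2) hB(1,2) that by simp
  have v_eq: "(j1, j2) = (l1, l2)" if "vvec A = vvec B" using vA(1,2) vB(1,2) that by simp
  have one: "overlap (hvec A) (hvec B) \<or> overlap (vvec A) (vvec B)"
  proof (rule ccontr)
    assume n: "\<not> ?thesis"
    obtain c where c: "c \<in> {hd (hvec A)..last (hvec A)}" "c \<in> {hd (hvec B)..last (hvec B)}"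
      "(c \<in> hindices T A) \<noteq> (c \<in> hindices T B)"
      using not_overlapD[OF hA(5) hB(5)] n by blast
    obtain r where r: "r \<in> {hd (vvec A)..last (vvec A)}" "r \<in> {hd (vvec B)..last (vvec B)}"
      "(r \<in> vindices T A) \<noteq> (r \<in> vindices T B)"
      using not_overlapD[OF vA(5) vB(5)] n by blast
    note gA = anchor_grid_mesh[OF A, folded A'] and gB = anchor_grid_mesh[OF B, folded B']
    note sA = anchor_shape[OF A] and sB = anchor_shape[OF B]
    show False
    proof (rule no_crossing_defects[OF gA gB, of "2 * int c" "2 * int r"])
      show "on_vskel T (2 * int c) ((2 * int j1 + 2 * int j2) div 2) \<noteq> on_vskel T (2 * int c) ((2 * int l1 + 2 * int l2) div 2)"
        using c anchor_grid.index_iff_v[OF gA, of "2 * int c"] anchor_grid.index_iff_v[OF gB, of "2 * int c"]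
          hindices_iff[OF sA(6), of c "(i1, i2)"] hindices_iff[OF sB(6), of c "(k1, k2)"]
        unfolding A' B' by (simp del: hindices.simps)
      show "on_hskel T ((2 * int i1 + 2 * int i2) div 2) (2 * int r) \<noteq> on_hskel T ((2 * int k1 + 2 * int k2) div 2) (2 * int r)"
        using r anchor_grid.index_iff_h[OF gA, of "2 * int r"] anchor_grid.index_iff_h[OF gB, of "2 * int r"]
          vindices_iff[OF sA(5), of r "(j1, j2)"] vindices_iff[OF sB(5), of r "(l1, l2)"]
        unfolding A' B' by (simp del: vindices.simps)
    qed (use c r in auto)
  qed
  have "overlap (vvec A) (vvec B)" if "(i1, i2) = (k1, k2)"
  proof (rule ccontr)
    assume "\<not> ?thesis"
    from not_overlapD[OF vA(5) vB(5) this] show False using that unfolding A' B' by auto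
  qed
  moreover have "overlap (hvec A) (hvec B)" if "(j1, j2) = (l1, l2)"
  proof (rule ccontr)
    assume "\<not> ?thesis"
    from not_overlapD[OF hA(5) hB(5) this] show False using that unfolding A' B' by auto
  qed
  ultimately show ?thesis using one h_eq v_eq \<open>A \<noteq> B\<close> A' B' by blast
qed

end

section \<open>Local linear independence\<close>

lemma bspline_support:
  assumes "bspline d \<xi> k x \<noteq> 0"
  shows "\<exists>a. k \<le> a \<and> a \<le> k + d \<and> \<xi> a \<le> x \<and> x < \<xi> (a + 1)"
  using assms
proof (induction d arbitrary: k)
  case 0
  then show ?case by (auto split: if_splits)
next
  case (Suc d)
  then have "bspline d \<xi> k x \<noteq> 0 \<or> bspline d \<xi> (k + 1) x \<noteq> 0" by auto
  then show ?case
  proof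
    assume "bspline d \<xi> k x \<noteq> 0"
    from Suc.IH[OF this] show ?thesis by auto
  next
    assume "bspline d \<xi> (k + 1) x \<noteq> 0"
    from Suc.IH[OF this] obtain a where "k + 1 \<le> a" "a \<le> k + 1 + d" "\<xi> a \<le> x" "x < \<xi> (a + 1)" by auto
    then show ?thesis by (intro exI[of _ a]) auto
  qed
qed

lemma poly_zero_on_interval:
  fixes f :: "real poly"
  assumes "u < v" "\<And>x. u < x \<Longrightarrow> x < v \<Longrightarrow> poly f x = 0"
  shows "f = 0"
proof (rule ccontr)
  assume "f \<noteq> 0"
  then have "finite {x. poly f x = 0}" by (rule poly_roots_finite)
  moreover have "{u<..<v} \<subseteq> {x. poly f x = 0}" using assms(2) by auto
  ultimately show False using infinite_Ioo[OF assms(1)] finite_subset by blast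
qed

lemma open_knot_vector_mono:
  assumes "open_knot_vector d m s"
  shows "mono_on {1..m} s"
proof (rule mono_onI)
  fix i j assume "i \<in> {1..m}" "j \<in> {1..m}" "i \<le> j"
  from \<open>i \<le> j\<close> \<open>i \<in> {1..m}\<close> \<open>j \<in> {1..m}\<close> show "s i \<le> s j"
  proof (induction j rule: dec_induct)
    case (step k)
    then have "s k \<le> s (k + 1)" using assms unfolding open_knot_vector_def by auto
    with step show ?case by auto
  qed simp
qed

context mesh begin

lemma ext_cell_bounds:
  assumes "((i1, i2), (j1, j2)) \<in> ext_cells p q T"
  shows "1 \<le> i1" "i1 < i2" "i2 \<le> xdim T" "1 \<le> j1" "j1 < j2" "j2 \<le> ydim T"
proof -
  let ?S = "open_box ((i1, i2), (j1, j2))"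
  show l: "i1 < i2" "j1 < j2" using assms unfolding ext_cells_def by auto
  have "frontier ?S \<subseteq> index_domain T" using assms ext_skel_domain unfolding ext_cells_def by auto
  moreover have "frontier ?S = closed_box ((i1, i2), (j1, j2)) - ?S"
    using l by (simp add: frontier_def closure_Times interior_open open_Times)
  ultimately have "(real i1, real j1) \<in> index_domain T" "(real i2, real j2) \<in> index_domain T"
    using l by auto
  then show "1 \<le> i1" "i2 \<le> xdim T" "1 \<le> j1" "j2 \<le> ydim T" unfolding index_domain_def by auto
qed

lemma ext_cell_disjoint:
  assumes "((i1, i2), (j1, j2)) \<in> ext_cells p q T" "z \<in> open_box ((i1, i2), (j1, j2))" "z \<in> ext_skel p q T"
  shows False
  using assms unfolding ext_cells_def by blast

text \<open>Over the support of the anchor an index column belongs to the extended skeleton by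
  \<open>index_line_v\<close>, and the open cell avoids this skeleton.\<close>

lemma no_index_inside_h:
  assumes E: "((il, ir), (jb, jt)) \<in> ext_cells p q T" and A: "A \<in> anchors p q T"
    and y: "hd (vvec A) < jt" "jb < last (vvec A)" and c: "c \<in> set (hvec A)" "il < c" "c < ir"
  shows False
proof -
  obtain i1 i2 j1 j2 where A': "A = ((i1, i2), (j1, j2))" by (metis surj_pair)
  note A = A[unfolded A']
  note g = anchor_grid_mesh[OF A, folded A']
  note v = index_vector_positions[OF hvec_props[OF A], folded A']
  have c': "c \<in> hindices T A" "c \<in> {hd (hvec A)..last (hvec A)}" using c v(5) by auto
  then have "\<forall>y\<in>{2 * int j1..2 * int j2}. on_vskel T (2 * int c) y"
    using hindices_iff[OF anchor_shape(6)[OF A], of c "(i1, i2)"] unfolding A' by blast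
  then have "on_vskel T (2 * int c) (anchor_grid.\<beta> (2 * int j1) (2 * int j2))"
    using anchor_shape(6)[OF A] unfolding anchor_grid.\<beta>_def[OF g] by auto
  \<comment> \<open>The middle of the first unit step above both the lower side of the cell and the
    lower end of the support. As all ends are integers, this row is strictly inside the cell and
    within the support.\<close>
  moreover define z where "z = 2 * int (max jb (hd (vvec A))) + 1"
  moreover have "z \<in> {2 * int (hd (vvec A))..2 * int (last (vvec A))}"
    using y vvec_bounds(6)[OF A, folded A'] unfolding z_def by auto
  ultimately have "on_vskel T (2 * int c) z \<or> on_vext q T (2 * int c) z"
    using anchor_grid.index_line_v[OF g, of "2 * int c" z] c' by auto
  from grid_in_ext_skel[OF this] show False
    by (rule ext_cell_disjoint[OF E, rotated])
      (use c y ext_cell_bounds[OF E] in \<open>auto simp: z_def max_def\<close>)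
qed

lemma no_index_inside_v:
  assumes E: "((il, ir), (jb, jt)) \<in> ext_cells p q T" and A: "A \<in> anchors p q T"
    and x: "hd (hvec A) < ir" "il < last (hvec A)" and c: "c \<in> set (vvec A)" "jb < c" "c < jt"
  shows False
proof -
  obtain i1 i2 j1 j2 where A': "A = ((i1, i2), (j1, j2))" by (metis surj_pair)
  note A = A[unfolded A']
  note g = anchor_grid_mesh[OF A, folded A']
  note v = index_vector_positions[OF vvec_props[OF A], folded A']
  have c': "c \<in> vindices T A" "c \<in> {hd (vvec A)..last (vvec A)}" using c v(5) by auto
  then have "\<forall>x\<in>{2 * int i1..2 * int i2}. on_hskel T x (2 * int c)"
    using vindices_iff[OF anchor_shape(5)[OF A], of c "(j1, j2)"] unfolding A' by blast
  then have "on_hskel T (anchor_grid.\<alpha> (2 * int i1) (2 * int i2)) (2 * int c)"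
    using anchor_shape(5)[OF A] unfolding anchor_grid.\<alpha>_def[OF g] by auto
  moreover define z where "z = 2 * int (max il (hd (hvec A))) + 1"
  moreover have "z \<in> {2 * int (hd (hvec A))..2 * int (last (hvec A))}"
    using x hvec_bounds(6)[OF A, folded A'] unfolding z_def by auto
  ultimately have "on_hskel T z (2 * int c) \<or> on_hext p T z (2 * int c)"
    using anchor_grid.index_line_h[OF g, of "2 * int c" z] c' by auto
  then have "(real_of_int z / 2, real_of_int (2 * int c) / 2) \<in> ext_skel p q T"
    unfolding on_hskel_def on_hext_def ext_skel_def skel_def by blast
  then show False
    by (rule ext_cell_disjoint[OF E, rotated])
      (use c x ext_cell_bounds[OF E] in \<open>auto simp: z_def max_def\<close>)
qed

lemma finite_anchors: "finite (anchors p q T)"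
proof (rule finite_subset)
  show "anchors p q T \<subseteq> ({..xdim T} \<times> {..xdim T}) \<times> ({..ydim T} \<times> {..ydim T})"
    using anchor_shape(5,6) anchor_bounds(2,4) by fastforce
qed auto

end

lemma spline_support:
  fixes \<xi> :: "nat \<Rightarrow> real"
  assumes "mono_on D \<xi>" "set w \<subseteq> D" "sorted_wrt (<) w" "length w = d + 2" "bspline d (\<lambda>k. \<xi> (w ! k)) 0 x \<noteq> 0"
  shows "\<xi> (hd w) \<le> x" "x < \<xi> (last w)"
proof -
  obtain a where a: "a \<le> d" "\<xi> (w ! a) \<le> x" "x < \<xi> (w ! (a + 1))"
    using bspline_support[OF assms(5)] by auto
  have "w \<noteq> []" using assms(4) by auto
  then have m: "w ! a \<in> set w" "w ! (a + 1) \<in> set w" "hd w \<in> set w" "last w \<in> set w"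
    using a(1) assms(4) by auto
  have "hd w \<le> w ! a" "w ! (a + 1) \<le> last w"
    using sorted_wrt_less_bounds[OF assms(3)] m by auto
  then have "\<xi> (hd w) \<le> \<xi> (w ! a)" "\<xi> (w ! (a + 1)) \<le> \<xi> (last w)"
    using assms(1,2) m unfolding mono_on_def by blast+
  with a show "\<xi> (hd w) \<le> x" "x < \<xi> (last w)" by auto
qed

lemma knots_outside:
  fixes \<xi> :: "nat \<Rightarrow> real"
  assumes mono: "mono_on {1..m} \<xi>" and w: "set w \<subseteq> {1..m}" "length w = d + 2" and e: "1 \<le> l" "l < r" "r \<le> m"
    and n: "\<And>c. c \<in> set w \<Longrightarrow> l < c \<Longrightarrow> c < r \<Longrightarrow> False" and "i \<le> d + 1"
  shows "\<xi> (w ! i) \<le> \<xi> l \<or> \<xi> r \<le> \<xi> (w ! i)"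
proof -
  have i: "w ! i \<in> set w" using assms by auto
  then have "w ! i \<le> l \<or> r \<le> w ! i" using n[of "w ! i"] by force
  then show ?thesis using mono i w(1) e unfolding mono_on_def by (metis atLeastAtMost_iff le_trans less_imp_le subsetD)
qed

locale knot_mesh = mesh +
  fixes s t :: "nat \<Rightarrow> real"
  assumes s: "open_knot_vector p (xdim T) s" and t: "open_knot_vector q (ydim T) t"
begin

lemma local_independence:
  assumes E: "E \<in> bezier_elements p q T s t"
    and zero: "\<forall>z \<in> parametric_domain s t E. (\<Sum>A \<in> active_anchors p q T s t E. c A * tspline p q T s t A z) = 0"
    and B: "B \<in> active_anchors p q T s t E"
  shows "c B = 0"
proof -
  obtain il ir jb jt where E': "E = ((il, ir), (jb, jt))" by (metis surj_pair)
  have cell: "((il, ir), (jb, jt)) \<in> ext_cells p q T" and pos: "s il < s ir" "t jb < t jt"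
    using E unfolding bezier_elements_def E' by auto
  note cb = ext_cell_bounds[OF cell]
  note ms = open_knot_vector_mono[OF s] and mt = open_knot_vector_mono[OF t]
  define f where "f A x = bspline p (\<lambda>k. s (hvec A ! k)) 0 x" for A x
  define g where "g A y = bspline q (\<lambda>k. t (vvec A ! k)) 0 y" for A y
  define P where "P A = bpoly (s il) (s ir) p (\<lambda>k. s (hvec A ! k)) 0" for A
  define Q where "Q A = bpoly (t jb) (t jt) q (\<lambda>k. t (vvec A ! k)) 0" for A
  let ?AA = "active_anchors p q T s t E"
  have tsp: "tspline p q T s t A (x, y) = f A x * g A y" for A x y
    by (simp add: tspline_def f_def g_def hvec_def vvec_def)
  have lists: "set (hvec A) \<subseteq> {1..xdim T} \<and> sorted_wrt (<) (hvec A) \<and> length (hvec A) = p + 2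
     \<and> set (vvec A) \<subseteq> {1..ydim T} \<and> sorted_wrt (<) (vvec A) \<and> length (vvec A) = q + 2"
    if "A \<in> anchors p q T" for A
  proof -
    obtain i1 i2 j1 j2 where A: "A = ((i1, i2), (j1, j2))" by (metis surj_pair)
    note that = that[unfolded A]
    show ?thesis
      unfolding A using hvec_bounds(1)[OF that] vvec_bounds(1)[OF that]
        index_vector_positions(3,4)[OF hvec_props[OF that]] index_vector_positions(3,4)[OF vvec_props[OF that]]
      by simp
  qed
  \<comment> \<open>\<open>hx\<close> and \<open>hy\<close> must come before the polynomial pieces:
    that no index column cuts the element is known only if the vertical support meets it, and
    likewise for rows.\<close>
  have active: "A \<in> anchors p q T \<and> P A \<noteq> 0 \<and> Q A \<noteq> 0
      \<and> (\<forall>x. s il < x \<and> x < s ir \<longrightarrow> poly (P A) x = f A x) \<and> (\<forall>y. t jb < y \<and> y < t jt \<longrightarrow> poly (Q A) y = g A y)"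
    if "A \<in> ?AA" for A
  proof -
    have A: "A \<in> anchors p q T" using that unfolding active_anchors_def by blast
    note l = lists[OF A]
    have "\<exists>z \<in> parametric_domain s t E. tspline p q T s t A z \<noteq> 0"
      using that unfolding active_anchors_def by blast
    then obtain x y where xy: "s il < x" "x < s ir" "t jb < y" "y < t jt" "f A x \<noteq> 0" "g A y \<noteq> 0"
      by (auto simp: tsp E')
    have in_range: "hd (hvec A) \<in> {1..xdim T}" "last (hvec A) \<in> {1..xdim T}"
      "hd (vvec A) \<in> {1..ydim T}" "last (vvec A) \<in> {1..ydim T}"
      using l by (metis (no_types) add_2_eq_Suc' hd_in_set last_in_set length_0_conv nat.distinct(1) subsetD)+
    have "s (hd (hvec A)) < s ir" "s il < s (last (hvec A))"
      using spline_support[OF ms, of "hvec A" p x] l xy unfolding f_def by force+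
    then have hx: "hd (hvec A) < ir" "il < last (hvec A)"
      using mono_onD[OF ms, of ir "hd (hvec A)"] mono_onD[OF ms, of "last (hvec A)" il] in_range cb
      by (force simp: not_le[symmetric])+
    have "t (hd (vvec A)) < t jt" "t jb < t (last (vvec A))"
      using spline_support[OF mt, of "vvec A" q y] l xy unfolding g_def by force+
    then have hy: "hd (vvec A) < jt" "jb < last (vvec A)"
      using mono_onD[OF mt, of jt "hd (vvec A)"] mono_onD[OF mt, of "last (vvec A)" jb] in_range cb
      by (force simp: not_le[symmetric])+
    have "poly (P A) x = f A x" if "s il < x" "x < s ir" for x
      unfolding P_def f_def
      by (rule poly_bpoly[OF that])
        (rule knots_outside[OF ms, where d = p], use l cb no_index_inside_h[OF cell A hy] in auto)
    moreover have "poly (Q A) y = g A y" if "t jb < y" "y < t jt" for y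
      unfolding Q_def g_def
      by (rule poly_bpoly[OF that])
        (rule knots_outside[OF mt, where d = q], use l cb no_index_inside_v[OF cell A hx] in auto)
    ultimately show ?thesis using A xy by fastforce
  qed
  have BA: "B \<in> anchors p q T" using active[OF B] by blast
  \<comment> \<open>\<open>B\<close> is active, so its two pieces are nonzero and have knot spans
    around the element.\<close>
  obtain a where a: "a \<le> p" "s (hvec B ! a) \<le> s il" "s ir \<le> s (hvec B ! (a + 1))"
    using bpoly_nonzero[of "s il" "s ir" p "\<lambda>k. s (hvec B ! k)" 0] active[OF B] unfolding P_def by auto
  obtain b where b: "b \<le> q" "t (vvec B ! b) \<le> t jb" "t jt \<le> t (vvec B ! (b + 1))"
    using bpoly_nonzero[of "t jb" "t jt" q "\<lambda>k. t (vvec B ! k)" 0] active[OF B] unfolding Q_def by auto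
  define \<phi> where "\<phi> = dual a (\<lambda>k. s (hvec B ! k)) p 0"
  define \<psi> where "\<psi> = dual b (\<lambda>k. t (vvec B ! k)) q 0"
  have \<phi>: "\<phi> (P A) = (if hvec B = hvec A then 1 else 0)" if "A \<in> anchors p q T" "overlap (hvec B) (hvec A)" for A
    unfolding \<phi>_def P_def using lists[OF BA] lists[OF that(1)] that(2) pos a
    by (intro dual_overlap[OF ms]) auto
  have \<psi>: "\<psi> (Q A) = (if vvec B = vvec A then 1 else 0)" if "A \<in> anchors p q T" "overlap (vvec B) (vvec A)" for A
    unfolding \<psi>_def Q_def using lists[OF BA] lists[OF that(1)] that(2) pos b
    by (intro dual_overlap[OF mt]) auto
  \<comment> \<open>For fixed \<open>y\<close> the relation is one between polynomials in
    \<open>x\<close>. Applying \<phi> leaves a relation between polynomials in \<open>y\<close>, to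
    which \<psi> is applied afterwards.\<close>
  have "(\<Sum>A\<in>?AA. c A * poly (Q A) y * \<phi> (P A)) = 0" if y: "t jb < y" "y < t jt" for y
  proof -
    have "(\<Sum>A\<in>?AA. smult (c A * poly (Q A) y) (P A)) = 0"
    proof (rule poly_zero_on_interval[OF pos(1)])
      fix x assume x: "s il < x" "x < s ir"
      have "(x, y) \<in> parametric_domain s t E" using x y by (simp add: E')
      from bspec[OF zero this] have "(\<Sum>A\<in>?AA. c A * (f A x * g A y)) = 0" by (simp only: tsp)
      also have "(\<Sum>A\<in>?AA. c A * (f A x * g A y)) = (\<Sum>A\<in>?AA. c A * poly (Q A) y * poly (P A) x)"
        using active x y by (intro sum.cong) auto
      finally show "poly (\<Sum>A\<in>?AA. smult (c A * poly (Q A) y) (P A)) x = 0" by (simp add: poly_sum)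
    qed
    then have "\<phi> (\<Sum>A\<in>?AA. smult (c A * poly (Q A) y) (P A)) = 0" by (simp add: \<phi>_def dual_zero)
    then show ?thesis by (simp add: \<phi>_def dual_sum dual_smult)
  qed
  then have "(\<Sum>A\<in>?AA. smult (c A * \<phi> (P A)) (Q A)) = 0"
    by (intro poly_zero_on_interval[OF pos(2)]) (simp add: poly_sum mult_ac)
  then have "\<psi> (\<Sum>A\<in>?AA. smult (c A * \<phi> (P A)) (Q A)) = 0" by (simp add: \<psi>_def dual_zero)
  then have "0 = (\<Sum>A\<in>?AA. c A * \<phi> (P A) * \<psi> (Q A))" by (simp add: \<psi>_def dual_sum dual_smult)
  also have "\<dots> = (\<Sum>A\<in>?AA. if A = B then c B else 0)"
  proof (rule sum.cong)
    fix A assume "A \<in> ?AA"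
    then have A: "A \<in> anchors p q T" using active by blast
    show "c A * \<phi> (P A) * \<psi> (Q A) = (if A = B then c B else 0)"
    proof (cases "A = B")
      case True
      have "overlap (hvec B) (hvec B)" "overlap (vvec B) (vvec B)" by (auto simp: overlap_def)
      then show ?thesis using \<phi>[OF BA] \<psi>[OF BA] True by simp
    next
      case False
      \<comment> \<open>In a direction with overlapping and distinct windows the factor is 0;
        nothing is claimed about the other factor.\<close>
      then have "\<phi> (P A) = 0 \<or> \<psi> (Q A) = 0"
        using partial_overlap[OF BA A] \<phi>[OF A] \<psi>[OF A] by auto
      then show ?thesis using False by auto
    qed
  qed simp
  also have "\<dots> = c B"
  proof -
    have "finite ?AA" using finite_anchors by (rule finite_subset[rotated]) (auto simp: active_anchors_def)
    then show ?thesis using B by simp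
  qed
  finally show ?thesis by simp
qed

end

text \<open>Each alternative puts the point into the closure of a half-open strip outside the active
  region, so the boundary shared with the active region belongs to the frame. This makes the
  inequalities for T-junctions in \<open>mesh\<close> strict.\<close>

lemma frame_regionI:
  assumes "(x, y) \<in> index_domain T" "1 \<le> p" "1 \<le> q" "2 * p + 2 \<le> xdim T" "2 * q + 2 \<le> ydim T"
    and "x \<le> 1 + real ((p + 1) div 2) \<or> real (xdim T) - real ((p + 1) div 2) \<le> x
       \<or> y \<le> 1 + real ((q + 1) div 2) \<or> real (ydim T) - real ((q + 1) div 2) \<le> y"
  shows "(x, y) \<in> frame_region p q T"
proof -
  let ?m = "real (xdim T)" and ?n = "real (ydim T)" and ?k = "real ((p + 1) div 2)" and ?l = "real ((q + 1) div 2)"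
  have k: "0 < ?k" "?k + 1 < ?m" "0 < ?l" "?l + 1 < ?n" using assms(2-5) by linarith+
  have sub: "(x, y) \<in> frame_region p q T" if "(x, y) \<in> closure S" "S \<subseteq> index_domain T - active_region p q T" for S
    using that closure_mono unfolding frame_region_def by blast
  have xy: "1 \<le> x" "x \<le> ?m" "1 \<le> y" "y \<le> ?n" using assms(1) unfolding index_domain_def by auto
  consider "x \<le> 1 + ?k" | "?m - ?k \<le> x" | "y \<le> 1 + ?l" | "?n - ?l \<le> y" using assms(6) by blast
  then show ?thesis
  proof cases
    case 1
    then show ?thesis using xy k
      by (intro sub[of "{1..<1 + ?k} \<times> {1..?n}"]) (auto simp: closure_Times index_domain_def active_region_def)
  next
    case 2
    then show ?thesis using xy k
      by (intro sub[of "{?m - ?k<..?m} \<times> {1..?n}"]) (auto simp: closure_Times index_domain_def active_region_def)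
  next
    case 3
    then show ?thesis using xy k
      by (intro sub[of "{1..?m} \<times> {1..<1 + ?l}"]) (auto simp: closure_Times index_domain_def active_region_def)
  next
    case 4
    then show ?thesis using xy k
      by (intro sub[of "{1..?m} \<times> {?n - ?l<..?n}"]) (auto simp: closure_Times index_domain_def active_region_def)
  qed
qed

theorem theorem4p5:
  fixes p q :: nat and T :: tmesh and s t :: "nat \<Rightarrow> real"
  assumes "p \<ge> 1" and "q \<ge> 1"
    and "is_tmesh T" and "admissible p q T" and "analysis_suitable p q T"
    and "open_knot_vector p (xdim T) s" and "open_knot_vector q (ydim T) t"
  shows "\<forall>E \<in> bezier_elements p q T s t. \<forall>c :: ibox \<Rightarrow> real.
           (\<forall>z \<in> parametric_domain s t E.
              (\<Sum>A \<in> active_anchors p q T s t E. c A * tspline p q T s t A z) = 0)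
           \<longrightarrow> (\<forall>A \<in> active_anchors p q T s t E. c A = 0)"
proof -
  have dims: "2 * p + 2 \<le> xdim T" "2 * q + 2 \<le> ydim T"
    using assms(6,7) by (auto simp: open_knot_vector_def)
  interpret knot_mesh p q T s t
  proof
    fix i j assume t: "(i, j) \<in> tjunctions T"
    then have "(i, j) \<in> inner_vertices T" "valence T (i, j) \<noteq> 4" by (auto simp: tjunctions_def)
    then have "(real i, real j) \<notin> frame_region p q T" using assms(4) unfolding admissible_def by blast
    moreover have "(real i, real j) \<in> index_domain T"
      using \<open>(i, j) \<in> inner_vertices T\<close> by (auto simp: inner_vertices_def index_domain_def)
    ultimately have "\<not> (real i \<le> 1 + real ((p + 1) div 2) \<or> real (xdim T) - real ((p + 1) div 2) \<le> real i
       \<or> real j \<le> 1 + real ((q + 1) div 2) \<or> real (ydim T) - real ((q + 1) div 2) \<le> real j)"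
      using frame_regionI assms(1,2) dims by blast
    then show "(p + 1) div 2 + 1 < i \<and> i + (p + 1) div 2 < xdim T \<and> (q + 1) div 2 + 1 < j \<and> j + (q + 1) div 2 < ydim T"
      by linarith
  qed (use assms dims in \<open>auto simp: admissible_def\<close>)
  show ?thesis using local_independence by blast
qed

end
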